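(* Let $\alpha>0$, $\alpha\neq1$, and let $H_u:A^2(U^\alpha)\to L^2(U^\alpha)$ be a Hankel operator whose symbol $u$ (a measurable function on $U^\alpha$) satisfies, for some $p>4$, $$\sup_{z\in U^\alpha}\big\|u(z)-u\big(\varphi_{z_2}(\phi_{f_\alpha(z)}(w))\big)\big\|_{L^p(U^\alpha)}<\infty,$$ where the $L^p$ norm is taken in the variable $w$. Then $H_u$ is $L^2$-bounded, i.e. it is a bounded operator from $A^2(U^\alpha)$ to $L^2(U^\alpha)$.
   Context: $U^\alpha=\{z=(z_1,z_2)\in\mathbb C^2: |z_1|^{2/\alpha}+|z_2|^2<1\}$; $d\sigma$ is Lebesgue measure and $L^p(U^\alpha)=L^p(U^\alpha,d\sigma)$. $A^2(U^\alpha)$ is the Bergman space, the closed subspace of holomorphic functions in $L^2(U^\alpha)$, and $K_{U^\alpha}(z;\bar w)$ is its Bergman (reproducing) kernel. The Hankel operator with symbol $u$ is $H_uf=(I-P)(uf)$, $P$ the Bergman projection; equivalently, and as the definition when $u$ is unbounded, $H_uf(z)=\int_{U^\alpha}(u(z)-u(w))f(w)K_{U^\alpha}(z;\bar w)\,d\sigma(w)$. $\mathbb D$ is the open unit disc in $\mathbb C$. For $b\in\mathbb D$ define $\varphi_b:U^\alpha\to U^\alpha$ by $$\varphi_b(w_1,w_2)=\Big(w_1\Big(\tfrac{\sqrt{1-|b|^2}}{1-\bar b w_2}\Big)^\alpha,\ \tfrac{b-w_2}{1-\bar b w_2}\Big)$$ (principal branch of the power). For $a\in\mathbb D$ define $\phi_a:U^\alpha\to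 U^\alpha$ by $\phi_a(w)=(\phi^{(1)}(w),\phi^{(2)}(w))$, where $$\phi^{(1)}(w)=\frac{a-w_1}{1-\bar a w_1},\qquad \phi^{(2)}(w)=w_2\,\frac{\sqrt{1-|a|^2}}{1-\bar a w_1}\sqrt{\frac{(1-|w_1|^2)(1-|\phi^{(1)}(w)|^{2/\alpha})}{(1-|w_1|^{2/\alpha})(1-|\phi^{(1)}(w)|^2)}}.$$ For $z=(z_1,z_2)\in U^\alpha$ put $f_\alpha(z)=z_1/(1-|z_2|^2)^{\alpha/2}\in\mathbb D$. *)

theory Defs
  imports "HOL-Analysis.Analysis"
begin

definition Lp_space :: "real \<Rightarrow> 'a measure \<Rightarrow> ('a \<Rightarrow> complex) set" where
  "Lp_space p M = {g \<in> borel_measurable M. integrable M (\<lambda>x. norm (g x) powr p)}"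

definition Lp_norm :: "real \<Rightarrow> 'a measure \<Rightarrow> ('a \<Rightarrow> complex) \<Rightarrow> real" where
  "Lp_norm p M g = (LINT x|M. norm (g x) powr p) powr (1 / p)"

text \<open>Holomorphy in two variables: the real Frechet derivative exists and is complex linear.\<close>

definition holomorphic2_on :: "(complex \<times> complex \<Rightarrow> complex) \<Rightarrow> (complex \<times> complex) set \<Rightarrow> bool" where
  "holomorphic2_on f U \<longleftrightarrow>
     (\<forall>z\<in>U. \<exists>A B. (f has_derivative (\<lambda>h. A * fst h + B * snd h)) (at z))"

text \<open>Elements are total functions; only their values on \<open>U\<close> are relevant.\<close>

definition bergman_space :: "(complex \<times> complex) set \<Rightarrow> (complex \<times> complex \<Rightarrow> complex) set" where
  "bergman_space U = {f. holomorphic2_on f U \<and> f \<in> Lp_space 2 (lebesgue_on U)}"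

text \<open>\<open>bergman_kernel U z w\<close> is \<open>K(z; cnj w)\<close>, i.e. the value at \<open>z\<close> of the element of the
  Bergman space representing evaluation at \<open>w\<close>. Only meaningful for \<open>z\<close> and \<open>w\<close> in \<open>U\<close>.\<close>

definition bergman_kernel ::
    "(complex \<times> complex) set \<Rightarrow> complex \<times> complex \<Rightarrow> complex \<times> complex \<Rightarrow> complex" where
  "bergman_kernel U z w =
     (THE c. \<exists>k\<in>bergman_space U.
        (\<forall>f\<in>bergman_space U. f w = (LINT x|lebesgue_on U. f x * cnj (k x))) \<and> c = k z)"

definition hankel_integrand ::
    "(complex \<times> complex) set \<Rightarrow> (complex \<times> complex \<Rightarrow> complex) \<Rightarrow> (complex \<times> complex \<Rightarrow> complex)
      \<Rightarrow> complex \<times> complex \<Rightarrow> complex \<times> complex \<Rightarrow> complex" where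
  "hankel_integrand U u f z w = (u z - u w) * f w * bergman_kernel U z w"

definition hankel ::
    "(complex \<times> complex) set \<Rightarrow> (complex \<times> complex \<Rightarrow> complex) \<Rightarrow> (complex \<times> complex \<Rightarrow> complex)
      \<Rightarrow> complex \<times> complex \<Rightarrow> complex" where
  "hankel U u f z = (LINT w|lebesgue_on U. hankel_integrand U u f z w)"

text \<open>The integrability clause makes the operator genuinely defined (the Bochner integral of a
  non-integrable function is 0 by convention); linearity up to null sets then follows from
  linearity of the integral.\<close>

definition hankel_bounded ::
    "(complex \<times> complex) set \<Rightarrow> (complex \<times> complex \<Rightarrow> complex) \<Rightarrow> bool" where
  "hankel_bounded U u \<longleftrightarrow>
     (\<exists>C. \<forall>f\<in>bergman_space U.
        (AE z in lebesgue_on U. integrable (lebesgue_on U) (hankel_integrand U u f z)) \<and>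
        hankel U u f \<in> Lp_space 2 (lebesgue_on U) \<and>
        Lp_norm 2 (lebesgue_on U) (hankel U u f) \<le> C * Lp_norm 2 (lebesgue_on U) f)"

definition U_dom :: "real \<Rightarrow> (complex \<times> complex) set" where
  "U_dom \<alpha> = {z. norm (fst z) powr (2 / \<alpha>) + (norm (snd z))\<^sup>2 < 1}"

definition varphi_map :: "real \<Rightarrow> complex \<Rightarrow> complex \<times> complex \<Rightarrow> complex \<times> complex" where
  "varphi_map \<alpha> b w =
     (fst w * (of_real (sqrt (1 - (norm b)\<^sup>2)) / (1 - cnj b * snd w)) powr of_real \<alpha>,
      (b - snd w) / (1 - cnj b * snd w))"

definition phi_fst :: "complex \<Rightarrow> complex \<times> complex \<Rightarrow> complex" where
  "phi_fst a w = (a - fst w) / (1 - cnj a * fst w)"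

definition phi_snd :: "real \<Rightarrow> complex \<Rightarrow> complex \<times> complex \<Rightarrow> complex" where
  "phi_snd \<alpha> a w =
     snd w * (of_real (sqrt (1 - (norm a)\<^sup>2)) / (1 - cnj a * fst w)) *
     of_real (sqrt (((1 - (norm (fst w))\<^sup>2) * (1 - norm (phi_fst a w) powr (2 / \<alpha>))) /
                    ((1 - norm (fst w) powr (2 / \<alpha>)) * (1 - (norm (phi_fst a w))\<^sup>2))))"

definition phi_map :: "real \<Rightarrow> complex \<Rightarrow> complex \<times> complex \<Rightarrow> complex \<times> complex" where
  "phi_map \<alpha> a w = (phi_fst a w, phi_snd \<alpha> a w)"

definition f_fun :: "real \<Rightarrow> complex \<times> complex \<Rightarrow> complex" where
  "f_fun \<alpha> z = fst z / of_real ((1 - (norm (snd z))\<^sup>2) powr (\<alpha> / 2))"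

definition oscillation ::
    "real \<Rightarrow> (complex \<times> complex \<Rightarrow> complex) \<Rightarrow> complex \<times> complex \<Rightarrow> complex \<times> complex \<Rightarrow> complex" where
  "oscillation \<alpha> u z w = u z - u (varphi_map \<alpha> (snd z) (phi_map \<alpha> (f_fun \<alpha> z) w))"

end

theory Submission
  imports Defs "HOL-Complex_Analysis.Complex_Analysis"
begin

text \<open>
Write \<open>f z = z1 / (1 - |z2|^2)^(\<alpha>/2)\<close> for the normalised first coordinate. The Bergman kernel is
explicit: with \<open>T = z1 cnj w1 / (1 - z2 cnj w2)^\<alpha>\<close> it is
\<open>F(T) / (\<pi>^2 (1 - z2 cnj w2)^(2+\<alpha>))\<close>, where \<open>F(s) = ((1 - s) + \<alpha> (1 + s)) / (1 - s)^3\<close>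
(lemma \<open>bergman_kernel_U_dom\<close>). Its modulus is therefore at most a constant times the symmetric function
\<open>k(z,w) = |1 - z2 cnj w2|^-(2+\<alpha>) |1 - T|^-3\<close>. The kernel \<open>|u(z) - u(w)| k(z,w)\<close> is symmetric too,
so Schur's test needs a single inequality:
\<open>\<integral> |u(z) - u(w)| k(z,w) h(w) dw \<le> C h(z)\<close> for some positive \<open>h\<close>.

The hypothesis on \<open>u\<close> enters through the substitution \<open>w = \<Phi>(\<zeta>)\<close>, where \<open>\<Phi>\<close> is the composition of
\<open>varphi\<close> at \<open>z2\<close> with \<open>phi\<close> at \<open>f z\<close>. Each of the two maps is a Moebius involution in one coordinate
and linear along the fibres over that coordinate, so its Jacobian is explicit although \<open>phi\<close> is not holomorphic. The
Jacobian of the inverse of \<open>\<Phi>\<close> turns out to be bounded below by a constant times \<open>k(z,w)^2 / k(z,z)\<close>, as for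
an automorphism; hence \<open>\<integral> |u(z) - u(w)|^p k(z,w)^2 / k(z,z) dw\<close> is bounded uniformly in \<open>z\<close>
(lemma \<open>nn_integral_kernel_weight_le\<close>).

Young's inequality with exponents \<open>p\<close> and \<open>q = p / (p - 1)\<close> removes \<open>u\<close> and reduces Schur's inequality
to a statement about the kernel alone, \<open>\<integral> k(z,w)^(2-q) h(w)^q dw \<le> C k(z,z)^(1-q) h(z)^q\<close>
(lemma \<open>schur_kernel_estimate\<close>). For \<open>h^q = (1 - |z2|^2)^(-a) (1 - |f z|^2)^(-b)\<close> the integral over the
normalised first coordinate is of Forelli-Rudin type and leaves an integral over \<open>w2\<close> that a Moebius substitution
centred at \<open>z2\<close> brings to the same type. This works for \<open>3 (q - 1) < b < 1\<close> and
\<open>(2 + \<alpha>) (q - 1) < a < 1 + \<alpha>\<close>. Such exponents exist as soon as \<open>q < 4/3\<close>, that is \<open>p > 4\<close>.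

The formula for the kernel is verified directly. The automorphism \<open>varphi\<close> moves \<open>w\<close> to a point \<open>(t, 0)\<close>,
the mean value property integrates out the second coordinate, and what remains is a reproducing formula on the disc for
the weight \<open>1 - |x|^(2/\<alpha>)\<close>, which is read off from Taylor coefficients.
\<close>

section \<open>Changes of variables in the plane\<close>

lemma lborel_real2_eq_distr_complex:
  "(lborel :: (real^2) measure) = distr lborel borel (\<lambda>z::complex. vector [Re z, Im z])"
proof (rule lborel_eqI)
  have meas: "(\<lambda>z::complex. vector [Re z, Im z] :: real^2) \<in> borel_measurable borel"
  proof -
    have "linear (\<lambda>z::complex. vector [Re z, Im z] :: real^2)"
      by (rule linearI) (simp_all add: vec_eq_iff forall_2)
    then show ?thesis
      by (intro borel_measurable_continuous_onI linear_continuous_on)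
         (simp add: linear_conv_bounded_linear)
  qed
  fix l u :: "real^2" assume lu: "\<And>b. b \<in> Basis \<Longrightarrow> l \<bullet> b \<le> u \<bullet> b"
  have lu': "l $ i \<le> u $ i" for i
    using lu[of "axis i 1"] by (auto simp: inner_axis Basis_vec_def)
  have "(\<lambda>z::complex. vector [Re z, Im z] :: real^2) -` box l u =
        box (Complex (l$1) (l$2)) (Complex (u$1) (u$2))"
    by (auto simp: box_def Basis_vec_def Basis_complex_def forall_2 inner_axis)
  then have "emeasure (distr lborel borel (\<lambda>z::complex. vector [Re z, Im z] :: real^2)) (box l u) =
     emeasure lborel (box (Complex (l$1) (l$2)) (Complex (u$1) (u$2)))"
    using meas by (subst emeasure_distr) auto
  also have "\<dots> = (\<Prod>b\<in>Basis. (Complex (u$1) (u$2) - Complex (l$1) (l$2)) \<bullet> b)"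
    using lu' by (subst emeasure_lborel_box) (auto simp: Basis_complex_def)
  also have "\<dots> = (\<Prod>b\<in>Basis. (u - l) \<bullet> b)"
    by (simp add: Basis_complex_def Basis_vec_def UNIV_2 inner_axis axis_eq_axis inner_diff_left mult.commute)
  finally show "emeasure (distr lborel borel (\<lambda>z::complex. vector [Re z, Im z] :: real^2)) (box l u) =
     ennreal (\<Prod>b\<in>Basis. (u - l) \<bullet> b)" .
qed simp

lemma lborel_complex_eq_distr_pair:
  "(lborel :: complex measure) = distr (lborel \<Otimes>\<^sub>M lborel) borel (\<lambda>(x,y). Complex x y)"
proof (rule lborel_eqI)
  have meas: "(\<lambda>(x,y). Complex x y) \<in> borel_measurable (lborel \<Otimes>\<^sub>M lborel)"
    unfolding lborel_prod case_prod_beta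
    by (auto intro!: borel_measurable_continuous_onI continuous_intros simp: )
  fix l u :: complex assume lu: "\<And>b. b \<in> Basis \<Longrightarrow> l \<bullet> b \<le> u \<bullet> b"
  have "(\<lambda>(x,y). Complex x y) -` box l u = box (Re l, Im l) (Re u, Im u)"
    by (auto simp: box_def Basis_complex_def Basis_prod_def)
  then show "emeasure (distr (lborel \<Otimes>\<^sub>M lborel) borel (\<lambda>(x,y). Complex x y)) (box l u) =
     ennreal (\<Prod>b\<in>Basis. (u - l) \<bullet> b)"
    using meas lu[of 1] lu[of \<i>]
    by (simp add: emeasure_distr lborel_prod emeasure_lborel_box_eq Basis_complex_def Basis_prod_def
        ball_Un mult.commute)
qed simp

text \<open>The real Jacobian determinant of a holomorphic map is the squared modulus of its
derivative, so this is the change of variables theorem in the plane, transported along the isometry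
\<open>z \<mapsto> (Re z, Im z)\<close>.\<close>

lemma emeasure_holomorphic_image:
  fixes g g' :: "complex \<Rightarrow> complex"
  assumes T[measurable]: "T \<in> sets borel" and gT[measurable]: "g ` T \<in> sets borel"
    and g': "g' \<in> borel_measurable borel"
    and der: "\<And>z. z \<in> T \<Longrightarrow> (g has_field_derivative g' z) (at z)"
    and inj: "inj_on g T"
  shows "emeasure lborel (g ` T) = (\<integral>\<^sup>+z\<in>T. ennreal ((cmod (g' z))\<^sup>2) \<partial>lborel)"
proof -
  define L :: "complex \<Rightarrow> real^2" where "L = (\<lambda>z. vector [Re z, Im z])"
  define K :: "real^2 \<Rightarrow> complex" where "K = (\<lambda>x. Complex (x$1) (x$2))"
  have KL[simp]: "K (L z) = z" for z by (simp add: K_def L_def)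
  have LK[simp]: "L (K x) = x" for x by (simp add: K_def L_def vec_eq_iff forall_2)
  have L_lin: "linear L"
    by (rule linearI) (simp_all add: L_def vec_eq_iff forall_2)
  have K_lin: "linear K"
    by (rule linearI) (simp_all add: K_def complex_eq_iff)
  have [measurable]: "L \<in> borel_measurable borel" "K \<in> borel_measurable borel"
    using L_lin K_lin linear_continuous_on[OF linear_conv_bounded_linear[THEN iffD1]]
    by (auto intro!: borel_measurable_continuous_onI)
  have distr: "lborel = distr lborel borel L"
    unfolding L_def by (rule lborel_real2_eq_distr_complex)
  have im: "L ` S = K -` S" for S
    by (auto simp: image_iff) (metis LK)
  have em: "emeasure lborel (L ` S) = emeasure lborel S" if [measurable]: "S \<in> sets borel" for S
  proof -
    have "L -` L ` S = S" by (auto) (metis KL)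
    moreover have "L ` S \<in> sets borel"
      unfolding im using measurable_sets[of K borel borel S] by simp
    ultimately show ?thesis by (subst distr) (simp add: emeasure_distr)
  qed
  have sL[measurable]: "L ` S \<in> sets borel" if [measurable]: "S \<in> sets borel" for S
    unfolding im using measurable_sets[of K borel borel S] by simp
  define G where "G = L \<circ> g \<circ> K"
  define G' where "G' = (\<lambda>x h. L (g' (K x) * K h))"
  have derG: "(G has_derivative G' x) (at x within L ` T)" if "x \<in> L ` T" for x
  proof -
    have 1: "(K has_derivative K) (at x within L ` T)"
      using K_lin by (intro bounded_linear_imp_has_derivative) (simp add: linear_conv_bounded_linear)
    have "K x \<in> T" using that by auto
    from der[OF this] have "(g has_derivative (\<lambda>h. g' (K x) * h)) (at (K x))"
      by (simp add: has_field_derivative_def)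
    then have 2: "(g has_derivative (\<lambda>h. g' (K x) * h)) (at (K x) within K ` L ` T)"
      by (rule has_derivative_at_withinI)
    have 3: "(L has_derivative L) (at (g (K x)) within g ` K ` L ` T)"
      using L_lin by (intro bounded_linear_imp_has_derivative) (simp add: linear_conv_bounded_linear)
    from diff_chain_within[OF diff_chain_within[OF 1 2]] 3 show ?thesis
      by (simp add: G_def G'_def o_def image_image)
  qed
  have det: "\<bar>det (matrix (G' x))\<bar> = (cmod (g' (K x)))\<^sup>2" for x
    by (simp add: det_2 matrix_def G'_def L_def K_def axis_def)
       (simp add: cmod_power2 flip: power2_eq_square)
  have injG: "inj_on G (L ` T)"
    unfolding G_def using inj by (auto simp: inj_on_def) (metis KL)+
  have GT: "G ` L ` T = L ` g ` T" by (auto simp: G_def image_image)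
  have Tleb: "L ` T \<in> sets lebesgue" by simp
  note iff = has_measure_differentiable_image[OF Tleb derG injG, unfolded det GT]
  have e1: "(\<integral>\<^sup>+z\<in>T. ennreal ((cmod (g' z))\<^sup>2) \<partial>lborel) =
        (\<integral>\<^sup>+x. ennreal (indicator (L ` T) x * (cmod (g' (K x)))\<^sup>2) \<partial>lborel)"
    using g' by (subst distr, subst nn_integral_distr)
       (auto intro!: nn_integral_cong simp: indicator_def ennreal_mult'' im)
  show ?thesis
  proof (cases "emeasure lborel (g ` T) < \<infinity>")
    case True
    then have lm: "L ` g ` T \<in> lmeasurable"
      by (simp add: em fmeasurable_def)
    with iff have hi: "((\<lambda>x. (cmod (g' (K x)))\<^sup>2) has_integral measure lebesgue (L ` g ` T)) (L ` T)"
      by blast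
    have "(\<integral>\<^sup>+x. ennreal (indicator (L ` T) x * (cmod (g' (K x)))\<^sup>2) \<partial>lborel) = measure lebesgue (L ` g ` T)"
      by (rule nn_integral_has_integral_lebesgue[OF _ hi]) auto
    also have "\<dots> = emeasure lebesgue (L ` g ` T)"
      using lm by (simp add: emeasure_eq_measure2)
    finally show ?thesis using e1 by (simp add: em)
  next
    case False
    have "\<not> (\<integral>\<^sup>+x. ennreal (indicator (L ` T) x * (cmod (g' (K x)))\<^sup>2) \<partial>lborel) < \<infinity>"
    proof
      assume *: "(\<integral>\<^sup>+x. ennreal (indicator (L ` T) x * (cmod (g' (K x)))\<^sup>2) \<partial>lborel) < \<infinity>"
      then obtain r where r: "0 \<le> r" "(\<integral>\<^sup>+x. ennreal (indicator (L ` T) x * (cmod (g' (K x)))\<^sup>2) \<partial>lborel) = ennreal r"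
        by (cases "(\<integral>\<^sup>+x. ennreal (indicator (L ` T) x * (cmod (g' (K x)))\<^sup>2) \<partial>lborel)" rule: ennreal_cases) auto
      have "((\<lambda>x. indicator (L ` T) x * (cmod (g' (K x)))\<^sup>2) has_integral r) UNIV"
        using g' r by (intro nn_integral_has_integral) auto
      then have "((\<lambda>x. (cmod (g' (K x)))\<^sup>2) has_integral r) (L ` T)"
      proof -
        have "(\<lambda>x. if x \<in> L ` T then (cmod (g' (K x)))\<^sup>2 else 0) =
              (\<lambda>x. indicator (L ` T) x * (cmod (g' (K x)))\<^sup>2)"
          by (auto simp: indicator_def fun_eq_iff)
        with \<open>(_ has_integral r) UNIV\<close> show ?thesis
          by (subst has_integral_restrict_UNIV[symmetric]) (simp only:)
      qed
      with iff have "L ` g ` T \<in> lmeasurable" by blast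
      then show False using False by (auto simp: em fmeasurable_def)
    qed
    then show ?thesis using False e1 by (simp add: less_top[symmetric])
  qed
qed

lemma nn_integral_holomorphic_substitution:
  fixes g g' :: "complex \<Rightarrow> complex" and f :: "complex \<Rightarrow> ennreal"
  assumes S[measurable]: "S \<in> sets borel" and gS[measurable]: "g ` S \<in> sets borel"
    and [measurable]: "g \<in> borel_measurable borel" "g' \<in> borel_measurable borel"
      "f \<in> borel_measurable borel"
    and der: "\<And>z. z \<in> S \<Longrightarrow> (g has_field_derivative g' z) (at z)"
    and inj: "inj_on g S"
  shows "(\<integral>\<^sup>+z\<in>S. f (g z) * ennreal ((cmod (g' z))\<^sup>2) \<partial>lborel) =
         (\<integral>\<^sup>+w\<in>g ` S. f w \<partial>lborel)"
proof -
  have eq: "distr (density lborel (\<lambda>z. ennreal ((cmod (g' z))\<^sup>2) * indicator S z)) borel g =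
        density lborel (indicator (g ` S))"
  proof (rule measure_eqI)
    fix A assume "A \<in> sets (distr (density lborel (\<lambda>z. ennreal ((cmod (g' z))\<^sup>2) * indicator S z)) borel g)"
    then have A[measurable]: "A \<in> sets borel" by simp
    have im: "g ` (S \<inter> g -` A) = A \<inter> g ` S" by auto
    have [measurable]: "S \<inter> g -` A \<in> sets borel"
      using measurable_sets[of g borel borel A] by auto
    have "emeasure (distr (density lborel (\<lambda>z. ennreal ((cmod (g' z))\<^sup>2) * indicator S z)) borel g) A =
       (\<integral>\<^sup>+z\<in>S \<inter> g -` A. ennreal ((cmod (g' z))\<^sup>2) \<partial>lborel)"
      using measurable_sets[of g borel borel A]
      by (subst emeasure_distr) (auto simp: emeasure_density intro!: nn_integral_cong split: split_indicator)
    also have "\<dots> = emeasure lborel (A \<inter> g ` S)"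
      using emeasure_holomorphic_image[of "S \<inter> g -` A" g g'] der inj_on_subset[OF inj, of "S \<inter> g -` A"]
      by (simp add: im)
    also have "\<dots> = emeasure (density lborel (indicator (g ` S))) A"
      by (subst emeasure_density) (auto simp: nn_integral_indicator[symmetric] simp del: nn_integral_indicator
          intro!: nn_integral_cong split: split_indicator)
    finally show "emeasure (distr (density lborel (\<lambda>z. ennreal ((cmod (g' z))\<^sup>2) * indicator S z)) borel g) A =
      emeasure (density lborel (indicator (g ` S))) A" .
  qed simp
  have "(\<integral>\<^sup>+z\<in>S. f (g z) * ennreal ((cmod (g' z))\<^sup>2) \<partial>lborel) =
     (\<integral>\<^sup>+w. f w \<partial>distr (density lborel (\<lambda>z. ennreal ((cmod (g' z))\<^sup>2) * indicator S z)) borel g)"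
    by (subst nn_integral_distr) (auto simp: nn_integral_density mult_ac)
  also have "\<dots> = (\<integral>\<^sup>+w\<in>g ` S. f w \<partial>lborel)"
    unfolding eq by (subst nn_integral_density) (auto simp: mult_ac)
  finally show ?thesis .
qed

lemma nn_integral_complex_scale:
  fixes f :: "complex \<Rightarrow> ennreal"
  assumes [measurable]: "f \<in> borel_measurable borel" and "c \<noteq> 0"
  shows "(\<integral>\<^sup>+z. f (c * z) \<partial>lborel) * ennreal ((cmod c)\<^sup>2) = (\<integral>\<^sup>+w. f w \<partial>lborel)"
proof -
  have im: "range ((*) c) = UNIV" using assms(2) by (auto simp: image_iff intro!: exI[of _ "_ / c"])
  have "(\<integral>\<^sup>+z\<in>UNIV. f (c * z) * ennreal ((cmod c)\<^sup>2) \<partial>lborel) =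
    (\<integral>\<^sup>+w\<in>range ((*) c). f w \<partial>lborel)"
    using assms(2)
    by (intro nn_integral_holomorphic_substitution) (auto simp: im inj_on_def intro!: derivative_eq_intros)
  then show ?thesis by (simp add: im nn_integral_multc)
qed

section \<open>Moebius involutions of the disc\<close>

text \<open>The automorphism of the disc that exchanges \<open>0\<close> and \<open>a\<close>; it is an involution.\<close>

definition moebius :: "complex \<Rightarrow> complex \<Rightarrow> complex" where
  "moebius a w = (a - w) / (1 - cnj a * w)"

lemma measurable_cnj [measurable]: "cnj \<in> borel_measurable borel"
  by (intro borel_measurable_continuous_onI continuous_intros)

lemma measurable_ball [measurable]: "ball (a :: 'a :: metric_space) r \<in> sets borel"
  by simp

lemma measurable_moebius [measurable]: "moebius a \<in> borel_measurable borel"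
  unfolding moebius_def by measurable

lemma one_minus_cnj_mult_lower:
  assumes "cmod a \<le> 1" shows "1 - cmod w \<le> cmod (1 - cnj a * w)"
proof -
  have "cmod (cnj a * w) \<le> 1 * cmod w" using assms by (simp only: norm_mult complex_mod_cnj) (intro mult_right_mono, auto)
  then show ?thesis using norm_triangle_ineq2[of 1 "cnj a * w"] by simp
qed

lemma one_minus_cnj_mult_nonzero:
  assumes "cmod a < 1" "cmod w < 1" shows "1 - cnj a * w \<noteq> 0"
  using one_minus_cnj_mult_lower[of a w] assms by auto

lemma one_minus_norm_sq_pos: "cmod a < 1 \<Longrightarrow> 0 < 1 - (cmod a)\<^sup>2"
  by (simp add: abs_square_less_1)

lemma one_minus_norm_sq_cnj: "1 - complex_of_real ((cmod a)\<^sup>2) = 1 - cnj a * a"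
  by (metis complex_norm_square mult.commute)

lemma one_minus_norm_moebius:
  assumes "cmod a < 1" "cmod w < 1"
  shows "1 - (cmod (moebius a w))\<^sup>2 = (1 - (cmod a)\<^sup>2) * (1 - (cmod w)\<^sup>2) / (cmod (1 - cnj a * w))\<^sup>2"
proof -
  have nz: "(cmod (1 - cnj a * w))\<^sup>2 \<noteq> 0" using one_minus_cnj_mult_nonzero[OF assms] by simp
  have "(cmod (1 - cnj a * w))\<^sup>2 - (cmod (a - w))\<^sup>2 = (1 - (cmod a)\<^sup>2) * (1 - (cmod w)\<^sup>2)"
    by (simp add: cmod_power2) (simp add: algebra_simps power2_eq_square)
  then show ?thesis using nz by (simp add: moebius_def norm_divide power_divide field_simps)
qed

lemma moebius_in_disc:
  assumes "cmod a < 1" "cmod w < 1" shows "cmod (moebius a w) < 1"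
proof -
  have "0 < 1 - (cmod (moebius a w))\<^sup>2"
    unfolding one_minus_norm_moebius[OF assms]
    using one_minus_norm_sq_pos assms one_minus_cnj_mult_nonzero[OF assms] by simp
  then show ?thesis by (simp add: abs_square_less_1)
qed

lemma one_minus_cnj_mult_moebius:
  assumes "cmod a < 1" "cmod w < 1"
  shows "1 - cnj a * moebius a w = of_real (1 - (cmod a)\<^sup>2) / (1 - cnj a * w)"
  using one_minus_cnj_mult_nonzero[OF assms] one_minus_norm_sq_cnj[of a]
  by (simp add: moebius_def field_simps)

lemma moebius_moebius:
  assumes "cmod a < 1" "cmod w < 1" shows "moebius a (moebius a w) = w"
proof -
  have nz: "1 - cnj a * w \<noteq> 0" by (rule one_minus_cnj_mult_nonzero[OF assms])
  have nz2: "1 - cnj a * a \<noteq> 0" by (rule one_minus_cnj_mult_nonzero[OF assms(1,1)])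
  have "a - moebius a w = w * (1 - cnj a * a) / (1 - cnj a * w)"
    using nz by (simp add: moebius_def field_simps)
  moreover have "1 - cnj a * moebius a w = (1 - cnj a * a) / (1 - cnj a * w)"
    using one_minus_cnj_mult_moebius[OF assms] one_minus_norm_sq_cnj[of a] by simp
  ultimately show ?thesis using nz nz2 by (simp add: moebius_def[of a "moebius a w"])
qed

lemma moebius_has_field_derivative:
  assumes "cmod a < 1" "cmod w < 1"
  shows "(moebius a has_field_derivative - of_real (1 - (cmod a)\<^sup>2) / (1 - cnj a * w)\<^sup>2) (at w)"
  unfolding moebius_def using one_minus_cnj_mult_nonzero[OF assms] one_minus_norm_sq_cnj[of a]
  by (auto intro!: derivative_eq_intros simp: field_simps power2_eq_square)

lemma moebius_image_disc:
  assumes "cmod a < 1" shows "moebius a ` ball 0 1 = ball 0 1"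
proof
  show "moebius a ` ball 0 1 \<subseteq> ball 0 1" using moebius_in_disc[OF assms] by auto
  show "ball 0 1 \<subseteq> moebius a ` ball 0 1"
  proof
    fix w :: complex assume "w \<in> ball 0 1"
    then show "w \<in> moebius a ` ball 0 1"
      using moebius_in_disc[OF assms, of w] moebius_moebius[OF assms, of w] by (intro image_eqI[of _ _ "moebius a w"]) auto
  qed
qed

text \<open>The involution maps the disc onto itself and is its own inverse, so the Jacobian can be put on the
side without the composition.\<close>

lemma nn_integral_disc_moebius:
  fixes f :: "complex \<Rightarrow> ennreal"
  assumes a: "cmod a < 1" and [measurable]: "f \<in> borel_measurable borel"
  shows "(\<integral>\<^sup>+w\<in>ball 0 1. f (moebius a w) \<partial>lborel) =
    (\<integral>\<^sup>+w\<in>ball 0 1. f w * ennreal (((1 - (cmod a)\<^sup>2) / (cmod (1 - cnj a * w))\<^sup>2)\<^sup>2) \<partial>lborel)"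
proof -
  define g' where "g' = (\<lambda>w. - complex_of_real (1 - (cmod a)\<^sup>2) / (1 - cnj a * w)\<^sup>2)"
  have inj: "inj_on (moebius a) (ball 0 1)"
    by (rule inj_on_inverseI[of _ "moebius a"]) (use moebius_moebius[OF a] in auto)
  have "(\<integral>\<^sup>+w\<in>ball 0 1. f (moebius a w) \<partial>lborel) =
        (\<integral>\<^sup>+w\<in>moebius a ` ball 0 1. f (moebius a w) \<partial>lborel)"
    by (simp add: moebius_image_disc[OF a])
  also have "\<dots> = (\<integral>\<^sup>+w\<in>ball 0 1. f (moebius a (moebius a w)) * ennreal ((cmod (g' w))\<^sup>2) \<partial>lborel)"
    using moebius_has_field_derivative[OF a]
    by (subst nn_integral_holomorphic_substitution[OF _ _ _ _ _ _ inj, of g'])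
       (auto simp: moebius_image_disc[OF a] g'_def)
  also have "\<dots> = (\<integral>\<^sup>+w\<in>ball 0 1. f w * ennreal (((1 - (cmod a)\<^sup>2) / (cmod (1 - cnj a * w))\<^sup>2)\<^sup>2) \<partial>lborel)"
    by (intro nn_integral_cong)
       (auto simp: moebius_moebius[OF a] g'_def norm_divide norm_power power_divide simp flip: of_real_power
          split: split_indicator simp del: of_real_diff)
  finally show ?thesis .
qed

section \<open>Forelli-Rudin integrals over the disc\<close>

lemma nn_integral_powr_Ioo:
  fixes b x :: real
  assumes "b > -1" "0 \<le> x"
  shows "(\<integral>\<^sup>+t\<in>{0<..<x}. ennreal (t powr b) \<partial>lborel) = ennreal (x powr (b + 1) / (b + 1))"
proof -
  have "((\<lambda>t. t powr b) has_integral x powr (b + 1) / (b + 1)) {0..x}"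
    using assms by (rule has_integral_powr_from_0)
  then have "(\<integral>\<^sup>+t. ennreal (indicator {0..x} t * t powr b) \<partial>lborel) = ennreal (x powr (b + 1) / (b + 1))"
    by (intro nn_integral_has_integral_lebesgue) auto
  moreover have "(\<integral>\<^sup>+t. ennreal (indicator {0..x} t * t powr b) \<partial>lborel) =
      (\<integral>\<^sup>+t\<in>{0<..<x}. ennreal (t powr b) \<partial>lborel)"
    using AE_lborel_singleton[of "0::real"] AE_lborel_singleton[of x]
    by (intro nn_integral_cong_AE) (auto split: split_indicator)
  ultimately show ?thesis by simp
qed

text \<open>A substitute for polar coordinates: homogeneity makes the \<open>W\<close>-mass of a disc a constant multiple of a
power of its radius, and these masses determine the image of the measure with density \<open>W\<close> under the squared
modulus.\<close>

lemma nn_integral_radial: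
  fixes W :: "complex \<Rightarrow> real" and g :: "real \<Rightarrow> ennreal"
  assumes W[measurable]: "W \<in> borel_measurable borel" and W0: "\<And>v. 0 \<le> W v"
    and hom: "\<And>r v. 0 < r \<Longrightarrow> W (of_real r * v) = r powr (- s) * W v"
    and s: "s < 2" and A: "0 \<le> A" "(\<integral>\<^sup>+v\<in>ball 0 1. ennreal (W v) \<partial>lborel) = ennreal A"
    and g[measurable]: "g \<in> borel_measurable borel"
  shows "(\<integral>\<^sup>+v. g ((cmod v)\<^sup>2) * ennreal (W v) \<partial>lborel) =
     ennreal ((1 - s / 2) * A) * (\<integral>\<^sup>+t\<in>{0<..}. g t * ennreal (t powr (- s / 2)) \<partial>lborel)"
proof -
  have ball: "(\<integral>\<^sup>+v\<in>ball 0 r. ennreal (W v) \<partial>lborel) = ennreal (r powr (2 - s) * A)"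
    if r: "0 < r" for r
  proof -
    have "(\<integral>\<^sup>+v\<in>ball 0 r. ennreal (W v) \<partial>lborel) =
       (\<integral>\<^sup>+v. ennreal (W (of_real r * v)) * indicator (ball 0 r) (of_real r * v) \<partial>lborel) *
         ennreal ((cmod (of_real r))\<^sup>2)"
      apply (rule nn_integral_complex_scale[symmetric])
      subgoal by measurable
      subgoal using r by simp
      done
    also have "(\<integral>\<^sup>+v. ennreal (W (of_real r * v)) * indicator (ball 0 r) (of_real r * v) \<partial>lborel) =
       (\<integral>\<^sup>+v. ennreal (r powr (- s)) * (ennreal (W v) * indicator (ball 0 1) v) \<partial>lborel)"
      using r W0 by (intro nn_integral_cong) (auto simp: hom ennreal_mult norm_mult split: split_indicator)
    also have "\<dots> = ennreal (r powr (- s) * A)"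
    proof -
      have "(\<lambda>v. ennreal (W v) * indicator (ball 0 1) v) \<in> borel_measurable lborel" by measurable
      then show ?thesis unfolding nn_integral_cmult[OF \<open>(\<lambda>v. ennreal (W v) * indicator (ball 0 1) v) \<in> borel_measurable lborel\<close>] A(2)
        using A(1) by (simp add: ennreal_mult)
    qed
    also have "ennreal (r powr (- s) * A) * ennreal ((cmod (of_real r))\<^sup>2) = ennreal (r powr (2 - s) * A)"
      using r A by (simp add: ennreal_mult[symmetric] powr_diff powr_minus field_simps flip: powr_numeral)
    finally show ?thesis .
  qed
  \<comment> \<open>With the minus sign the half-lines \<open>{x<..}\<close> pull back to discs, which have finite mass.\<close>
  define M where "M = distr (density lborel (\<lambda>v. ennreal (W v))) borel (\<lambda>v. - (cmod v)\<^sup>2)"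
  define N where "N = distr (density lborel
     (\<lambda>t. ennreal ((1 - s / 2) * A) * (ennreal (t powr (- s / 2)) * indicator {0<..} t))) borel uminus"
  have emM: "emeasure M {x<..} = (if x < 0 then ennreal ((- x) powr (1 - s / 2) * A) else 0)" for x
  proof -
    have "emeasure M {x<..} = (\<integral>\<^sup>+v. ennreal (W v) * indicator {v. (cmod v)\<^sup>2 < - x} v \<partial>lborel)"
    proof -
      have "(\<lambda>v. - (cmod v)\<^sup>2) -` {x<..} = {v. (cmod v)\<^sup>2 < - x}" by auto
      moreover have "{v. (cmod v)\<^sup>2 < - x} \<in> sets borel" by measurable
      ultimately show ?thesis unfolding M_def by (subst emeasure_distr) (auto simp: emeasure_density)
    qed
    also have "\<dots> = (if x < 0 then ennreal ((- x) powr (1 - s / 2) * A) else 0)"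
    proof (cases "x < 0")
      case True
      have "{v. (cmod v)\<^sup>2 < - x} = ball 0 (sqrt (- x))"
        using True by (auto simp: real_less_rsqrt) (metis norm_ge_zero real_sqrt_less_iff real_sqrt_pow2 real_sqrt_abs abs_of_nonneg real_sqrt_less_mono)+
      moreover have "sqrt (- x) powr (2 - s) = (- x) powr (1 - s / 2)"
        using True by (simp add: powr_half_sqrt[symmetric] powr_powr diff_divide_distrib)
      ultimately show ?thesis using True ball[of "sqrt (- x)"] by simp
    next
      case False
      then have "{v. (cmod v)\<^sup>2 < - x} = {}"
        by (auto) (smt (verit) zero_le_power2)
      then show ?thesis using False by simp
    qed
    finally show ?thesis .
  qed
  have emN: "emeasure N {x<..} = (if x < 0 then ennreal ((- x) powr (1 - s / 2) * A) else 0)" for x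
  proof -
    have "emeasure N {x<..} = (\<integral>\<^sup>+t. ennreal ((1 - s / 2) * A) * (ennreal (t powr (- s / 2)) * indicator {0<..<-x} t) \<partial>lborel)"
    proof -
      have "uminus -` {x<..} = {..<- x}" by auto
      then show ?thesis unfolding N_def
        by (subst emeasure_distr)
           (auto simp: emeasure_density intro!: nn_integral_cong split: split_indicator)
    qed
    also have "\<dots> = ennreal ((1 - s / 2) * A) * (\<integral>\<^sup>+t\<in>{0<..<-x}. ennreal (t powr (- s / 2)) \<partial>lborel)"
      by (rule nn_integral_cmult) simp
    also have "\<dots> = (if x < 0 then ennreal ((- x) powr (1 - s / 2) * A) else 0)"
    proof (cases "x < 0")
      case True
      have "(\<integral>\<^sup>+t\<in>{0<..<-x}. ennreal (t powr (- s / 2)) \<partial>lborel) =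
         ennreal ((- x) powr (- s / 2 + 1) / (- s / 2 + 1))"
        using s True by (intro nn_integral_powr_Ioo) auto
      then show ?thesis using True s A
        by (simp add: ennreal_mult[symmetric] add.commute[of "- (s/2)"])
    next
      case False
      then have "{0<..<-x} = {}" by auto
      then show ?thesis using False by simp
    qed
    finally show ?thesis .
  qed
  have "M = N"
    by (rule measure_eqI_lessThan) (simp_all only: emM emN, auto simp: M_def N_def)
  have "(\<integral>\<^sup>+v. g ((cmod v)\<^sup>2) * ennreal (W v) \<partial>lborel) = (\<integral>\<^sup>+t. g (- t) \<partial>M)"
    unfolding M_def by (subst nn_integral_distr) (auto simp: nn_integral_density mult.commute)
  also have "\<dots> = (\<integral>\<^sup>+t. ennreal ((1 - s / 2) * A) * (g t * ennreal (t powr (- s / 2)) * indicator {0<..} t) \<partial>lborel)"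
    unfolding \<open>M = N\<close> N_def by (subst nn_integral_distr) (auto simp: nn_integral_density mult_ac)
  also have "\<dots> = ennreal ((1 - s / 2) * A) * (\<integral>\<^sup>+t\<in>{0<..}. g t * ennreal (t powr (- s / 2)) \<partial>lborel)"
    by (rule nn_integral_cmult) simp
  finally show ?thesis .
qed

lemma nn_integral_disc_radial:
  fixes g :: "real \<Rightarrow> ennreal"
  assumes [measurable]: "g \<in> borel_measurable borel"
  shows "(\<integral>\<^sup>+v. g ((cmod v)\<^sup>2) \<partial>lborel) = ennreal pi * (\<integral>\<^sup>+t\<in>{0<..}. g t \<partial>lborel)"
proof -
  have "(\<integral>\<^sup>+v. g ((cmod v)\<^sup>2) * ennreal 1 \<partial>lborel) =
     ennreal ((1 - 0 / 2) * pi) * (\<integral>\<^sup>+t\<in>{0<..}. g t * ennreal (t powr (- 0 / 2)) \<partial>lborel)"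
  proof (rule nn_integral_radial)
    show "(\<integral>\<^sup>+v\<in>ball (0::complex) 1. ennreal 1 \<partial>lborel) = ennreal pi"
      by (simp add: emeasure_ball unit_ball_vol_2)
  qed auto
  also have "(\<integral>\<^sup>+t\<in>{0<..}. g t * ennreal (t powr (- 0 / 2)) \<partial>lborel) =
    (\<integral>\<^sup>+t\<in>{0<..}. g t \<partial>lborel)"
    by (intro nn_integral_cong) (auto split: split_indicator)
  finally show ?thesis by simp
qed

lemma nn_integral_disc_Im_powr_finite:
  fixes s :: real
  assumes "s < 1"
  shows "(\<integral>\<^sup>+v\<in>ball 0 1. ennreal (\<bar>Im v\<bar> powr (- s)) \<partial>lborel) < \<infinity>"
proof -
  define h where "h = (\<lambda>y::real. ennreal (y powr (- s)) * indicator {0<..<1} y)"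
  have h[measurable]: "h \<in> borel_measurable borel" unfolding h_def by measurable
  have hI: "(\<integral>\<^sup>+y. h y \<partial>lborel) = ennreal (1 / (1 - s))"
    using nn_integral_powr_Ioo[of "- s" 1] assms by (simp add: h_def)
  have hI': "(\<integral>\<^sup>+y. h (- y) \<partial>lborel) = ennreal (1 / (1 - s))"
    using nn_integral_real_affine[of h "-1" 0] hI by simp
  have "(\<integral>\<^sup>+v\<in>ball 0 1. ennreal (\<bar>Im v\<bar> powr (- s)) \<partial>lborel) \<le>
        (\<integral>\<^sup>+v. indicator {-1..1} (Re v) * (h (Im v) + h (- Im v)) \<partial>lborel)"
  proof (intro nn_integral_mono)
    fix v :: complex
    show "ennreal (\<bar>Im v\<bar> powr (- s)) * indicator (ball 0 1) v \<le> indicator {-1..1} (Re v) * (h (Im v) + h (- Im v))"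
      using abs_Re_le_cmod[of v] abs_Im_le_cmod[of v]
      by (cases "Im v" "0::real" rule: linorder_cases) (auto simp: h_def split: split_indicator)
  qed
  also have "\<dots> = (\<integral>\<^sup>+p. (case p of (x::real, y::real) \<Rightarrow> indicator {-1..1} x * (h y + h (- y))) \<partial>(lborel \<Otimes>\<^sub>M lborel))"
  proof -
    have [measurable]: "(\<lambda>(x,y). Complex x y) \<in> borel_measurable (lborel \<Otimes>\<^sub>M lborel)"
      unfolding lborel_prod case_prod_beta
      by (auto intro!: borel_measurable_continuous_onI continuous_intros)
    show ?thesis
      by (subst lborel_complex_eq_distr_pair, subst nn_integral_distr) (auto simp: case_prod_unfold intro!: nn_integral_cong)
  qed
  also have "\<dots> = (\<integral>\<^sup>+(x::real). \<integral>\<^sup>+y. indicator {-1..1} x * (h y + h (- y)) \<partial>lborel \<partial>lborel)"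
    by (subst lborel.nn_integral_fst[symmetric]) auto
  also have "\<dots> = 2 * (ennreal (1 / (1 - s)) + ennreal (1 / (1 - s)))"
    by (simp add: nn_integral_cmult nn_integral_add hI hI' nn_integral_multc mult.commute)
  also have "\<dots> < \<infinity>" by (simp add: ennreal_mult_less_top)
  finally show ?thesis .
qed

lemma AE_Im_nonzero: "AE v::complex in lborel. Im v \<noteq> 0"
proof -
  have "negligible {v::complex. \<i> \<bullet> v = 0}" by (rule negligible_hyperplane) auto
  moreover have "{v::complex. \<i> \<bullet> v = 0} = {v. Im v = 0}" by (auto simp: inner_complex_def)
  ultimately have "{v::complex. Im v = 0} \<in> null_sets lborel"
    by (simp add: negligible_iff_null_sets null_sets_completion_iff)
  from AE_not_in[OF this] show ?thesis by simp
qed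

lemma powr_le_scaled_powr:
  fixes x y a :: real
  assumes "0 < y" "y / 2 \<le> x" "0 \<le> a"
  shows "x powr (- a) \<le> 2 powr a * y powr (- a)"
proof -
  have "x powr (- a) \<le> (y / 2) powr (- a)" using assms by (intro powr_mono2') auto
  also have "\<dots> = 2 powr a * y powr (- a)"
    using assms by (simp add: powr_divide powr_minus field_simps)
  finally show ?thesis .
qed

text \<open>Since \<open>|Im v|^(-s)\<close> is homogeneous, the integral is a Beta integral in the squared modulus,
times the mass of that weight on the unit disc.\<close>

lemma nn_integral_disc_Im_powr_weight_finite:
  fixes m s :: real
  assumes m: "m > -1" and s: "0 \<le> s" "s < 1"
  shows "(\<integral>\<^sup>+v\<in>ball 0 1. ennreal ((1 - (cmod v)\<^sup>2) powr m * \<bar>Im v\<bar> powr (- s)) \<partial>lborel) < \<infinity>"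
proof -
  obtain A where A: "0 \<le> A" "(\<integral>\<^sup>+v\<in>ball 0 1. ennreal (\<bar>Im v\<bar> powr (- s)) \<partial>lborel) = ennreal A"
    using nn_integral_disc_Im_powr_finite[OF s(2)]
    by (cases "(\<integral>\<^sup>+v\<in>ball 0 1. ennreal (\<bar>Im v\<bar> powr (- s)) \<partial>lborel)" rule: ennreal_cases) auto
  define g where "g = (\<lambda>t::real. ennreal ((1 - t) powr m) * indicator {..<1} t)"
  have "(\<integral>\<^sup>+v\<in>ball 0 1. ennreal ((1 - (cmod v)\<^sup>2) powr m * \<bar>Im v\<bar> powr (- s)) \<partial>lborel) =
     (\<integral>\<^sup>+v. g ((cmod v)\<^sup>2) * ennreal (\<bar>Im v\<bar> powr (- s)) \<partial>lborel)"
    by (intro nn_integral_cong) (auto simp: g_def ennreal_mult abs_square_less_1 split: split_indicator)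
  also have "\<dots> = ennreal ((1 - s / 2) * A) * (\<integral>\<^sup>+t\<in>{0<..}. g t * ennreal (t powr (- s / 2)) \<partial>lborel)"
    by (rule nn_integral_radial[OF _ _ _ _ A])
       (use s in \<open>auto simp: g_def abs_mult powr_mult\<close>)
  finally have eq: "(\<integral>\<^sup>+v\<in>ball 0 1. ennreal ((1 - (cmod v)\<^sup>2) powr m * \<bar>Im v\<bar> powr (- s)) \<partial>lborel) =
    ennreal ((1 - s / 2) * A) * (\<integral>\<^sup>+t\<in>{0<..}. g t * ennreal (t powr (- s / 2)) \<partial>lborel)" .
  have "(\<integral>\<^sup>+t\<in>{0<..}. g t * ennreal (t powr (- s / 2)) \<partial>lborel) \<le>
      (\<integral>\<^sup>+t. ennreal (indicator {0..1} t * (t powr ((1 - s / 2) - 1) * (1 - t) powr ((m + 1) - 1))) \<partial>lborel)"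
    by (intro nn_integral_mono) (auto simp: g_def ennreal_mult[symmetric] mult.commute split: split_indicator)
  also have "\<dots> = ennreal (Beta (1 - s / 2) (m + 1))"
    by (rule nn_integral_has_integral_lebesgue[OF _ has_integral_Beta_real]) (use s m in auto)
  finally show ?thesis unfolding eq by (auto simp: ennreal_mult_less_top intro: le_less_trans)
qed

text \<open>Once \<open>c\<close> is rotated to the positive axis, \<open>|1 - cnj c v|\<close> dominates half of
\<open>1 - |v|^2\<close> and half of \<open>|Im v|\<close>. Splitting its exponent between the two leaves a majorant that does not
depend on \<open>c\<close>, and \<open>N < 2 + m\<close> is what allows a split with integrable singularities.\<close>

lemma forelli_rudin_bounded:
  fixes N m :: real
  assumes m: "m > -1" and N: "N < 2 + m"
  obtains C where "0 \<le> C" "\<And>c. cmod c < 1 \<Longrightarrow>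
     (\<integral>\<^sup>+v\<in>ball 0 1. ennreal (cmod (1 - cnj c * v) powr (- N) * (1 - (cmod v)\<^sup>2) powr m) \<partial>lborel) \<le> ennreal C"
proof -
  \<comment> \<open>The slack shared by the three constraints \<open>a1 < 1 + m\<close>, \<open>a2 < 1\<close> and \<open>N \<le> a1 + a2\<close>.\<close>
  define e where "e = min ((2 + m - N) / 2) (min (1 / 2) ((1 + m) / 2))"
  define a1 where "a1 = 1 + m - e"
  define a2 where "a2 = 1 - e"
  have "0 < e \<and> e \<le> 1 / 2 \<and> e \<le> (1 + m) / 2 \<and> 2 * e \<le> 2 + m - N"
    using m N unfolding e_def min_def by auto
  then have e: "0 < e" "e \<le> 1 / 2" "e \<le> (1 + m) / 2" "2 * e \<le> 2 + m - N" by auto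
  have a: "0 \<le> a1" "0 \<le> a2" "a2 < 1" "m - a1 > -1" "N \<le> a1 + a2"
    using e m unfolding a1_def a2_def by auto
  define J where "J = (\<integral>\<^sup>+v\<in>ball 0 1. ennreal ((1 - (cmod v)\<^sup>2) powr (m - a1) * \<bar>Im v\<bar> powr (- a2)) \<partial>lborel)"
  have "J < \<infinity>" unfolding J_def by (rule nn_integral_disc_Im_powr_weight_finite) (use a in auto)
  then obtain j where j: "0 \<le> j" "J = ennreal j" by (cases J rule: ennreal_cases) auto
  define B where "B = 2 powr (a1 + a2 - N) * 2 powr a1 * 2 powr a2"
  have B0: "0 \<le> B" by (simp add: B_def)
  have main: "(\<integral>\<^sup>+v\<in>ball 0 1. ennreal (cmod (1 - cnj c * v) powr (- N) * (1 - (cmod v)\<^sup>2) powr m) \<partial>lborel)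
      \<le> ennreal (B * j)" if c: "cmod c < 1" for c
  proof -
    define w where "w = (if c = 0 then 1 else c / of_real (cmod c))"
    have w: "cmod w = 1" by (simp add: w_def norm_divide)
    have cw: "cnj c * w = of_real (cmod c)"
      using complex_norm_square[of c]
      by (auto simp: w_def power2_eq_square field_simps)
    have pt: "cmod (1 - cnj c * (w * v)) powr (- N) * (1 - (cmod (w * v))\<^sup>2) powr m \<le>
       B * ((1 - (cmod v)\<^sup>2) powr (m - a1) * \<bar>Im v\<bar> powr (- a2))"
      if v: "cmod v < 1" "Im v \<noteq> 0" for v :: complex
    proof -
      define x where "x = cmod (1 - cnj c * (w * v))"
      have xeq: "x = cmod (1 - of_real (cmod c) * v)" using cw by (simp add: x_def mult.assoc[symmetric])
      have xlo: "1 - cmod v \<le> x" "1 - cmod c \<le> x" "cmod c * \<bar>Im v\<bar> \<le> x"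
      proof -
        have "cmod (of_real (cmod c) * v) \<le> cmod v" "cmod (of_real (cmod c) * v) \<le> cmod c"
          using c v by (auto simp: norm_mult mult_left_le_one_le mult_left_le)
        then show "1 - cmod v \<le> x" "1 - cmod c \<le> x"
          using norm_triangle_ineq2[of 1 "of_real (cmod c) * v"] unfolding xeq by auto
        show "cmod c * \<bar>Im v\<bar> \<le> x"
          using abs_Im_le_cmod[of "1 - of_real (cmod c) * v"] unfolding xeq by (simp add: abs_mult)
      qed
      have xp: "0 < x" using xlo v by linarith
      have x2: "x \<le> 2"
      proof -
        have "x \<le> 1 + cmod c * cmod v" unfolding xeq using norm_triangle_ineq4[of 1 "of_real (cmod c) * v"]
          by (simp add: norm_mult)
        moreover have "cmod c * cmod v \<le> 1" using c v by (intro mult_le_one) auto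
        ultimately show ?thesis by simp
      qed
      have v2: "0 < 1 - (cmod v)\<^sup>2" using v by (intro one_minus_norm_sq_pos)
      have l1: "(1 - (cmod v)\<^sup>2) / 2 \<le> x"
      proof -
        have "0 \<le> (1 - cmod v)\<^sup>2" by simp
        then have "(1 - (cmod v)\<^sup>2) / 2 \<le> 1 - cmod v" by (simp add: power2_eq_square field_simps)
        then show ?thesis using xlo by linarith
      qed
      have l2: "\<bar>Im v\<bar> / 2 \<le> x"
      proof (cases "cmod c \<le> 1 / 2")
        case True then show ?thesis using xlo(2) abs_Im_le_cmod[of v] v by linarith
      next
        case False
        then have "1 / 2 * \<bar>Im v\<bar> \<le> cmod c * \<bar>Im v\<bar>" by (intro mult_right_mono) auto
        then show ?thesis using xlo(3) by linarith
      qed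
      have "x powr (- N) = x powr (a1 + a2 - N) * (x powr (- a1) * x powr (- a2))"
        using xp by (simp add: powr_add[symmetric])
      also have "\<dots> \<le> 2 powr (a1 + a2 - N) * ((2 powr a1 * (1 - (cmod v)\<^sup>2) powr (- a1)) * (2 powr a2 * \<bar>Im v\<bar> powr (- a2)))"
        using a xp x2 v v2[THEN less_imp_le] v2 l1 l2 by (intro mult_mono powr_mono2 powr_le_scaled_powr) (simp_all)
      finally have 1: "x powr (- N) \<le> B * ((1 - (cmod v)\<^sup>2) powr (- a1) * \<bar>Im v\<bar> powr (- a2))"
        by (simp add: B_def mult_ac)
      have "x powr (- N) * (1 - (cmod v)\<^sup>2) powr m \<le>
            B * ((1 - (cmod v)\<^sup>2) powr (- a1) * \<bar>Im v\<bar> powr (- a2)) * (1 - (cmod v)\<^sup>2) powr m"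
        by (rule mult_right_mono[OF 1]) simp
      also have "\<dots> = B * ((1 - (cmod v)\<^sup>2) powr (m - a1) * \<bar>Im v\<bar> powr (- a2))"
        using v2 by (simp add: powr_diff powr_minus field_simps)
      finally show ?thesis using w by (simp add: x_def norm_mult)
    qed
    have "(\<integral>\<^sup>+v\<in>ball 0 1. ennreal (cmod (1 - cnj c * v) powr (- N) * (1 - (cmod v)\<^sup>2) powr m) \<partial>lborel)
      = (\<integral>\<^sup>+v. ennreal (cmod (1 - cnj c * (w * v)) powr (- N) * (1 - (cmod (w * v))\<^sup>2) powr m) * indicator (ball 0 1) (w * v) \<partial>lborel) * ennreal ((cmod w)\<^sup>2)"
      using w by (intro nn_integral_complex_scale[symmetric]) auto
    also have "\<dots> = (\<integral>\<^sup>+v. ennreal (cmod (1 - cnj c * (w * v)) powr (- N) * (1 - (cmod (w * v))\<^sup>2) powr m) * indicator (ball 0 1) (w * v) \<partial>lborel)"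
      using w by simp
    \<comment> \<open>On the real axis \<open>0 powr (- a2) = 0\<close> spoils the pointwise bound, but the axis is a null set.\<close>
    also have "\<dots> \<le> (\<integral>\<^sup>+v. ennreal B * (ennreal ((1 - (cmod v)\<^sup>2) powr (m - a1) * \<bar>Im v\<bar> powr (- a2)) * indicator (ball 0 1) v) \<partial>lborel)"
      using AE_Im_nonzero
    proof (intro nn_integral_mono_AE, eventually_elim)
      case (elim v)
      then show ?case using pt[of v] w B0
        by (auto simp: norm_mult ennreal_mult[symmetric] intro!: ennreal_leI split: split_indicator)
    qed
    also have "\<dots> = ennreal (B * j)"
    proof -
      have m: "(\<lambda>v. ennreal ((1 - (cmod v)\<^sup>2) powr (m - a1) * \<bar>Im v\<bar> powr (- a2)) * indicator (ball 0 1) v)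
          \<in> borel_measurable lborel" by measurable
      show ?thesis unfolding nn_integral_cmult[OF m] J_def[symmetric]
        using j B0 by (simp add: ennreal_mult)
    qed
    finally show ?thesis .
  qed
  show thesis by (rule that[OF _ main]) (use B0 j in auto)
qed

lemma norm_one_minus_cnj_mult_moebius:
  assumes "cmod a < 1" "cmod w < 1"
  shows "cmod (1 - cnj a * moebius a w) = (1 - (cmod a)\<^sup>2) / cmod (1 - cnj a * w)"
  unfolding one_minus_cnj_mult_moebius[OF assms] norm_divide norm_of_real
  using one_minus_norm_sq_pos[OF assms(1)] by simp

text \<open>The Moebius substitution preserves this family of weights: it exchanges the exponents \<open>s\<close> and
\<open>-(4 + s + 2 r)\<close> of \<open>|1 - cnj c w|\<close>.\<close>

lemma nn_integral_disc_weight_moebius: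
  fixes s r :: real and g :: "complex \<Rightarrow> real"
  assumes c: "cmod c < 1" and [measurable]: "g \<in> borel_measurable borel" and g0: "\<And>v. 0 \<le> g v"
  shows "(\<integral>\<^sup>+w\<in>ball 0 1. ennreal (cmod (1 - cnj c * w) powr s * (1 - (cmod w)\<^sup>2) powr r * g (moebius c w)) \<partial>lborel) =
    ennreal ((1 - (cmod c)\<^sup>2) powr (2 + s + r)) *
    (\<integral>\<^sup>+v\<in>ball 0 1. ennreal (cmod (1 - cnj c * v) powr (- (4 + s + 2 * r)) * (1 - (cmod v)\<^sup>2) powr r * g v) \<partial>lborel)"
proof -
  define A where "A = 1 - (cmod c)\<^sup>2"
  have A: "0 < A" using one_minus_norm_sq_pos[OF c] by (simp add: A_def)
  define f where "f = (\<lambda>w. ennreal (cmod (1 - cnj c * w) powr (4 + s) * (1 - (cmod w)\<^sup>2) powr r * g (moebius c w) / A\<^sup>2))"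
  have f[measurable]: "f \<in> borel_measurable borel" unfolding f_def by measurable
  have "(\<integral>\<^sup>+w\<in>ball 0 1. ennreal (cmod (1 - cnj c * w) powr s * (1 - (cmod w)\<^sup>2) powr r * g (moebius c w)) \<partial>lborel) =
     (\<integral>\<^sup>+w\<in>ball 0 1. f w * ennreal ((A / (cmod (1 - cnj c * w))\<^sup>2)\<^sup>2) \<partial>lborel)"
  proof (intro nn_integral_cong)
    fix w :: complex
    have "cmod (1 - cnj c * w) powr s * (1 - (cmod w)\<^sup>2) powr r * g (moebius c w) =
       cmod (1 - cnj c * w) powr (4 + s) * (1 - (cmod w)\<^sup>2) powr r * g (moebius c w) / A\<^sup>2 * (A / (cmod (1 - cnj c * w))\<^sup>2)\<^sup>2" if w: "cmod w < 1"
    proof -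
      define x where "x = cmod (1 - cnj c * w)"
      have x: "0 < x" using one_minus_cnj_mult_nonzero[OF c w] by (simp add: x_def)
      have "x powr (4 + s) = x ^ 4 * x powr s" using x powr_add[of x 4 s] by simp
      then show ?thesis unfolding x_def[symmetric] using x A by (simp add: power_divide field_simps)
    qed
    then show "ennreal (cmod (1 - cnj c * w) powr s * (1 - (cmod w)\<^sup>2) powr r * g (moebius c w)) * indicator (ball 0 1) w =
       f w * ennreal ((A / (cmod (1 - cnj c * w))\<^sup>2)\<^sup>2) * indicator (ball 0 1) w"
      using g0 by (auto simp: f_def ennreal_mult[symmetric] split: split_indicator)
  qed
  also have "\<dots> = (\<integral>\<^sup>+v\<in>ball 0 1. f (moebius c v) \<partial>lborel)"
    unfolding A_def by (rule nn_integral_disc_moebius[OF c f, symmetric])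
  also have "\<dots> = (\<integral>\<^sup>+v. ennreal (A powr (2 + s + r)) *
      (ennreal (cmod (1 - cnj c * v) powr (- (4 + s + 2 * r)) * (1 - (cmod v)\<^sup>2) powr r * g v) * indicator (ball 0 1) v) \<partial>lborel)"
  proof (intro nn_integral_cong)
    fix v :: complex
    show "f (moebius c v) * indicator (ball 0 1) v = ennreal (A powr (2 + s + r)) *
      (ennreal (cmod (1 - cnj c * v) powr (- (4 + s + 2 * r)) * (1 - (cmod v)\<^sup>2) powr r * g v) * indicator (ball 0 1) v)"
    proof (cases "cmod v < 1")
      case v: True
      define x where "x = cmod (1 - cnj c * v)"
      define V where "V = 1 - (cmod v)\<^sup>2"
      have x: "0 < x" "0 < V" using one_minus_cnj_mult_nonzero[OF c v] one_minus_norm_sq_pos[OF v] by (auto simp: x_def V_def)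
      have 1: "cmod (1 - cnj c * moebius c v) = A / x"
        unfolding norm_one_minus_cnj_mult_moebius[OF c v] by (simp add: A_def x_def)
      have 2: "1 - (cmod (moebius c v))\<^sup>2 = A * V / x\<^sup>2"
        unfolding one_minus_norm_moebius[OF c v] by (simp add: A_def x_def V_def)
      have "ln ((A / x) powr (4 + s) * (A * V / x\<^sup>2) powr r / A\<^sup>2) =
         ln (A powr (2 + s + r) * (x powr (- (4 + s + 2 * r)) * V powr r))"
        using x A by (simp add: ln_mult ln_div ln_powr ln_realpow algebra_simps)
      then have "(A / x) powr (4 + s) * (A * V / x\<^sup>2) powr r / A\<^sup>2 =
         A powr (2 + s + r) * (x powr (- (4 + s + 2 * r)) * V powr r)"
        by (subst (asm) ln_inj_iff) (use x A in auto)
      then have "(A / x) powr (4 + s) * (A * V / x\<^sup>2) powr r / A\<^sup>2 * g v =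
         A powr (2 + s + r) * (x powr (- (4 + s + 2 * r)) * V powr r) * g v" by simp
      then have "f (moebius c v) = ennreal (A powr (2 + s + r) * (x powr (- (4 + s + 2 * r)) * V powr r * g v))"
        unfolding f_def 1 2 moebius_moebius[OF c v] by (simp add: mult.assoc)
      then show ?thesis unfolding x_def[symmetric] V_def[symmetric]
        using v g0 by (simp add: ennreal_mult[symmetric])
    qed simp
  qed
  also have "\<dots> = ennreal (A powr (2 + s + r)) *
    (\<integral>\<^sup>+v\<in>ball 0 1. ennreal (cmod (1 - cnj c * v) powr (- (4 + s + 2 * r)) * (1 - (cmod v)\<^sup>2) powr r * g v) \<partial>lborel)"
    by (rule nn_integral_cmult) measurable
  finally show ?thesis by (simp add: A_def)
qed

text \<open>The substitution turns an exponent above the critical value into one below it, and the factor that it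
produces is the growth rate.\<close>

lemma forelli_rudin_growth:
  fixes N \<beta> :: real
  assumes \<beta>: "0 < \<beta>" "\<beta> < 1" and N: "N > 2 - \<beta>"
  obtains C where "0 \<le> C" "\<And>c. cmod c < 1 \<Longrightarrow>
     (\<integral>\<^sup>+v\<in>ball 0 1. ennreal (cmod (1 - cnj c * v) powr (- N) * (1 - (cmod v)\<^sup>2) powr (- \<beta>)) \<partial>lborel)
       \<le> ennreal (C * (1 - (cmod c)\<^sup>2) powr (- (N - 2 + \<beta>)))"
proof -
  have e: "4 - N - 2 * \<beta> = 4 + - N + 2 * - \<beta>" "- (N - 2 + \<beta>) = 2 + - N + - \<beta>" by auto
  obtain C where C: "0 \<le> C" "\<And>c. cmod c < 1 \<Longrightarrow>
     (\<integral>\<^sup>+v\<in>ball 0 1. ennreal (cmod (1 - cnj c * v) powr (- (4 - N - 2 * \<beta>)) * (1 - (cmod v)\<^sup>2) powr (- \<beta>)) \<partial>lborel) \<le> ennreal C"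
    using forelli_rudin_bounded[of "- \<beta>" "4 - N - 2 * \<beta>"] \<beta> N by auto
  have "(\<integral>\<^sup>+v\<in>ball 0 1. ennreal (cmod (1 - cnj c * v) powr (- N) * (1 - (cmod v)\<^sup>2) powr (- \<beta>)) \<partial>lborel)
       \<le> ennreal (C * (1 - (cmod c)\<^sup>2) powr (- (N - 2 + \<beta>)))" if c: "cmod c < 1" for c
    using nn_integral_disc_weight_moebius[OF c, of "\<lambda>_. 1" "- N" "- \<beta>"]
      mult_left_mono[OF C(2)[OF c], of "ennreal ((1 - (cmod c)\<^sup>2) powr (- (N - 2 + \<beta>)))"] C(1)
    unfolding e by (simp add: ennreal_mult mult.commute)
  then show thesis using that C(1) by blast
qed

lemma nn_integral_singular_kernel:
  fixes \<delta> e :: real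
  assumes e: "e > 1" and \<delta>: "0 < \<delta>"
  shows "(\<integral>\<^sup>+(v::complex). ennreal ((\<delta> + (cmod v)\<^sup>2) powr (- e)) \<partial>lborel) = ennreal (pi / (e - 1) * \<delta> powr (1 - e))"
proof -
  have lim: "((\<lambda>t. - ((\<delta> + t) powr (1 - e) / (e - 1))) \<longlongrightarrow> - (0 / (e - 1))) at_top"
  proof (intro tendsto_intros tendsto_neg_powr)
    show "filterlim (\<lambda>t. \<delta> + t) at_top at_top"
      by (intro filterlim_tendsto_add_at_top[OF tendsto_const] filterlim_ident)
  qed (use e in auto)
  have "(\<integral>\<^sup>+t\<in>{0..}. ennreal ((\<delta> + t) powr (- e)) \<partial>lborel) =
     ennreal (- (0 / (e - 1)) - (- ((\<delta> + 0) powr (1 - e) / (e - 1))))"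
  proof (rule nn_integral_FTC_atLeast[OF _ _ _ lim])
    fix t :: real assume "0 \<le> t"
    then show "((\<lambda>t. - ((\<delta> + t) powr (1 - e) / (e - 1))) has_real_derivative (\<delta> + t) powr (- e)) (at t)"
      using \<delta> e by (auto intro!: derivative_eq_intros simp: divide_simps) (simp add: algebra_simps)?
  qed (auto)
  also have "(\<integral>\<^sup>+t\<in>{0..}. ennreal ((\<delta> + t) powr (- e)) \<partial>lborel) =
     (\<integral>\<^sup>+t\<in>{0<..}. ennreal ((\<delta> + t) powr (- e)) \<partial>lborel)"
    using AE_lborel_singleton[of "0::real"]
    by (intro nn_integral_cong_AE) (auto split: split_indicator)
  finally show ?thesis
    using nn_integral_disc_radial[of "\<lambda>t. ennreal ((\<delta> + t) powr (- e))"] e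
    by (simp add: ennreal_mult[symmetric])
qed

lemma powr_le_between:
  fixes x L a :: real
  assumes "1 / L \<le> x" "x \<le> L" "1 \<le> L"
  shows "x powr a \<le> L powr \<bar>a\<bar>"
proof (cases "0 \<le> a")
  case True then show ?thesis using assms by (auto intro!: powr_mono2 order_trans[OF _ assms(1)])
next
  case False
  have "x powr a \<le> (1 / L) powr a" using assms False by (intro powr_mono2') auto
  also have "\<dots> = L powr \<bar>a\<bar>" using False assms by (simp add: powr_divide powr_minus_divide[symmetric])
  finally show ?thesis .
qed

text \<open>The factors are singular in different places. Near the origin only \<open>\<delta> + |v|^2\<close> matters; near the
circle that factor is bounded and the integral is of Forelli-Rudin type.\<close>

lemma forelli_rudin_interior_singularity:
  fixes N m e :: real
  assumes m: "m > -1" and N: "N < 2 + m" and e: "e > 1"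
  obtains C where "0 \<le> C" "\<And>c \<delta>. cmod c < 1 \<Longrightarrow> 0 < \<delta> \<Longrightarrow> \<delta> \<le> 1 \<Longrightarrow>
     (\<integral>\<^sup>+v\<in>ball 0 1. ennreal (cmod (1 - cnj c * v) powr (- N) * (1 - (cmod v)\<^sup>2) powr m * (\<delta> + (cmod v)\<^sup>2) powr (- e)) \<partial>lborel)
     \<le> ennreal (C * \<delta> powr (1 - e))"
proof -
  obtain C where C: "0 \<le> C" "\<And>c. cmod c < 1 \<Longrightarrow>
     (\<integral>\<^sup>+v\<in>ball 0 1. ennreal (cmod (1 - cnj c * v) powr (- N) * (1 - (cmod v)\<^sup>2) powr m) \<partial>lborel) \<le> ennreal C"
    using forelli_rudin_bounded[OF m N] by auto
  define K where "K = 4 powr \<bar>- N\<bar> * 2 powr \<bar>m\<bar>"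
  have K: "0 \<le> K" by (simp add: K_def)
  have "(\<integral>\<^sup>+v\<in>ball 0 1. ennreal (cmod (1 - cnj c * v) powr (- N) * (1 - (cmod v)\<^sup>2) powr m * (\<delta> + (cmod v)\<^sup>2) powr (- e)) \<partial>lborel)
     \<le> ennreal ((K * (pi / (e - 1)) + 2 powr e * C) * \<delta> powr (1 - e))"
    if c: "cmod c < 1" and \<delta>: "0 < \<delta>" "\<delta> \<le> 1" for c \<delta>
  proof -
    have pt: "cmod (1 - cnj c * v) powr (- N) * (1 - (cmod v)\<^sup>2) powr m * (\<delta> + (cmod v)\<^sup>2) powr (- e) \<le>
       K * (\<delta> + (cmod v)\<^sup>2) powr (- e) + 2 powr e * (cmod (1 - cnj c * v) powr (- N) * (1 - (cmod v)\<^sup>2) powr m)"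
      if v: "cmod v < 1" for v
    proof (cases "(cmod v)\<^sup>2 < 1 / 2")
      case True
      have "cmod v < 3 / 4"
      proof (rule ccontr)
        assume "\<not> cmod v < 3 / 4"
        then have "(3 / 4)\<^sup>2 \<le> (cmod v)\<^sup>2" by (intro power_mono) auto
        then show False using True by (simp add: power2_eq_square)
      qed
      then have lo: "1 / 4 \<le> cmod (1 - cnj c * v)"
        using one_minus_cnj_mult_lower[of c v] c by linarith
      have "cmod (cnj c * v) \<le> 1 * 1" unfolding norm_mult using c v by (intro mult_mono) auto
      then have up: "cmod (1 - cnj c * v) \<le> 4"
        using norm_triangle_ineq4[of 1 "cnj c * v"] by simp
      have "cmod (1 - cnj c * v) powr (- N) * (1 - (cmod v)\<^sup>2) powr m \<le> K"
      proof -
        have "1 - (cmod v)\<^sup>2 \<le> 2" using zero_le_power2[of "cmod v"] by linarith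
        then show ?thesis
          unfolding K_def using lo up True by (intro mult_mono powr_le_between) simp_all
      qed
      then have "cmod (1 - cnj c * v) powr (- N) * (1 - (cmod v)\<^sup>2) powr m * (\<delta> + (cmod v)\<^sup>2) powr (- e) \<le> K * (\<delta> + (cmod v)\<^sup>2) powr (- e)"
        by (intro mult_right_mono) auto
      then show ?thesis by (smt (verit) mult_nonneg_nonneg powr_ge_zero)
    next
      case False
      have "(\<delta> + (cmod v)\<^sup>2) powr (- e) \<le> (1 / 2) powr (- e)"
        using False \<delta> e by (intro powr_mono2') auto
      also have "\<dots> = 2 powr e" by (simp add: powr_divide powr_minus_divide)
      finally have "(cmod (1 - cnj c * v) powr (- N) * (1 - (cmod v)\<^sup>2) powr m) * (\<delta> + (cmod v)\<^sup>2) powr (- e) \<le>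
         (cmod (1 - cnj c * v) powr (- N) * (1 - (cmod v)\<^sup>2) powr m) * 2 powr e"
        by (intro mult_left_mono) auto
      moreover have "0 \<le> K * (\<delta> + (cmod v)\<^sup>2) powr (- e)" using K by simp
      ultimately show ?thesis by (simp add: mult.commute)
    qed
    have "(\<integral>\<^sup>+v\<in>ball 0 1. ennreal (cmod (1 - cnj c * v) powr (- N) * (1 - (cmod v)\<^sup>2) powr m * (\<delta> + (cmod v)\<^sup>2) powr (- e)) \<partial>lborel) \<le>
       (\<integral>\<^sup>+v. ennreal K * ennreal ((\<delta> + (cmod v)\<^sup>2) powr (- e)) +
          ennreal (2 powr e) * (ennreal (cmod (1 - cnj c * v) powr (- N) * (1 - (cmod v)\<^sup>2) powr m) * indicator (ball 0 1) v) \<partial>lborel)"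
      using pt K by (intro nn_integral_mono)
        (auto simp: ennreal_mult[symmetric] simp flip: ennreal_plus intro!: ennreal_leI split: split_indicator)
    also have "\<dots> = ennreal K * (\<integral>\<^sup>+(v::complex). ennreal ((\<delta> + (cmod v)\<^sup>2) powr (- e)) \<partial>lborel) +
        ennreal (2 powr e) * (\<integral>\<^sup>+v\<in>ball 0 1. ennreal (cmod (1 - cnj c * v) powr (- N) * (1 - (cmod v)\<^sup>2) powr m) \<partial>lborel)"
    proof -
      have m1: "(\<lambda>v::complex. ennreal ((\<delta> + (cmod v)\<^sup>2) powr (- e))) \<in> borel_measurable lborel" by measurable
      have m2: "(\<lambda>v. ennreal (cmod (1 - cnj c * v) powr (- N) * (1 - (cmod v)\<^sup>2) powr m) * indicator (ball 0 1) v) \<in> borel_measurable lborel"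
        by measurable
      show ?thesis
        by (subst nn_integral_add) (use m1 m2 in \<open>auto simp: nn_integral_cmult[OF m1] nn_integral_cmult[OF m2]\<close>)
    qed
    also have "\<dots> \<le> ennreal K * ennreal (pi / (e - 1) * \<delta> powr (1 - e)) + ennreal (2 powr e) * ennreal C"
      unfolding nn_integral_singular_kernel[OF e \<delta>(1)] by (intro add_left_mono mult_left_mono C(2)[OF c]) auto
    also have "\<dots> = ennreal (K * (pi / (e - 1)) * \<delta> powr (1 - e) + 2 powr e * C)"
      using K C e by (simp add: ennreal_mult[symmetric] mult.assoc flip: ennreal_plus)
    also have "\<dots> \<le> ennreal ((K * (pi / (e - 1)) + 2 powr e * C) * \<delta> powr (1 - e))"
    proof (intro ennreal_leI)
      have "1 \<le> \<delta> powr (1 - e)" using powr_mono2'[of "1 - e" \<delta> 1] \<delta> e by simp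
      then have "2 powr e * C * 1 \<le> 2 powr e * C * \<delta> powr (1 - e)" using C by (intro mult_left_mono) auto
      then show "K * (pi / (e - 1)) * \<delta> powr (1 - e) + 2 powr e * C \<le> (K * (pi / (e - 1)) + 2 powr e * C) * \<delta> powr (1 - e)"
        by (simp add: algebra_simps)
    qed
    finally show ?thesis .
  qed
  moreover have "0 \<le> K * (pi / (e - 1)) + 2 powr e * C" using K C e by simp
  ultimately show thesis using that by blast
qed

section \<open>The coordinate maps of the Thullen domain and their Jacobians\<close>

lemma measurable_fst_borel [measurable]:
    "fst \<in> borel_measurable (borel :: ('a::topological_space \<times> 'b::topological_space) measure)"
  and measurable_snd_borel [measurable]:
    "snd \<in> borel_measurable (borel :: ('a::topological_space \<times> 'b::topological_space) measure)"
  by (auto intro!: borel_measurable_continuous_onI continuous_intros)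

lemma nn_integral_lborel_pair_fst:
  fixes F :: "complex \<times> complex \<Rightarrow> ennreal"
  assumes "F \<in> borel_measurable borel"
  shows "(\<integral>\<^sup>+p. F p \<partial>lborel) = (\<integral>\<^sup>+x. \<integral>\<^sup>+y. F (x, y) \<partial>lborel \<partial>lborel)"
  using lborel.nn_integral_fst[of F lborel] assms by (simp add: lborel_prod)

lemma nn_integral_lborel_pair_snd:
  fixes F :: "complex \<times> complex \<Rightarrow> ennreal"
  assumes "F \<in> borel_measurable borel"
  shows "(\<integral>\<^sup>+p. F p \<partial>lborel) = (\<integral>\<^sup>+y. \<integral>\<^sup>+x. F (x, y) \<partial>lborel \<partial>lborel)"
  using lborel_pair.nn_integral_snd[of F] assms by (simp add: lborel_prod)

lemma nn_integral_lborel_swap: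
  fixes F :: "complex \<times> complex \<Rightarrow> ennreal"
  assumes [measurable]: "F \<in> borel_measurable borel"
  shows "(\<integral>\<^sup>+p. F (prod.swap p) \<partial>lborel) = (\<integral>\<^sup>+p. F p \<partial>lborel)"
proof -
  have "prod.swap \<in> borel_measurable (borel :: (complex \<times> complex) measure)"
    by (auto intro!: borel_measurable_continuous_onI continuous_intros simp: prod.swap_def)
  then have "(\<lambda>p. F (prod.swap p)) \<in> borel_measurable borel" by measurable
  then show ?thesis
    by (subst nn_integral_lborel_pair_snd) (auto simp: nn_integral_lborel_pair_fst)
qed

text \<open>The Thullen domain has this form over either coordinate disc.\<close>

definition fibred :: "(complex \<Rightarrow> real) \<Rightarrow> (complex \<times> complex) set" where
  "fibred \<rho> = {p. cmod (fst p) < 1 \<and> cmod (snd p) < \<rho> (fst p)}"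

text \<open>The condition on \<open>\<mu>\<close> says that the map takes the fibre over \<open>x\<close> onto the fibre over the image
of \<open>x\<close>. Substituting first along the fibres and then in the base gives the two factors of the Jacobian.\<close>

lemma nn_integral_fibred_moebius:
  fixes F :: "complex \<times> complex \<Rightarrow> ennreal" and \<mu> :: "complex \<Rightarrow> complex" and \<rho> :: "complex \<Rightarrow> real"
  assumes a: "cmod a < 1"
    and [measurable]: "F \<in> borel_measurable borel" "\<mu> \<in> borel_measurable borel" "\<rho> \<in> borel_measurable borel"
    and pos: "\<And>x. cmod x < 1 \<Longrightarrow> 0 < \<rho> x"
    and \<mu>: "\<And>x. cmod x < 1 \<Longrightarrow> cmod (\<mu> x) * \<rho> x = \<rho> (moebius a x)"
  shows "(\<integral>\<^sup>+p\<in>fibred \<rho>. F (moebius a (fst p), snd p * \<mu> (fst p)) \<partial>lborel) =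
    (\<integral>\<^sup>+p\<in>fibred \<rho>. F p * ennreal (((1 - (cmod a)\<^sup>2) / (cmod (1 - cnj a * fst p))\<^sup>2)\<^sup>2 * (\<rho> (moebius a (fst p)) / \<rho> (fst p))\<^sup>2)
       \<partial>lborel)"
proof -
  have [measurable]: "fibred \<rho> \<in> sets borel"
    unfolding fibred_def by measurable
  define H where "H = (\<lambda>x. \<integral>\<^sup>+y. F (x, y) * indicator {y. cmod y < \<rho> x} y \<partial>lborel)"
  have F2: "F \<in> borel_measurable (borel \<Otimes>\<^sub>M borel)" unfolding borel_prod by measurable
  have [measurable]: "H \<in> borel_measurable borel"
  proof -
    have "(\<lambda>(x,y). F (x, y) * indicator {p. cmod (snd p) < \<rho> (fst p)} (x, y)) \<in> borel_measurable (borel \<Otimes>\<^sub>M lborel)"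
      using F2 by measurable
    then have "(\<lambda>x. \<integral>\<^sup>+y. F (x, y) * indicator {p. cmod (snd p) < \<rho> (fst p)} (x, y) \<partial>lborel) \<in> borel_measurable borel"
      by (intro lborel.borel_measurable_nn_integral) simp
    then show ?thesis unfolding H_def by (simp add: indicator_def)
  qed
  define G where "G = (\<lambda>x. ennreal ((\<rho> (moebius a x) / \<rho> x)\<^sup>2) * H x)"
  have mu0: "\<mu> x \<noteq> 0" if "cmod x < 1" for x
    using \<mu>[OF that] pos[OF moebius_in_disc[OF a that]] by auto
  have inner: "(\<integral>\<^sup>+y. F (moebius a x, y * \<mu> x) * indicator (fibred \<rho>) (x, y) \<partial>lborel) = G (moebius a x) * indicator (ball 0 1) x" for x
  proof (cases "cmod x < 1")
    case True
    have "(\<integral>\<^sup>+y. F (moebius a x, y * \<mu> x) * indicator (fibred \<rho>) (x, y) \<partial>lborel) =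
      (\<integral>\<^sup>+y. F (moebius a x, \<mu> x * y) * indicator {y. cmod y < \<rho> (moebius a x)} (\<mu> x * y) \<partial>lborel)"
    proof (intro nn_integral_cong)
      fix y
      have "cmod y < \<rho> x \<longleftrightarrow> cmod (\<mu> x * y) < \<rho> (moebius a x)"
        using mu0[OF True] by (simp add: \<mu>[OF True, symmetric] norm_mult)
      then show "F (moebius a x, y * \<mu> x) * indicator (fibred \<rho>) (x, y) =
          F (moebius a x, \<mu> x * y) * indicator {y. cmod y < \<rho> (moebius a x)} (\<mu> x * y)"
        using True by (auto simp: fibred_def mult.commute split: split_indicator)
    qed
    also have "\<dots> = (\<integral>\<^sup>+y. F (moebius a x, \<mu> x * y) * indicator {y. cmod y < \<rho> (moebius a x)} (\<mu> x * y) \<partial>lborel) *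
        ennreal ((cmod (\<mu> x))\<^sup>2) * ennreal (1 / (cmod (\<mu> x))\<^sup>2)"
      using mu0[OF True] by (simp add: mult.assoc ennreal_mult[symmetric])
    also have "(\<integral>\<^sup>+y. F (moebius a x, \<mu> x * y) * indicator {y. cmod y < \<rho> (moebius a x)} (\<mu> x * y) \<partial>lborel) *
        ennreal ((cmod (\<mu> x))\<^sup>2) = H (moebius a x)"
      unfolding H_def using mu0[OF True] F2 by (intro nn_integral_complex_scale) measurable
    also have "1 / (cmod (\<mu> x))\<^sup>2 = (\<rho> (moebius a (moebius a x)) / \<rho> (moebius a x))\<^sup>2"
      using mu0[OF True] pos[OF True] \<mu>[OF True, symmetric] moebius_moebius[OF a True]
      by (simp add: power_divide power_mult_distrib)
    finally show ?thesis using True by (simp add: G_def mult.commute)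
  qed (simp add: fibred_def)
  have "(\<integral>\<^sup>+p\<in>fibred \<rho>. F (moebius a (fst p), snd p * \<mu> (fst p)) \<partial>lborel) =
     (\<integral>\<^sup>+x\<in>ball 0 1. G (moebius a x) \<partial>lborel)"
    using F2 by (subst nn_integral_lborel_pair_fst) (measurable, simp add: inner)
  also have "\<dots> = (\<integral>\<^sup>+x\<in>ball 0 1. G x * ennreal (((1 - (cmod a)\<^sup>2) / (cmod (1 - cnj a * x))\<^sup>2)\<^sup>2) \<partial>lborel)"
    by (rule nn_integral_disc_moebius[OF a]) (unfold G_def, measurable)
  also have "\<dots> = (\<integral>\<^sup>+x. \<integral>\<^sup>+y. F (x, y) * ennreal (((1 - (cmod a)\<^sup>2) / (cmod (1 - cnj a * x))\<^sup>2)\<^sup>2 * (\<rho> (moebius a x) / \<rho> x)\<^sup>2)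
       * indicator (fibred \<rho>) (x, y) \<partial>lborel \<partial>lborel)"
  proof (intro nn_integral_cong)
    fix x
    have "(\<integral>\<^sup>+y. F (x, y) * ennreal (((1 - (cmod a)\<^sup>2) / (cmod (1 - cnj a * x))\<^sup>2)\<^sup>2 * (\<rho> (moebius a x) / \<rho> x)\<^sup>2)
       * indicator (fibred \<rho>) (x, y) \<partial>lborel) =
      (\<integral>\<^sup>+y. (ennreal (((1 - (cmod a)\<^sup>2) / (cmod (1 - cnj a * x))\<^sup>2)\<^sup>2 * (\<rho> (moebius a x) / \<rho> x)\<^sup>2) * indicator (ball 0 1) x)
       * (F (x, y) * indicator {y. cmod y < \<rho> x} y) \<partial>lborel)"
      by (intro nn_integral_cong) (auto simp: fibred_def mult_ac split: split_indicator)
    also have "\<dots> = (ennreal (((1 - (cmod a)\<^sup>2) / (cmod (1 - cnj a * x))\<^sup>2)\<^sup>2 * (\<rho> (moebius a x) / \<rho> x)\<^sup>2) * indicator (ball 0 1) x) * H x"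
      unfolding H_def using F2 by (intro nn_integral_cmult) measurable
    finally show "G x * ennreal (((1 - (cmod a)\<^sup>2) / (cmod (1 - cnj a * x))\<^sup>2)\<^sup>2) * indicator (ball 0 1) x =
      (\<integral>\<^sup>+y. F (x, y) * ennreal (((1 - (cmod a)\<^sup>2) / (cmod (1 - cnj a * x))\<^sup>2)\<^sup>2 * (\<rho> (moebius a x) / \<rho> x)\<^sup>2)
       * indicator (fibred \<rho>) (x, y) \<partial>lborel)"
      by (simp add: G_def ennreal_mult mult_ac)
  qed
  also have "\<dots> = (\<integral>\<^sup>+p\<in>fibred \<rho>. F p * ennreal (((1 - (cmod a)\<^sup>2) / (cmod (1 - cnj a * fst p))\<^sup>2)\<^sup>2 * (\<rho> (moebius a (fst p)) / \<rho> (fst p))\<^sup>2)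
       \<partial>lborel)"
  proof -
    have m: "(\<lambda>p. F p * ennreal (((1 - (cmod a)\<^sup>2) / (cmod (1 - cnj a * fst p))\<^sup>2)\<^sup>2 * (\<rho> (moebius a (fst p)) / \<rho> (fst p))\<^sup>2)
       * indicator (fibred \<rho>) p) \<in> borel_measurable borel"
      by measurable
    show ?thesis unfolding nn_integral_lborel_pair_fst[OF m] by simp
  qed
  finally show ?thesis .
qed


lemma measurable_powr_complex [measurable (raw)]:
  fixes f :: "'a \<Rightarrow> complex"
  assumes [measurable]: "f \<in> borel_measurable M"
  shows "(\<lambda>x. f x powr c) \<in> borel_measurable M"
  unfolding powr_def by measurable

lemma powr_less_iff_less_powr:
  fixes x y a :: real
  assumes "0 \<le> x" "0 < y" "0 < a"
  shows "x powr (1 / a) < y \<longleftrightarrow> x < y powr a"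
proof
  assume "x powr (1 / a) < y"
  then have "(x powr (1 / a)) powr a < y powr a" using assms by (intro powr_less_mono2) auto
  then show "x < y powr a" using assms by (simp add: powr_powr)
next
  assume "x < y powr a"
  then have "x powr (1 / a) < (y powr a) powr (1 / a)" using assms by (intro powr_less_mono2) auto
  then show "x powr (1 / a) < y" using assms by (simp add: powr_powr)
qed

lemma U_dom_iff_snd:
  assumes "\<alpha> > 0"
  shows "z \<in> U_dom \<alpha> \<longleftrightarrow> cmod (snd z) < 1 \<and> cmod (fst z) < (1 - (cmod (snd z))\<^sup>2) powr (\<alpha> / 2)"
proof -
  have "cmod (snd z) < 1" if "z \<in> U_dom \<alpha>"
    using that powr_ge_zero[of "cmod (fst z)" "2 / \<alpha>"] abs_square_less_1[of "cmod (snd z)"]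
    by (auto simp: U_dom_def simp del: powr_ge_zero)
  moreover have "z \<in> U_dom \<alpha> \<longleftrightarrow> cmod (fst z) < (1 - (cmod (snd z))\<^sup>2) powr (\<alpha> / 2)" if "cmod (snd z) < 1"
    using powr_less_iff_less_powr[of "cmod (fst z)" "1 - (cmod (snd z))\<^sup>2" "\<alpha> / 2"] that assms one_minus_norm_sq_pos[OF that]
    by (auto simp: U_dom_def)
  ultimately show ?thesis by blast
qed

lemma U_dom_iff_fst:
  assumes "\<alpha> > 0"
  shows "z \<in> U_dom \<alpha> \<longleftrightarrow> cmod (fst z) < 1 \<and> cmod (snd z) < sqrt (1 - cmod (fst z) powr (2 / \<alpha>))"
proof -
  have *: "cmod (fst z) < 1 \<longleftrightarrow> cmod (fst z) powr (2 / \<alpha>) < 1"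
    using powr_less_iff_less_powr[of "cmod (fst z)" 1 "\<alpha> / 2"] assms by auto
  have "cmod (snd z) < sqrt (1 - cmod (fst z) powr (2 / \<alpha>)) \<longleftrightarrow> (cmod (snd z))\<^sup>2 < 1 - cmod (fst z) powr (2 / \<alpha>)"
    by (metis norm_ge_zero real_sqrt_less_iff real_sqrt_unique)
  moreover have "cmod (fst z) powr (2 / \<alpha>) < 1" if "(cmod (snd z))\<^sup>2 < 1 - cmod (fst z) powr (2 / \<alpha>)"
    using that zero_le_power2[of "cmod (snd z)"] by linarith
  ultimately show ?thesis unfolding * U_dom_def by auto
qed

lemma U_dom_fst_less_1: "\<alpha> > 0 \<Longrightarrow> z \<in> U_dom \<alpha> \<Longrightarrow> cmod (fst z) < 1"
  and U_dom_snd_less_1: "\<alpha> > 0 \<Longrightarrow> z \<in> U_dom \<alpha> \<Longrightarrow> cmod (snd z) < 1"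
  using U_dom_iff_fst U_dom_iff_snd by blast+

lemma U_dom_borel [measurable]: "U_dom \<alpha> \<in> sets borel"
  unfolding U_dom_def by measurable

lemma moebius_factor_powr_norm:
  assumes "cmod b < 1" "cmod x < 1"
  shows "cmod ((of_real (sqrt (1 - (cmod b)\<^sup>2)) / (1 - cnj b * x)) powr of_real \<alpha>) =
    ((1 - (cmod b)\<^sup>2) / (cmod (1 - cnj b * x))\<^sup>2) powr (\<alpha> / 2)"
proof -
  have "sqrt (1 - (cmod b)\<^sup>2) / cmod (1 - cnj b * x) = ((1 - (cmod b)\<^sup>2) / (cmod (1 - cnj b * x))\<^sup>2) powr (1 / 2)"
    using one_minus_norm_sq_pos[OF assms(1)] by (simp add: powr_half_sqrt real_sqrt_divide)
  then show ?thesis using one_minus_norm_sq_pos[OF assms(1)]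
    by (simp add: norm_powr_real_powr' norm_divide powr_powr)
qed

lemma one_minus_norm_moebius_ratio:
  assumes "cmod a < 1" "cmod x < 1"
  shows "(1 - (cmod (moebius a x))\<^sup>2) / (1 - (cmod x)\<^sup>2) = (1 - (cmod a)\<^sup>2) / (cmod (1 - cnj a * x))\<^sup>2"
  using one_minus_norm_sq_pos[OF assms(2)] by (simp add: one_minus_norm_moebius[OF assms])

lemma measurable_varphi_map [measurable]: "varphi_map \<alpha> b \<in> borel_measurable borel"
  unfolding varphi_map_def borel_prod[symmetric] by measurable

text \<open>Here the base is the second coordinate, with fibre radius \<open>(1 - |y|^2)^(\<alpha>/2)\<close>, so the coordinates
are exchanged before the fibrewise substitution applies.\<close>

lemma nn_integral_varphi_map:
  fixes F :: "complex \<times> complex \<Rightarrow> ennreal"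
  assumes \<alpha>: "\<alpha> > 0" and b: "cmod b < 1" and [measurable]: "F \<in> borel_measurable borel"
  shows "(\<integral>\<^sup>+x\<in>U_dom \<alpha>. F (varphi_map \<alpha> b x) \<partial>lborel) =
    (\<integral>\<^sup>+x\<in>U_dom \<alpha>. F x * ennreal (((1 - (cmod b)\<^sup>2) / (cmod (1 - cnj b * snd x))\<^sup>2) powr (2 + \<alpha>)) \<partial>lborel)"
proof -
  let ?U = "U_dom \<alpha>"
  define \<rho> where "\<rho> = (\<lambda>x. (1 - (cmod x)\<^sup>2) powr (\<alpha> / 2))"
  define \<mu> where "\<mu> = (\<lambda>x. (of_real (sqrt (1 - (cmod b)\<^sup>2)) / (1 - cnj b * x)) powr complex_of_real \<alpha>)"
  have [measurable]: "prod.swap \<in> borel_measurable (borel :: (complex \<times> complex) measure)"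
    by (auto intro!: borel_measurable_continuous_onI continuous_intros simp: prod.swap_def)
  have [measurable]: "\<rho> \<in> borel_measurable borel" "\<mu> \<in> borel_measurable borel"
    unfolding \<rho>_def \<mu>_def by measurable
  have pos: "0 < \<rho> x" if "cmod x < 1" for x
    using one_minus_norm_sq_pos[OF that] by (simp add: \<rho>_def)
  have mu: "cmod (\<mu> x) * \<rho> x = \<rho> (moebius b x)" if x: "cmod x < 1" for x
    unfolding \<mu>_def \<rho>_def moebius_factor_powr_norm[OF b x] one_minus_norm_moebius[OF b x]
    using one_minus_norm_sq_pos[OF x] one_minus_norm_sq_pos[OF b]
    by (simp add: powr_mult[symmetric])
  have R: "indicator (fibred \<rho>) p = (indicator ?U (prod.swap p) :: ennreal)" for p
    using U_dom_iff_snd[OF \<alpha>, of "prod.swap p"] by (auto simp: fibred_def \<rho>_def indicator_def)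
  have "(\<integral>\<^sup>+x\<in>?U. F (varphi_map \<alpha> b x) \<partial>lborel) =
     (\<integral>\<^sup>+p. F (varphi_map \<alpha> b (prod.swap p)) * indicator ?U (prod.swap p) \<partial>lborel)"
    by (rule nn_integral_lborel_swap[symmetric, of "\<lambda>x. F (varphi_map \<alpha> b x) * indicator ?U x"]) measurable
  also have "\<dots> = (\<integral>\<^sup>+p\<in>fibred \<rho>. F (prod.swap (moebius b (fst p), snd p * \<mu> (fst p))) \<partial>lborel)"
    by (simp add: R varphi_map_def moebius_def \<mu>_def)
  also have "\<dots> = (\<integral>\<^sup>+p\<in>fibred \<rho>. F (prod.swap p) * ennreal (((1 - (cmod b)\<^sup>2) / (cmod (1 - cnj b * fst p))\<^sup>2)\<^sup>2 * (\<rho> (moebius b (fst p)) / \<rho> (fst p))\<^sup>2)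
       \<partial>lborel)"
    by (rule nn_integral_fibred_moebius[where F = "\<lambda>p. F (prod.swap p)"]) (measurable, fact b pos mu)+
  also have "\<dots> = (\<integral>\<^sup>+p. F (prod.swap p) * ennreal (((1 - (cmod b)\<^sup>2) / (cmod (1 - cnj b * snd (prod.swap p)))\<^sup>2) powr (2 + \<alpha>)) * indicator ?U (prod.swap p) \<partial>lborel)"
  proof (intro nn_integral_cong)
    fix p :: "complex \<times> complex"
    show "F (prod.swap p) * ennreal (((1 - (cmod b)\<^sup>2) / (cmod (1 - cnj b * fst p))\<^sup>2)\<^sup>2 * (\<rho> (moebius b (fst p)) / \<rho> (fst p))\<^sup>2)
       * indicator (fibred \<rho>) p = F (prod.swap p) * ennreal (((1 - (cmod b)\<^sup>2) / (cmod (1 - cnj b * snd (prod.swap p)))\<^sup>2) powr (2 + \<alpha>)) * indicator ?U (prod.swap p)"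
    proof (cases "prod.swap p \<in> ?U")
      case True
      then have x: "cmod (fst p) < 1" using U_dom_snd_less_1[OF \<alpha>] by fastforce
      define Q where "Q = (1 - (cmod b)\<^sup>2) / (cmod (1 - cnj b * fst p))\<^sup>2"
      have Qp: "0 < Q" using one_minus_norm_sq_pos[OF b] one_minus_cnj_mult_nonzero[OF b x] by (simp add: Q_def)
      have "\<rho> (moebius b (fst p)) / \<rho> (fst p) = Q powr (\<alpha> / 2)"
        using one_minus_norm_moebius_ratio[OF b x] one_minus_norm_sq_pos[OF x] one_minus_norm_sq_pos[OF moebius_in_disc[OF b x]]
        by (simp add: \<rho>_def Q_def powr_divide[symmetric])
      moreover have "(Q powr (\<alpha> / 2))\<^sup>2 = Q powr \<alpha>"
        unfolding power2_eq_square powr_add[symmetric] by simp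
      moreover have "Q\<^sup>2 * Q powr \<alpha> = Q powr (2 + \<alpha>)"
        using Qp by (simp add: powr_add)
      ultimately have "Q\<^sup>2 * (\<rho> (moebius b (fst p)) / \<rho> (fst p))\<^sup>2 = Q powr (2 + \<alpha>)"
        by simp
      then show ?thesis by (simp add: R Q_def)
    qed (simp add: R)
  qed
  also have "\<dots> = (\<integral>\<^sup>+x\<in>?U. F x * ennreal (((1 - (cmod b)\<^sup>2) / (cmod (1 - cnj b * snd x))\<^sup>2) powr (2 + \<alpha>)) \<partial>lborel)"
    by (rule nn_integral_lborel_swap[of "\<lambda>x. F x * ennreal (((1 - (cmod b)\<^sup>2) / (cmod (1 - cnj b * snd x))\<^sup>2) powr (2 + \<alpha>)) * indicator ?U x"]) measurable
  finally show ?thesis .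
qed

text \<open>Here the base is the first coordinate. The unwieldy square root in \<open>phi_snd\<close> is exactly what makes the
fibre factor carry fibres of radius \<open>sqrt (1 - |x|^(2/\<alpha>))\<close> onto each other.\<close>

lemma nn_integral_phi_map:
  fixes F :: "complex \<times> complex \<Rightarrow> ennreal"
  assumes \<alpha>: "\<alpha> > 0" and a: "cmod a < 1" and [measurable]: "F \<in> borel_measurable borel"
  shows "(\<integral>\<^sup>+x\<in>U_dom \<alpha>. F (phi_map \<alpha> a x) \<partial>lborel) =
    (\<integral>\<^sup>+x\<in>U_dom \<alpha>. F x * ennreal (((1 - (cmod a)\<^sup>2) / (cmod (1 - cnj a * fst x))\<^sup>2)\<^sup>2 *
        ((1 - cmod (moebius a (fst x)) powr (2 / \<alpha>)) / (1 - cmod (fst x) powr (2 / \<alpha>)))) \<partial>lborel)"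
proof -
  define \<rho> where "\<rho> = (\<lambda>x. sqrt (1 - cmod x powr (2 / \<alpha>)))"
  define \<mu> where "\<mu> = (\<lambda>x. (of_real (sqrt (1 - (cmod a)\<^sup>2)) / (1 - cnj a * x)) *
     complex_of_real (sqrt (((1 - (cmod x)\<^sup>2) * (1 - cmod (moebius a x) powr (2 / \<alpha>))) /
                    ((1 - cmod x powr (2 / \<alpha>)) * (1 - (cmod (moebius a x))\<^sup>2)))))"
  have [measurable]: "\<rho> \<in> borel_measurable borel" "\<mu> \<in> borel_measurable borel"
    unfolding \<rho>_def \<mu>_def by measurable
  have pos': "0 < 1 - cmod x powr (2 / \<alpha>)" if "cmod x < 1" for x
    using powr_less_iff_less_powr[of "cmod x" 1 "\<alpha> / 2"] that \<alpha> by auto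
  have pos: "0 < \<rho> x" if "cmod x < 1" for x
    using pos'[OF that] by (simp add: \<rho>_def)
  have mu: "cmod (\<mu> x) * \<rho> x = \<rho> (moebius a x)" if x: "cmod x < 1" for x
  proof -
    define c where "c = cmod (1 - cnj a * x)"
    have c: "0 < c" using one_minus_cnj_mult_nonzero[OF a x] by (simp add: c_def)
    define A where "A = 1 - (cmod a)\<^sup>2"
    define X where "X = 1 - (cmod x)\<^sup>2"
    define P where "P = 1 - cmod (moebius a x) powr (2 / \<alpha>)"
    define Q where "Q = 1 - cmod x powr (2 / \<alpha>)"
    have pp: "0 < A" "0 < X" "0 < P" "0 < Q"
      using one_minus_norm_sq_pos[OF a] one_minus_norm_sq_pos[OF x] pos'[OF x] pos'[OF moebius_in_disc[OF a x]]
      by (auto simp: A_def X_def P_def Q_def)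
    have "cmod (\<mu> x) * \<rho> x = sqrt A / c * sqrt (X * P / (Q * (A * X / c\<^sup>2))) * sqrt Q"
      using pp c by (simp add: \<mu>_def \<rho>_def norm_mult norm_divide one_minus_norm_moebius[OF a x]
          flip: A_def X_def P_def Q_def c_def)
    also have "\<dots> = sqrt P"
      using pp c by (simp add: real_sqrt_divide real_sqrt_mult)
    finally show ?thesis by (simp add: \<rho>_def P_def)
  qed
  have R: "fibred \<rho> = U_dom \<alpha>"
    using U_dom_iff_fst[OF \<alpha>] by (auto simp: fibred_def \<rho>_def)
  have "(\<integral>\<^sup>+x\<in>U_dom \<alpha>. F (phi_map \<alpha> a x) \<partial>lborel) =
     (\<integral>\<^sup>+p\<in>fibred \<rho>. F (moebius a (fst p), snd p * \<mu> (fst p)) \<partial>lborel)"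
    by (simp add: R phi_map_def phi_fst_def phi_snd_def moebius_def \<mu>_def mult.assoc)
  also have "\<dots> = (\<integral>\<^sup>+p\<in>fibred \<rho>. F p * ennreal (((1 - (cmod a)\<^sup>2) / (cmod (1 - cnj a * fst p))\<^sup>2)\<^sup>2 * (\<rho> (moebius a (fst p)) / \<rho> (fst p))\<^sup>2)
       \<partial>lborel)"
    by (rule nn_integral_fibred_moebius) (measurable, fact a pos mu)+
  also have "\<dots> = (\<integral>\<^sup>+x\<in>U_dom \<alpha>. F x * ennreal (((1 - (cmod a)\<^sup>2) / (cmod (1 - cnj a * fst x))\<^sup>2)\<^sup>2 *
        ((1 - cmod (moebius a (fst x)) powr (2 / \<alpha>)) / (1 - cmod (fst x) powr (2 / \<alpha>)))) \<partial>lborel)"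
  proof (intro nn_integral_cong)
    fix p :: "complex \<times> complex"
    show "F p * ennreal (((1 - (cmod a)\<^sup>2) / (cmod (1 - cnj a * fst p))\<^sup>2)\<^sup>2 * (\<rho> (moebius a (fst p)) / \<rho> (fst p))\<^sup>2)
       * indicator (fibred \<rho>) p = F p * ennreal (((1 - (cmod a)\<^sup>2) / (cmod (1 - cnj a * fst p))\<^sup>2)\<^sup>2 *
        ((1 - cmod (moebius a (fst p)) powr (2 / \<alpha>)) / (1 - cmod (fst p) powr (2 / \<alpha>)))) * indicator (U_dom \<alpha>) p"
    proof (cases "p \<in> U_dom \<alpha>")
      case True
      then have x: "cmod (fst p) < 1" using U_dom_fst_less_1[OF \<alpha>] by blast
      show ?thesis using pos'[OF x] pos'[OF moebius_in_disc[OF a x]] by (simp add: R) (simp add: \<rho>_def power_divide)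
    qed (simp add: R)
  qed
  finally show ?thesis .
qed

lemma varphi_map_in_U_dom:
  assumes \<alpha>: "\<alpha> > 0" and b: "cmod b < 1" and x: "x \<in> U_dom \<alpha>"
  shows "varphi_map \<alpha> b x \<in> U_dom \<alpha>"
proof -
  have x2: "cmod (snd x) < 1" using U_dom_snd_less_1[OF \<alpha> x] .
  define Q where "Q = (1 - (cmod b)\<^sup>2) / (cmod (1 - cnj b * snd x))\<^sup>2"
  have Qp: "0 < Q" using one_minus_norm_sq_pos[OF b] one_minus_cnj_mult_nonzero[OF b x2] by (simp add: Q_def)
  have "cmod (fst x) * Q powr (\<alpha> / 2) < (1 - (cmod (snd x))\<^sup>2) powr (\<alpha> / 2) * Q powr (\<alpha> / 2)"
    using x Qp U_dom_iff_snd[OF \<alpha>] by (intro mult_strict_right_mono) auto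
  also have "\<dots> = (1 - (cmod (moebius b (snd x)))\<^sup>2) powr (\<alpha> / 2)"
    using one_minus_norm_sq_pos[OF x2] Qp one_minus_norm_moebius[OF b x2]
    by (simp add: powr_mult[symmetric] Q_def mult.commute)
  finally show ?thesis
    unfolding U_dom_iff_snd[OF \<alpha>] using moebius_in_disc[OF b x2] moebius_factor_powr_norm[OF b x2, of \<alpha>]
    by (simp add: varphi_map_def norm_mult Q_def moebius_def)
qed

lemma Re_one_minus_cnj_mult_pos:
  assumes "cmod b < 1" "cmod x < 1" shows "0 < Re (1 - cnj b * x)"
proof -
  have "cmod (cnj b * x) < 1" using assms mult_left_le[of "cmod x" "cmod b"] by (simp add: norm_mult)
  then show ?thesis using complex_Re_le_cmod[of "cnj b * x"] by simp
qed

text \<open>Principal powers are multiplicative here because the denominator lies in the right half plane.\<close>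

lemma of_real_divide_powr:
  assumes "0 < A" "0 < Re \<zeta>"
  shows "(of_real A / \<zeta>) powr of_real c = of_real (A powr c) / \<zeta> powr of_real c"
proof -
  have "\<zeta> \<notin> \<real>\<^sub>\<le>\<^sub>0" "\<zeta> \<noteq> 0" using assms(2) by (auto simp: complex_nonpos_Reals_iff)
  then have "inverse \<zeta> powr of_real c = inverse (\<zeta> powr of_real c)"
    by (simp add: powr_def Ln_inverse exp_minus)
  moreover have "(of_real A * inverse \<zeta>) powr of_real c = of_real A powr of_real c * inverse \<zeta> powr of_real c"
    using assms by (intro powr_times_real_left) auto
  moreover have "complex_of_real A powr of_real c = of_real (A powr c)"
    using assms by (simp add: powr_of_real)
  ultimately show ?thesis by (simp only: divide_inverse)
qed

lemma moebius_factor_powr: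
  assumes "cmod b < 1" "cmod x < 1"
  shows "(of_real (sqrt (1 - (cmod b)\<^sup>2)) / (1 - cnj b * x)) powr of_real \<alpha> =
    of_real ((1 - (cmod b)\<^sup>2) powr (\<alpha> / 2)) / (1 - cnj b * x) powr of_real \<alpha>"
proof -
  have "sqrt (1 - (cmod b)\<^sup>2) powr \<alpha> = (1 - (cmod b)\<^sup>2) powr (\<alpha> / 2)"
    using one_minus_norm_sq_pos[OF assms(1)] by (simp add: powr_half_sqrt[symmetric] powr_powr)
  moreover have "0 < sqrt (1 - (cmod b)\<^sup>2)"
    using one_minus_norm_sq_pos[OF assms(1)] by simp
  ultimately show ?thesis
    using of_real_divide_powr[OF _ Re_one_minus_cnj_mult_pos[OF assms]] by metis
qed

text \<open>In the second coordinate this is the disc involution. In the first, the two linear factors are principal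
powers of mutually inverse numbers with positive real part.\<close>

lemma varphi_map_varphi_map:
  assumes \<alpha>: "\<alpha> > 0" and b: "cmod b < 1" and x: "x \<in> U_dom \<alpha>"
  shows "varphi_map \<alpha> b (varphi_map \<alpha> b x) = x"
proof -
  have x2: "cmod (snd x) < 1" using U_dom_snd_less_1[OF \<alpha> x] .
  define r where "r = 1 - (cmod b)\<^sup>2"
  have r: "0 < r" using one_minus_norm_sq_pos[OF b] by (simp add: r_def)
  define \<zeta> where "\<zeta> = 1 - cnj b * snd x"
  have z: "\<zeta> \<noteq> 0"
    using Re_one_minus_cnj_mult_pos[OF b x2] unfolding \<zeta>_def[symmetric] by auto
  have q2: "(1 - cnj b * moebius b (snd x)) powr of_real \<alpha> = of_real (r powr \<alpha>) / \<zeta> powr of_real \<alpha>"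
    unfolding one_minus_cnj_mult_moebius[OF b x2] r_def[symmetric] \<zeta>_def[symmetric]
    by (rule of_real_divide_powr[OF r]) (use Re_one_minus_cnj_mult_pos[OF b x2] in \<open>simp only: \<zeta>_def\<close>)
  have "r powr (\<alpha> / 2) * r powr (\<alpha> / 2) = r powr \<alpha>"
    by (simp only: powr_add[symmetric]) simp
  then have pp: "of_real (r powr (\<alpha> / 2)) * of_real (r powr (\<alpha> / 2)) = complex_of_real (r powr \<alpha>)"
    by (simp only: of_real_mult[symmetric])
  have step: "varphi_map \<alpha> b y = (fst y * (of_real (r powr (\<alpha> / 2)) / (1 - cnj b * snd y) powr of_real \<alpha>), moebius b (snd y))"
    if "cmod (snd y) < 1" for y
    unfolding varphi_map_def moebius_factor_powr[OF b that] moebius_def r_def ..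
  have eq: "varphi_map \<alpha> b (varphi_map \<alpha> b x) = (fst x * (of_real (r powr (\<alpha> / 2)) / \<zeta> powr of_real \<alpha>) *
     (of_real (r powr (\<alpha> / 2)) / (1 - cnj b * moebius b (snd x)) powr of_real \<alpha>), moebius b (moebius b (snd x)))"
    using step[OF x2] moebius_in_disc[OF b x2] step[of "varphi_map \<alpha> b x"] by (simp add: \<zeta>_def)
  have "x1 * (p / Z) * (p / (R / Z)) = x1" if "p * p = R" "Z \<noteq> 0" "R \<noteq> 0" for x1 p Z R :: complex
    using that by (simp add: field_simps)
  then have "fst x * (of_real (r powr (\<alpha> / 2)) / \<zeta> powr of_real \<alpha>) *
     (of_real (r powr (\<alpha> / 2)) / (1 - cnj b * moebius b (snd x)) powr of_real \<alpha>) = fst x"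
    unfolding q2 using pp z r by auto
  then show ?thesis unfolding eq moebius_moebius[OF b x2] by simp
qed

section \<open>The size of the kernel against the Jacobian\<close>

text \<open>The quotient \<open>T\<close> on which the Bergman kernel depends besides the power of \<open>1 - z2 cnj w2\<close>.\<close>

definition kernel_ratio :: "real \<Rightarrow> complex \<times> complex \<Rightarrow> complex \<times> complex \<Rightarrow> complex" where
  "kernel_ratio \<alpha> z w = fst z * cnj (fst w) / (1 - snd z * cnj (snd w)) powr of_real \<alpha>"

text \<open>The order of magnitude of the Bergman kernel, which has a pole of order three at \<open>T = 1\<close>.\<close>

definition kernel_size :: "real \<Rightarrow> complex \<times> complex \<Rightarrow> complex \<times> complex \<Rightarrow> real" where
  "kernel_size \<alpha> z w = cmod (1 - snd z * cnj (snd w)) powr (- (2 + \<alpha>)) * cmod (1 - kernel_ratio \<alpha> z w) powr (- 3)"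

text \<open>This is \<open>kernel_size \<alpha> z z\<close>, since the quotient \<open>T\<close> is \<open>|f z|^2\<close> on the diagonal.\<close>

definition kernel_diag :: "real \<Rightarrow> complex \<times> complex \<Rightarrow> real" where
  "kernel_diag \<alpha> z = (1 - (cmod (snd z))\<^sup>2) powr (- (2 + \<alpha>)) * (1 - (cmod (f_fun \<alpha> z))\<^sup>2) powr (- 3)"

lemma norm_f_fun_less_1:
  assumes "\<alpha> > 0" "z \<in> U_dom \<alpha>" shows "cmod (f_fun \<alpha> z) < 1"
  using assms U_dom_iff_snd[OF assms(1), of z] one_minus_norm_sq_pos[of "snd z"]
  by (auto simp: f_fun_def norm_divide)

lemma norm_one_minus_mult_cnj: "cmod (1 - x * cnj y) = cmod (1 - cnj x * y)"
  by (metis complex_cnj_cnj complex_cnj_diff complex_cnj_mult complex_cnj_one complex_mod_cnj)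

text \<open>Here the maps meet the kernel: \<open>varphi\<close> at \<open>z2\<close> sends \<open>z\<close> to the point
\<open>(f z, 0)\<close>, and the quotient \<open>T\<close> of the pair is the pairing of the first coordinates of the images.\<close>

lemma cnj_f_fun_varphi:
  assumes \<alpha>: "\<alpha> > 0" and z: "z \<in> U_dom \<alpha>" and w: "w \<in> U_dom \<alpha>"
  shows "cnj (f_fun \<alpha> z) * fst (varphi_map \<alpha> (snd z) w) = cnj (kernel_ratio \<alpha> z w)"
proof -
  have z2: "cmod (snd z) < 1" and w2: "cmod (snd w) < 1"
    using U_dom_snd_less_1[OF \<alpha>] z w by auto
  have p: "0 < (1 - (cmod (snd z))\<^sup>2) powr (\<alpha> / 2)"
    using one_minus_norm_sq_pos[OF z2] by simp
  have "Re (1 - snd z * cnj (snd w)) > 0"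
    using Re_one_minus_cnj_mult_pos[OF z2 w2] by simp
  then have c: "cnj ((1 - snd z * cnj (snd w)) powr of_real \<alpha>) = (1 - cnj (snd z) * snd w) powr of_real \<alpha>"
    by (subst cnj_powr) auto
  show ?thesis
    using p unfolding varphi_map_def moebius_factor_powr[OF z2 w2] kernel_ratio_def f_fun_def
    by (simp add: c)
qed

lemma norm_kernel_ratio:
  assumes \<alpha>: "\<alpha> > 0" and z: "z \<in> U_dom \<alpha>" and w: "cmod (snd w) < 1"
  shows "cmod (kernel_ratio \<alpha> z w) = cmod (f_fun \<alpha> z) * cmod (f_fun \<alpha> w) * (1 - (cmod (moebius (snd z) (snd w)))\<^sup>2) powr (\<alpha> / 2)"
proof -
  have z2: "cmod (snd z) < 1"
    using U_dom_snd_less_1[OF \<alpha>] z by auto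
  define A where "A = 1 - (cmod (snd z))\<^sup>2"
  define B where "B = 1 - (cmod (snd w))\<^sup>2"
  define x where "x = cmod (1 - cnj (snd z) * snd w)"
  have pos: "0 < A" "0 < B" "0 < x"
    using one_minus_norm_sq_pos z2 w one_minus_cnj_mult_nonzero[OF z2 w] by (auto simp: A_def B_def x_def)
  have "cmod (kernel_ratio \<alpha> z w) = cmod (fst z) * cmod (fst w) / x powr \<alpha>"
    by (simp add: kernel_ratio_def norm_divide norm_mult norm_powr_real_powr' norm_one_minus_mult_cnj x_def)
  moreover have "(1 - (cmod (moebius (snd z) (snd w)))\<^sup>2) powr (\<alpha> / 2) = A powr (\<alpha> / 2) * B powr (\<alpha> / 2) / x powr \<alpha>"
  proof -
    have "(x\<^sup>2) powr (\<alpha> / 2) = x powr \<alpha>"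
      using pos by (simp add: powr_powr flip: powr_numeral)
    then show ?thesis unfolding one_minus_norm_moebius[OF z2 w] A_def[symmetric] B_def[symmetric] x_def[symmetric]
      using pos by (simp add: powr_divide powr_mult)
  qed
  moreover have "cmod (f_fun \<alpha> z) = cmod (fst z) / A powr (\<alpha> / 2)" "cmod (f_fun \<alpha> w) = cmod (fst w) / B powr (\<alpha> / 2)"
    using pos by (simp_all add: f_fun_def norm_divide A_def B_def)
  ultimately show ?thesis using pos by simp
qed

text \<open>Concavity of the powers with exponent at most one, in the form of Young's inequality; larger exponents
are reduced to it by taking the inverse power.\<close>

lemma one_minus_powr_bounds:
  fixes s \<beta> :: real
  assumes s: "0 \<le> s" "s \<le> 1" and \<beta>: "0 < \<beta>"
  shows "min 1 \<beta> * (1 - s) \<le> 1 - s powr \<beta>" "1 - s powr \<beta> \<le> max 1 \<beta> * (1 - s)"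
proof -
  have young: "x powr b \<le> b * x + (1 - b)" if "0 < b" "b \<le> 1" "0 \<le> x" for x b :: real
    using Youngs_inequality_0[of b "1 - b" x 1] that by (cases "x = 0") auto
  have *: "min 1 \<beta> * (1 - s) \<le> 1 - s powr \<beta> \<and> 1 - s powr \<beta> \<le> max 1 \<beta> * (1 - s)"
  proof (cases "\<beta> \<le> 1")
    case True
    have "s \<le> s powr \<beta>"
      using powr_mono'[of \<beta> 1 s] s True by simp
    then show ?thesis using young[of \<beta> s] \<beta> True s by (simp add: min_def max_def algebra_simps)
  next
    case False
    have "s powr \<beta> \<le> s" using powr_mono'[of 1 \<beta> s] s False by simp
    moreover have "s \<le> 1 / \<beta> * s powr \<beta> + (1 - 1 / \<beta>)"
      using young[of "1 / \<beta>" "s powr \<beta>"] False s by (simp add: powr_powr)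
    then have "\<beta> * s \<le> \<beta> * (1 / \<beta> * s powr \<beta> + (1 - 1 / \<beta>))"
      using False by (intro mult_left_mono) auto
    moreover have "\<beta> * (1 / \<beta> * s powr \<beta> + (1 - 1 / \<beta>)) = s powr \<beta> + \<beta> - 1"
      using False by (simp add: algebra_simps)
    ultimately show ?thesis using False by (simp add: min_def max_def algebra_simps)
  qed
  then show "min 1 \<beta> * (1 - s) \<le> 1 - s powr \<beta>" "1 - s powr \<beta> \<le> max 1 \<beta> * (1 - s)" by auto
qed

text \<open>The quantities \<open>1 - s^(1/\<alpha>)\<close> and \<open>1 - s\<close> are comparable on the unit interval. The fibre
factor of the Jacobian of \<open>phi\<close> is therefore comparable with the ratio of the \<open>1 - |x|^2\<close> at the two
points, which is a third copy of the base factor.\<close>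

lemma phi_jacobian_lower:
  assumes \<alpha>: "\<alpha> > 0" and a: "cmod a < 1" and x: "cmod x < 1"
  shows "((1 - (cmod a)\<^sup>2) / (cmod (1 - cnj a * x))\<^sup>2) ^ 3 \<le>
     max 1 (1 / \<alpha>) / min 1 (1 / \<alpha>) * (((1 - (cmod a)\<^sup>2) / (cmod (1 - cnj a * x))\<^sup>2)\<^sup>2 *
        ((1 - cmod (moebius a x) powr (2 / \<alpha>)) / (1 - cmod x powr (2 / \<alpha>))))"
proof -
  define M where "M = max 1 (1 / \<alpha>)"
  define m where "m = min 1 (1 / \<alpha>)"
  define Q where "Q = (1 - (cmod a)\<^sup>2) / (cmod (1 - cnj a * x))\<^sup>2"
  have Qp: "0 \<le> Q" using one_minus_norm_sq_pos[OF a] by (simp add: Q_def)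
  have Mm: "0 < M" "0 < m" using \<alpha> by (auto simp: M_def m_def)
  have sq: "c powr (2 / \<alpha>) = (c\<^sup>2) powr (1 / \<alpha>)" if "0 \<le> c" for c :: real
    using that by (cases "c = 0") (auto simp: powr_powr simp flip: powr_numeral)
  define y where "y = cmod (moebius a x)"
  define t where "t = cmod x"
  have yt: "0 \<le> y" "y < 1" "0 \<le> t" "t < 1" using moebius_in_disc[OF a x] x by (auto simp: y_def t_def)
  have up: "1 - t powr (2 / \<alpha>) \<le> M * (1 - t\<^sup>2)"
    using one_minus_powr_bounds(2)[of "t\<^sup>2" "1 / \<alpha>"] yt \<alpha> by (simp add: sq M_def power_le_one)
  have lo: "m * (1 - y\<^sup>2) \<le> 1 - y powr (2 / \<alpha>)"
    using one_minus_powr_bounds(1)[of "y\<^sup>2" "1 / \<alpha>"] yt \<alpha> by (simp add: sq m_def power_le_one)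
  have tp: "0 < 1 - t powr (2 / \<alpha>)"
    using powr_less_iff_less_powr[of t 1 "\<alpha> / 2"] yt \<alpha> by auto
  have t2: "0 < 1 - t\<^sup>2" using one_minus_norm_sq_pos[OF x] by (simp add: t_def)
  have y2: "1 - y\<^sup>2 = Q * (1 - t\<^sup>2)"
    using one_minus_norm_moebius_ratio[OF a x] t2 by (simp add: Q_def y_def t_def field_simps)
  have "Q * (1 - t powr (2 / \<alpha>)) * m \<le> Q * (M * (1 - t\<^sup>2)) * m"
    using up Qp Mm by (intro mult_right_mono mult_left_mono) auto
  also have "\<dots> = M * (m * (1 - y\<^sup>2))" by (simp add: y2)
  also have "\<dots> \<le> M * (1 - y powr (2 / \<alpha>))" using lo Mm by (intro mult_left_mono) auto
  finally have "Q \<le> M / m * ((1 - y powr (2 / \<alpha>)) / (1 - t powr (2 / \<alpha>)))"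
    using Mm tp by (simp add: field_simps)
  then have "Q\<^sup>2 * Q \<le> Q\<^sup>2 * (M / m * ((1 - y powr (2 / \<alpha>)) / (1 - t powr (2 / \<alpha>))))"
    by (intro mult_left_mono) auto
  then show ?thesis unfolding M_def[symmetric] m_def[symmetric] Q_def[symmetric] y_def[symmetric] t_def[symmetric]
    by (simp add: power3_eq_cube power2_eq_square mult_ac)
qed

text \<open>For an automorphism taking \<open>z\<close> to the centre, \<open>|K(z,w)|^2 / K(z,z)\<close> is the Jacobian up to a
constant. The right-hand side is the Jacobian of \<open>varphi\<close> times the cube that bounds the Jacobian of
\<open>phi\<close>.\<close>

lemma kernel_size_sq_div_kernel_diag:
  assumes \<alpha>: "\<alpha> > 0" and z: "z \<in> U_dom \<alpha>" and w: "w \<in> U_dom \<alpha>"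
  defines "y \<equiv> fst (varphi_map \<alpha> (snd z) w)"
  shows "(kernel_size \<alpha> z w)\<^sup>2 / kernel_diag \<alpha> z =
     ((1 - (cmod (snd z))\<^sup>2) / (cmod (1 - cnj (snd z) * snd w))\<^sup>2) powr (2 + \<alpha>) *
     ((1 - (cmod (f_fun \<alpha> z))\<^sup>2) / (cmod (1 - cnj (f_fun \<alpha> z) * y))\<^sup>2) ^ 3"
proof -
  have z2: "cmod (snd z) < 1" and w2: "cmod (snd w) < 1"
    using U_dom_snd_less_1[OF \<alpha>] z w by auto
  have t: "cmod (f_fun \<alpha> z) < 1" by (rule norm_f_fun_less_1[OF \<alpha> z])
  have y: "cmod y < 1" unfolding y_def
    using U_dom_fst_less_1[OF \<alpha> varphi_map_in_U_dom[OF \<alpha> z2 w]] .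
  define A where "A = 1 - (cmod (snd z))\<^sup>2"
  define D where "D = 1 - (cmod (f_fun \<alpha> z))\<^sup>2"
  define x where "x = cmod (1 - cnj (snd z) * snd w)"
  define s where "s = cmod (1 - cnj (f_fun \<alpha> z) * y)"
  have pos: "0 < A" "0 < D" "0 < x" "0 < s"
    using one_minus_norm_sq_pos z2 t one_minus_cnj_mult_nonzero[OF z2 w2] one_minus_cnj_mult_nonzero[OF t y]
    by (auto simp: A_def D_def x_def s_def)
  have s: "cmod (1 - kernel_ratio \<alpha> z w) = s"
    unfolding s_def y_def cnj_f_fun_varphi[OF \<alpha> z w]
    by (metis complex_cnj_diff complex_cnj_one complex_mod_cnj)
  have x: "cmod (1 - snd z * cnj (snd w)) = x" by (simp add: x_def norm_one_minus_mult_cnj)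
  have k: "kernel_size \<alpha> z w = x powr (- (2 + \<alpha>)) * s powr (- 3)" unfolding kernel_size_def s x ..
  have d: "kernel_diag \<alpha> z = A powr (- (2 + \<alpha>)) * D powr (- 3)" by (simp add: kernel_diag_def A_def D_def)
  have "ln ((kernel_size \<alpha> z w)\<^sup>2 / kernel_diag \<alpha> z) = ln ((A / x\<^sup>2) powr (2 + \<alpha>) * (D / s\<^sup>2) ^ 3)"
    unfolding k d using pos by (simp add: ln_mult ln_div ln_powr ln_realpow algebra_simps)
  then have "(kernel_size \<alpha> z w)\<^sup>2 / kernel_diag \<alpha> z = (A / x\<^sup>2) powr (2 + \<alpha>) * (D / s\<^sup>2) ^ 3"
    by (subst (asm) ln_inj_iff) (use pos k d in auto)
  then show ?thesis by (simp add: A_def D_def x_def s_def)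
qed

lemma measurable_kernel_ratio [measurable (raw)]:
  assumes "f \<in> borel_measurable M" "g \<in> borel_measurable M"
  shows "(\<lambda>x. kernel_ratio \<alpha> (f x) (g x)) \<in> borel_measurable M"
proof -
  have [measurable]: "(\<lambda>x. fst (f x)) \<in> borel_measurable M" "(\<lambda>x. fst (g x)) \<in> borel_measurable M"
     "(\<lambda>x. snd (f x)) \<in> borel_measurable M" "(\<lambda>x. snd (g x)) \<in> borel_measurable M"
    using assms measurable_compose[OF _ measurable_fst_borel] measurable_compose[OF _ measurable_snd_borel] by auto
  show ?thesis unfolding kernel_ratio_def by measurable
qed

lemma measurable_kernel_size [measurable (raw)]:
  assumes [measurable]: "f \<in> borel_measurable M" "g \<in> borel_measurable M"
  shows "(\<lambda>x. kernel_size \<alpha> (f x) (g x)) \<in> borel_measurable M"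
proof -
  have [measurable]: "(\<lambda>x. snd (f x)) \<in> borel_measurable M" "(\<lambda>x. snd (g x)) \<in> borel_measurable M"
    using assms measurable_compose[OF _ measurable_snd_borel] by auto
  show ?thesis unfolding kernel_size_def by measurable
qed

lemma measurable_f_fun [measurable]: "f_fun \<alpha> \<in> borel_measurable borel"
  unfolding f_fun_def by measurable

lemma nn_integral_varphi_phi:
  fixes F :: "complex \<times> complex \<Rightarrow> ennreal"
  assumes \<alpha>: "\<alpha> > 0" and b: "cmod b < 1" and t: "cmod t < 1" and [measurable]: "F \<in> borel_measurable borel"
  defines "J \<equiv> \<lambda>x. ((1 - (cmod t)\<^sup>2) / (cmod (1 - cnj t * x))\<^sup>2)\<^sup>2 *
        ((1 - cmod (moebius t x) powr (2 / \<alpha>)) / (1 - cmod x powr (2 / \<alpha>)))"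
    and "Q \<equiv> \<lambda>x::complex\<times>complex. ((1 - (cmod b)\<^sup>2) / (cmod (1 - cnj b * snd x))\<^sup>2) powr (2 + \<alpha>)"
  shows "(\<integral>\<^sup>+x\<in>U_dom \<alpha>. F (varphi_map \<alpha> b (phi_map \<alpha> t x)) \<partial>lborel) =
    (\<integral>\<^sup>+w\<in>U_dom \<alpha>. F w * ennreal (J (fst (varphi_map \<alpha> b w))) * ennreal (Q w) \<partial>lborel)"
proof -
  have [measurable]: "J \<in> borel_measurable borel" unfolding J_def by measurable
  have [measurable]: "Q \<in> borel_measurable borel" unfolding Q_def by measurable
  have "(\<integral>\<^sup>+x\<in>U_dom \<alpha>. F (varphi_map \<alpha> b (phi_map \<alpha> t x)) \<partial>lborel) =
     (\<integral>\<^sup>+x\<in>U_dom \<alpha>. F (varphi_map \<alpha> b x) * ennreal (J (fst x)) \<partial>lborel)"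
    unfolding J_def by (rule nn_integral_phi_map[OF \<alpha> t, of "\<lambda>x. F (varphi_map \<alpha> b x)"]) measurable
  also have "\<dots> = (\<integral>\<^sup>+x\<in>U_dom \<alpha>. (\<lambda>w. F w * ennreal (J (fst (varphi_map \<alpha> b w)))) (varphi_map \<alpha> b x) \<partial>lborel)"
    by (intro nn_integral_cong) (auto simp: varphi_map_varphi_map[OF \<alpha> b] split: split_indicator)
  also have "\<dots> = (\<integral>\<^sup>+w\<in>U_dom \<alpha>. (F w * ennreal (J (fst (varphi_map \<alpha> b w)))) * ennreal (Q w) \<partial>lborel)"
    unfolding Q_def by (rule nn_integral_varphi_map[OF \<alpha> b]) measurable
  finally show ?thesis .
qed

text \<open>This turns the oscillation hypothesis, an average over \<open>\<Phi>(\<zeta>)\<close>, into an average over \<open>w\<close>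
with a weight given by the kernel.\<close>

lemma nn_integral_kernel_weight_le:
  fixes F :: "complex \<times> complex \<Rightarrow> ennreal"
  assumes \<alpha>: "\<alpha> > 0" and z: "z \<in> U_dom \<alpha>" and [measurable]: "F \<in> borel_measurable borel"
  shows "(\<integral>\<^sup>+w\<in>U_dom \<alpha>. F w * ennreal ((kernel_size \<alpha> z w)\<^sup>2 / kernel_diag \<alpha> z) \<partial>lborel) \<le>
    ennreal (max 1 (1 / \<alpha>) / min 1 (1 / \<alpha>)) *
      (\<integral>\<^sup>+x\<in>U_dom \<alpha>. F (varphi_map \<alpha> (snd z) (phi_map \<alpha> (f_fun \<alpha> z) x)) \<partial>lborel)"
proof -
  let ?U = "U_dom \<alpha>"
  define b where "b = snd z"
  define t where "t = f_fun \<alpha> z"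
  define C where "C = max 1 (1 / \<alpha>) / min 1 (1 / \<alpha>)"
  have C: "0 < C" using \<alpha> by (simp add: C_def)
  have b: "cmod b < 1" using U_dom_snd_less_1[OF \<alpha> z] by (simp add: b_def)
  have t: "cmod t < 1" using norm_f_fun_less_1[OF \<alpha> z] by (simp add: t_def)
  define J where "J = (\<lambda>x. ((1 - (cmod t)\<^sup>2) / (cmod (1 - cnj t * x))\<^sup>2)\<^sup>2 *
        ((1 - cmod (moebius t x) powr (2 / \<alpha>)) / (1 - cmod x powr (2 / \<alpha>))))"
  define Q where "Q = (\<lambda>x::complex\<times>complex. ((1 - (cmod b)\<^sup>2) / (cmod (1 - cnj b * snd x))\<^sup>2) powr (2 + \<alpha>))"
  have [measurable]: "J \<in> borel_measurable borel" unfolding J_def by measurable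
  have [measurable]: "Q \<in> borel_measurable borel" unfolding Q_def by measurable
  have eq: "(\<integral>\<^sup>+x\<in>?U. F (varphi_map \<alpha> b (phi_map \<alpha> t x)) \<partial>lborel) =
    (\<integral>\<^sup>+w\<in>?U. (F w * ennreal (J (fst (varphi_map \<alpha> b w)))) * ennreal (Q w) \<partial>lborel)"
    unfolding J_def Q_def by (rule nn_integral_varphi_phi[OF \<alpha> b t]) measurable
  have "(\<integral>\<^sup>+w\<in>?U. F w * ennreal ((kernel_size \<alpha> z w)\<^sup>2 / kernel_diag \<alpha> z) \<partial>lborel) \<le>
     (\<integral>\<^sup>+w. ennreal C * ((F w * ennreal (J (fst (varphi_map \<alpha> b w)))) * ennreal (Q w) * indicator ?U w) \<partial>lborel)"
  proof (intro nn_integral_mono)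
    fix w :: "complex \<times> complex"
    show "F w * ennreal ((kernel_size \<alpha> z w)\<^sup>2 / kernel_diag \<alpha> z) * indicator ?U w \<le>
       ennreal C * ((F w * ennreal (J (fst (varphi_map \<alpha> b w)))) * ennreal (Q w) * indicator ?U w)"
    proof (cases "w \<in> ?U")
      case True
      define y where "y = fst (varphi_map \<alpha> b w)"
      have y: "cmod y < 1" unfolding y_def
        using U_dom_fst_less_1[OF \<alpha> varphi_map_in_U_dom[OF \<alpha> b True]] .
      have Q0: "0 \<le> Q w" by (simp add: Q_def)
      have "(kernel_size \<alpha> z w)\<^sup>2 / kernel_diag \<alpha> z = Q w * ((1 - (cmod t)\<^sup>2) / (cmod (1 - cnj t * y))\<^sup>2) ^ 3"
        using kernel_size_sq_div_kernel_diag[OF \<alpha> z True] by (simp add: Q_def y_def b_def t_def)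
      also have "\<dots> \<le> Q w * (C * J y)"
        using phi_jacobian_lower[OF \<alpha> t y] Q0 by (intro mult_left_mono) (auto simp: C_def J_def)
      finally have le: "(kernel_size \<alpha> z w)\<^sup>2 / kernel_diag \<alpha> z \<le> C * (J y * Q w)" by (simp add: mult_ac)
      have J0: "0 \<le> J y"
        using powr_less_iff_less_powr[of "cmod (moebius t y)" 1 "\<alpha> / 2"] powr_less_iff_less_powr[of "cmod y" 1 "\<alpha> / 2"]
          moebius_in_disc[OF t y] y \<alpha> by (auto simp: J_def intro!: mult_nonneg_nonneg divide_nonneg_pos)
      have "F w * ennreal ((kernel_size \<alpha> z w)\<^sup>2 / kernel_diag \<alpha> z) \<le> F w * ennreal (C * (J y * Q w))"
        using le by (intro mult_left_mono ennreal_leI) auto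
      then show ?thesis using True C J0 Q0 by (simp add: ennreal_mult y_def mult_ac)
    qed simp
  qed
  also have "\<dots> = ennreal C * (\<integral>\<^sup>+w\<in>?U. (F w * ennreal (J (fst (varphi_map \<alpha> b w)))) * ennreal (Q w) \<partial>lborel)"
    by (rule nn_integral_cmult) measurable
  finally show ?thesis using eq unfolding C_def b_def t_def by simp
qed

section \<open>The kernel estimate behind the Schur test\<close>

text \<open>Test functions for Schur's test: powers of the boundary distances of the second coordinate and of the
normalised first coordinate in their unit discs.\<close>

definition schur_weight :: "real \<Rightarrow> real \<Rightarrow> real \<Rightarrow> complex \<times> complex \<Rightarrow> real" where
  "schur_weight \<alpha> a b w = (1 - (cmod (snd w))\<^sup>2) powr (- a) * (1 - (cmod (f_fun \<alpha> w))\<^sup>2) powr (- b)"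

lemma measurable_schur_weight [measurable]: "schur_weight \<alpha> a b \<in> borel_measurable borel"
  unfolding schur_weight_def by measurable

text \<open>The number whose square appears on the right is the parameter of the fibre integral. It approaches the
circle only if \<open>f z\<close> does so and, at the same time, \<open>w2\<close> approaches \<open>z2\<close>.\<close>

lemma one_minus_norm_kernel_ratio_lower:
  fixes \<alpha> t v :: real
  assumes \<alpha>: "\<alpha> > 0" and t: "0 \<le> t" "t < 1" and v: "0 \<le> v" "v < 1"
  shows "min 1 \<alpha> / 2 * ((1 - t\<^sup>2) + v\<^sup>2) \<le> 1 - (t * (1 - v\<^sup>2) powr (\<alpha> / 2))\<^sup>2"
proof -
  define m where "m = min 1 \<alpha>"
  have m: "0 < m" "m \<le> 1" using \<alpha> by (auto simp: m_def min_def)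
  have v2: "v\<^sup>2 < 1" "0 \<le> v\<^sup>2" using v by (auto simp: power_less_one_iff abs_square_less_1)
  have t2: "t\<^sup>2 < 1" "0 \<le> t\<^sup>2" using t by (auto simp: power_less_one_iff abs_square_less_1)
  have "m * (1 - (1 - v\<^sup>2)) \<le> 1 - (1 - v\<^sup>2) powr \<alpha>"
    unfolding m_def using v2 by (intro one_minus_powr_bounds \<alpha>) auto
  then have "(1 - v\<^sup>2) powr \<alpha> \<le> 1 - m * v\<^sup>2" by simp
  then have "t\<^sup>2 * (1 - v\<^sup>2) powr \<alpha> \<le> t\<^sup>2 * (1 - m * v\<^sup>2)" using t2 by (intro mult_left_mono) auto
  moreover have sq: "((1 - v\<^sup>2) powr (\<alpha> / 2))\<^sup>2 = (1 - v\<^sup>2) powr \<alpha>"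
    by (simp add: power2_eq_square[of "_ powr _"] powr_add[symmetric])
  moreover have "m * v\<^sup>2 * (1 - t\<^sup>2) \<le> 1 - t\<^sup>2"
    using m v2 t2 by (intro mult_left_le_one_le mult_le_one) auto
  moreover have "m * (1 - t\<^sup>2) \<le> 1 - t\<^sup>2"
    using m t2 by (intro mult_left_le_one_le) auto
  moreover have "0 \<le> m * v\<^sup>2 * t\<^sup>2" using m v2 t2 by simp
  ultimately show ?thesis unfolding m_def[symmetric] power_mult_distrib sq by (simp add: algebra_simps)
qed


text \<open>In the coordinate \<open>\<tau> = f w\<close> the quotient \<open>T\<close> is a constant times \<open>cnj \<tau>\<close>, so the
integral over a fibre is of Forelli-Rudin type.\<close>

lemma schur_weight_fibre_estimate:
  fixes q a b :: real
  assumes \<alpha>: "\<alpha> > 0" and q: "q > 1" and b: "3 * (q - 1) < b" "b < 1"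
  obtains K where "0 \<le> K" "\<And>z w2. z \<in> U_dom \<alpha> \<Longrightarrow>
     (\<integral>\<^sup>+w1. ennreal (kernel_size \<alpha> z (w1, w2) powr (2 - q) * schur_weight \<alpha> a b (w1, w2)) * indicator (U_dom \<alpha>) (w1, w2) \<partial>lborel)
      \<le> ennreal (K * (cmod (1 - cnj (snd z) * w2) powr (- ((2 + \<alpha>) * (2 - q))) * (1 - (cmod w2)\<^sup>2) powr (\<alpha> - a) *
            ((1 - (cmod (f_fun \<alpha> z))\<^sup>2) + (cmod (moebius (snd z) w2))\<^sup>2) powr (- (4 - 3 * q + b)))) * indicator (ball 0 1) w2"
proof -
  define N where "N = 3 * (2 - q)"
  define e where "e = 4 - 3 * q + b"
  have e: "e = N - 2 + b" by (simp add: e_def N_def)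
  obtain C where C: "0 \<le> C" "\<And>c. cmod c < 1 \<Longrightarrow>
     (\<integral>\<^sup>+v\<in>ball 0 1. ennreal (cmod (1 - cnj c * v) powr (- N) * (1 - (cmod v)\<^sup>2) powr (- b)) \<partial>lborel)
       \<le> ennreal (C * (1 - (cmod c)\<^sup>2) powr (- e))"
    using forelli_rudin_growth[of b N] b q unfolding e by (auto simp: N_def)
  define m where "m = min 1 \<alpha> / 2"
  have m: "0 < m" using \<alpha> by (auto simp: m_def min_def)
  have e1: "1 < e" using b by (simp add: e_def)
  have "(\<integral>\<^sup>+w1. ennreal (kernel_size \<alpha> z (w1, w2) powr (2 - q) * schur_weight \<alpha> a b (w1, w2)) * indicator (U_dom \<alpha>) (w1, w2) \<partial>lborel)
      \<le> ennreal (C * m powr (- e) * (cmod (1 - cnj (snd z) * w2) powr (- ((2 + \<alpha>) * (2 - q))) * (1 - (cmod w2)\<^sup>2) powr (\<alpha> - a) *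
            ((1 - (cmod (f_fun \<alpha> z))\<^sup>2) + (cmod (moebius (snd z) w2))\<^sup>2) powr (- e))) * indicator (ball 0 1) w2"
    if z: "z \<in> U_dom \<alpha>" for z w2
  proof (cases "cmod w2 < 1")
    case False
    then have "(w1, w2) \<notin> U_dom \<alpha>" for w1 using U_dom_snd_less_1[OF \<alpha>, of "(w1, w2)"] by auto
    then show ?thesis by simp
  next
    case w2: True
    have z2: "cmod (snd z) < 1" using U_dom_snd_less_1[OF \<alpha> z] .
    have t: "cmod (f_fun \<alpha> z) < 1" using norm_f_fun_less_1[OF \<alpha> z] .
    define B where "B = 1 - (cmod w2)\<^sup>2"
    have B: "0 < B" using one_minus_norm_sq_pos[OF w2] by (simp add: B_def)
    define R where "R = B powr (\<alpha> / 2)"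
    have R: "0 < R" using B by (simp add: R_def)
    define x where "x = cmod (1 - cnj (snd z) * w2)"
    define c where "c = kernel_ratio \<alpha> z (of_real R, w2)"
    define v where "v = cmod (moebius (snd z) w2)"
    have v: "0 \<le> v" "v < 1" using moebius_in_disc[OF z2 w2] by (auto simp: v_def)
    have fR: "f_fun \<alpha> (of_real R * \<tau>, w2) = \<tau>" for \<tau>
      using R by (simp add: f_fun_def R_def[unfolded B_def, symmetric])
    have ker: "kernel_ratio \<alpha> z (of_real R * \<tau>, w2) = c * cnj \<tau>" for \<tau>
      by (simp add: kernel_ratio_def c_def)
    have nc: "cmod c = cmod (f_fun \<alpha> z) * (1 - v\<^sup>2) powr (\<alpha> / 2)"
      using norm_kernel_ratio[OF \<alpha> z, of "(of_real R, w2)"] w2 fR[of 1] by (simp add: c_def v_def)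
    have low: "m * ((1 - (cmod (f_fun \<alpha> z))\<^sup>2) + v\<^sup>2) \<le> 1 - (cmod c)\<^sup>2"
      unfolding nc m_def using one_minus_norm_kernel_ratio_lower[OF \<alpha> _ t v] by simp
    have D: "0 < (1 - (cmod (f_fun \<alpha> z))\<^sup>2) + v\<^sup>2"
      using one_minus_norm_sq_pos[OF t] by (simp add: add_pos_nonneg)
    have c1: "cmod c < 1"
    proof -
      have "0 < 1 - (cmod c)\<^sup>2" using low m D by (smt (verit) mult_pos_pos)
      then show ?thesis by (simp add: abs_square_less_1)
    qed
    define G where "G = (\<lambda>w1. ennreal (kernel_size \<alpha> z (w1, w2) powr (2 - q) * schur_weight \<alpha> a b (w1, w2)) * indicator (U_dom \<alpha>) (w1, w2))"
    have G[measurable]: "G \<in> borel_measurable borel"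
    proof -
      have [measurable]: "(\<lambda>w1. (w1, w2)) \<in> borel \<rightarrow>\<^sub>M (borel :: (complex \<times> complex) measure)"
        by (intro borel_measurable_continuous_onI continuous_intros)
      show ?thesis unfolding G_def by measurable
    qed
    have GR: "G (of_real R * \<tau>) = ennreal (x powr (- ((2 + \<alpha>) * (2 - q))) * B powr (- a)) *
        (ennreal (cmod (1 - cnj c * \<tau>) powr (- N) * (1 - (cmod \<tau>)\<^sup>2) powr (- b)) * indicator (ball 0 1) \<tau>)" for \<tau>
    proof -
      have "(of_real R * \<tau>, w2) \<in> U_dom \<alpha> \<longleftrightarrow> \<tau> \<in> ball 0 1"
        unfolding U_dom_iff_snd[OF \<alpha>] using w2 R by (simp add: norm_mult R_def[unfolded B_def, symmetric])
      moreover have "kernel_size \<alpha> z (of_real R * \<tau>, w2) powr (2 - q) = x powr (- ((2 + \<alpha>) * (2 - q))) * cmod (1 - cnj c * \<tau>) powr (- N)"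
        unfolding kernel_size_def ker norm_one_minus_mult_cnj snd_conv x_def
        by (simp add: powr_mult powr_powr N_def left_diff_distrib distrib_right)
      moreover have "schur_weight \<alpha> a b (of_real R * \<tau>, w2) = B powr (- a) * (1 - (cmod \<tau>)\<^sup>2) powr (- b)"
        by (simp add: schur_weight_def fR B_def)
      ultimately show ?thesis
        by (simp add: G_def ennreal_mult[symmetric] mult_ac split: split_indicator)
    qed
    have "(\<integral>\<^sup>+w1. G w1 \<partial>lborel) = (\<integral>\<^sup>+\<tau>. G (of_real R * \<tau>) \<partial>lborel) * ennreal ((cmod (of_real R))\<^sup>2)"
      using R by (intro nn_integral_complex_scale[symmetric] G) auto
    also have "(\<integral>\<^sup>+\<tau>. G (of_real R * \<tau>) \<partial>lborel) = ennreal (x powr (- ((2 + \<alpha>) * (2 - q))) * B powr (- a)) *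
       (\<integral>\<^sup>+\<tau>. (ennreal (cmod (1 - cnj c * \<tau>) powr (- N) * (1 - (cmod \<tau>)\<^sup>2) powr (- b)) * indicator (ball 0 1) \<tau>) \<partial>lborel)"
      unfolding GR by (rule nn_integral_cmult) measurable
    also have "\<dots> * ennreal ((cmod (of_real R))\<^sup>2) \<le> ennreal (x powr (- ((2 + \<alpha>) * (2 - q))) * B powr (- a)) *
        ennreal (C * (1 - (cmod c)\<^sup>2) powr (- e)) * ennreal ((cmod (of_real R))\<^sup>2)"
      by (intro mult_left_mono mult_right_mono C(2)[OF c1]) auto
    also have "\<dots> \<le> ennreal (x powr (- ((2 + \<alpha>) * (2 - q))) * B powr (- a)) *
        ennreal (C * (m powr (- e) * ((1 - (cmod (f_fun \<alpha> z))\<^sup>2) + v\<^sup>2) powr (- e))) * ennreal ((cmod (of_real R))\<^sup>2)"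
    proof -
      have "(1 - (cmod c)\<^sup>2) powr (- e) \<le> (m * ((1 - (cmod (f_fun \<alpha> z))\<^sup>2) + v\<^sup>2)) powr (- e)"
        using low m D e1 by (intro powr_mono2') auto
      also have "\<dots> = m powr (- e) * ((1 - (cmod (f_fun \<alpha> z))\<^sup>2) + v\<^sup>2) powr (- e)"
        using m D by (simp add: powr_mult)
      finally show ?thesis using C(1) by (intro mult_left_mono mult_right_mono ennreal_leI) auto
    qed
    also have "\<dots> = ennreal (C * m powr (- e) * (x powr (- ((2 + \<alpha>) * (2 - q))) * B powr (\<alpha> - a) * ((1 - (cmod (f_fun \<alpha> z))\<^sup>2) + v\<^sup>2) powr (- e)))"
    proof -
      have "R\<^sup>2 = B powr \<alpha>" by (simp add: R_def power2_eq_square powr_add[symmetric])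
      moreover have "B powr (\<alpha> - a) = B powr \<alpha> * B powr (- a)" by (simp add: powr_add[symmetric])
      ultimately show ?thesis using C(1) by (simp add: ennreal_mult[symmetric] mult_ac)
    qed
    finally show ?thesis using w2 by (simp add: G_def B_def x_def v_def)
  qed
  then show thesis using that[of "C * m powr (- e)"] C(1) unfolding e_def by simp
qed

text \<open>The Moebius substitution centred at \<open>z2\<close> moves the singularity left by the fibre integrals to the
origin. All powers of \<open>1 - |z2|^2\<close> come out of the substitution, those of \<open>1 - |f z|^2\<close> come from the
singularity.\<close>

lemma schur_kernel_estimate:
  fixes q a b :: real
  assumes \<alpha>: "\<alpha> > 0" and q: "q > 1" and a: "(2 + \<alpha>) * (q - 1) < a" "a < 1 + \<alpha>" and b: "3 * (q - 1) < b" "b < 1"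
  obtains C where "0 \<le> C" "\<And>z. z \<in> U_dom \<alpha> \<Longrightarrow>
     (\<integral>\<^sup>+w\<in>U_dom \<alpha>. ennreal (kernel_size \<alpha> z w powr (2 - q) * schur_weight \<alpha> a b w) \<partial>lborel)
      \<le> ennreal (C * (kernel_diag \<alpha> z powr (1 - q) * schur_weight \<alpha> a b z))"
proof -
  obtain K where K: "0 \<le> K" "\<And>z w2. z \<in> U_dom \<alpha> \<Longrightarrow>
     (\<integral>\<^sup>+w1. ennreal (kernel_size \<alpha> z (w1, w2) powr (2 - q) * schur_weight \<alpha> a b (w1, w2)) * indicator (U_dom \<alpha>) (w1, w2) \<partial>lborel)
      \<le> ennreal (K * (cmod (1 - cnj (snd z) * w2) powr (- ((2 + \<alpha>) * (2 - q))) * (1 - (cmod w2)\<^sup>2) powr (\<alpha> - a) *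
            ((1 - (cmod (f_fun \<alpha> z))\<^sup>2) + (cmod (moebius (snd z) w2))\<^sup>2) powr (- (4 - 3 * q + b)))) * indicator (ball 0 1) w2"
    using schur_weight_fibre_estimate[OF \<alpha> q b, of a] by blast
  define e where "e = 4 - 3 * q + b"
  have e1: "1 < e" using b by (simp add: e_def)
  define N where "N = (2 + \<alpha>) * q - 2 * a"
  have N: "N < 2 + (\<alpha> - a)" using a by (simp add: N_def algebra_simps)
  obtain C where C: "0 \<le> C" "\<And>c \<delta>. cmod c < 1 \<Longrightarrow> 0 < \<delta> \<Longrightarrow> \<delta> \<le> 1 \<Longrightarrow>
     (\<integral>\<^sup>+v\<in>ball 0 1. ennreal (cmod (1 - cnj c * v) powr (- N) * (1 - (cmod v)\<^sup>2) powr (\<alpha> - a) * (\<delta> + (cmod v)\<^sup>2) powr (- e)) \<partial>lborel)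
     \<le> ennreal (C * \<delta> powr (1 - e))"
    using forelli_rudin_interior_singularity[OF _ N e1] a(2) by auto
  have "(\<integral>\<^sup>+w\<in>U_dom \<alpha>. ennreal (kernel_size \<alpha> z w powr (2 - q) * schur_weight \<alpha> a b w) \<partial>lborel)
      \<le> ennreal (K * C * (kernel_diag \<alpha> z powr (1 - q) * schur_weight \<alpha> a b z))" if z: "z \<in> U_dom \<alpha>" for z
  proof -
    define c where "c = snd z"
    have c: "cmod c < 1" using U_dom_snd_less_1[OF \<alpha> z] by (simp add: c_def)
    have t: "cmod (f_fun \<alpha> z) < 1" using norm_f_fun_less_1[OF \<alpha> z] .
    define A where "A = 1 - (cmod c)\<^sup>2"
    have A: "0 < A" using one_minus_norm_sq_pos[OF c] by (simp add: A_def)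
    define \<delta> where "\<delta> = 1 - (cmod (f_fun \<alpha> z))\<^sup>2"
    have \<delta>: "0 < \<delta>" "\<delta> \<le> 1" using one_minus_norm_sq_pos[OF t] by (auto simp: \<delta>_def)
    have m1: "(\<lambda>w. ennreal (kernel_size \<alpha> z w powr (2 - q) * schur_weight \<alpha> a b w) * indicator (U_dom \<alpha>) w) \<in> borel_measurable borel"
      by measurable
    define g where "g = (\<lambda>v. K * (\<delta> + (cmod v)\<^sup>2) powr (- e))"
    have [measurable]: "g \<in> borel_measurable borel" unfolding g_def by measurable
    have g0: "0 \<le> g v" for v using K(1) by (simp add: g_def)
    have ex: "2 + - ((2 + \<alpha>) * (2 - q)) + (\<alpha> - a) = (2 + \<alpha>) * (q - 1) - a"
       "4 + - ((2 + \<alpha>) * (2 - q)) + 2 * (\<alpha> - a) = N"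
      by (simp_all add: N_def algebra_simps)
    have "(\<integral>\<^sup>+w\<in>U_dom \<alpha>. ennreal (kernel_size \<alpha> z w powr (2 - q) * schur_weight \<alpha> a b w) \<partial>lborel) \<le>
      (\<integral>\<^sup>+w2\<in>ball 0 1. ennreal (cmod (1 - cnj c * w2) powr (- ((2 + \<alpha>) * (2 - q))) * (1 - (cmod w2)\<^sup>2) powr (\<alpha> - a) * g (moebius c w2)) \<partial>lborel)"
      unfolding nn_integral_lborel_pair_snd[OF m1] c_def \<delta>_def e_def g_def
      using K(2)[OF z] by (intro nn_integral_mono) (simp only: mult.left_commute[of _ K])
    also have "\<dots> = ennreal (A powr ((2 + \<alpha>) * (q - 1) - a)) *
       (\<integral>\<^sup>+v\<in>ball 0 1. ennreal (cmod (1 - cnj c * v) powr (- N) * (1 - (cmod v)\<^sup>2) powr (\<alpha> - a) * g v) \<partial>lborel)"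
      unfolding A_def by (subst nn_integral_disc_weight_moebius[OF c _ g0]) (simp_all only: ex, measurable)
    also have "\<dots> = ennreal (A powr ((2 + \<alpha>) * (q - 1) - a)) * (\<integral>\<^sup>+v. ennreal K *
       (ennreal (cmod (1 - cnj c * v) powr (- N) * (1 - (cmod v)\<^sup>2) powr (\<alpha> - a) * (\<delta> + (cmod v)\<^sup>2) powr (- e)) * indicator (ball 0 1) v) \<partial>lborel)"
      unfolding g_def mult.left_commute[of _ K] ennreal_mult'[OF K(1)] mult.assoc ..
    also have "\<dots> = ennreal (K * A powr ((2 + \<alpha>) * (q - 1) - a)) *
       (\<integral>\<^sup>+v\<in>ball 0 1. ennreal (cmod (1 - cnj c * v) powr (- N) * (1 - (cmod v)\<^sup>2) powr (\<alpha> - a) * (\<delta> + (cmod v)\<^sup>2) powr (- e)) \<partial>lborel)"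
      using K(1) by (subst nn_integral_cmult) (measurable, simp add: ennreal_mult mult_ac)
    also have "\<dots> \<le> ennreal (K * A powr ((2 + \<alpha>) * (q - 1) - a)) * ennreal (C * \<delta> powr (1 - e))"
      by (intro mult_left_mono C(2)[OF c \<delta>]) auto
    also have "\<dots> = ennreal (K * C * (A powr ((2 + \<alpha>) * (q - 1) - a) * \<delta> powr (1 - e)))"
      using K(1) C(1) by (simp add: ennreal_mult[symmetric] mult_ac)
    also have "A powr ((2 + \<alpha>) * (q - 1) - a) * \<delta> powr (1 - e) = kernel_diag \<alpha> z powr (1 - q) * schur_weight \<alpha> a b z"
    proof -
      have "ln (A powr ((2 + \<alpha>) * (q - 1) - a) * \<delta> powr (1 - e)) =
         ln ((A powr (- (2 + \<alpha>)) * \<delta> powr (- 3)) powr (1 - q) * (A powr (- a) * \<delta> powr (- b)))"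
        using A \<delta> by (simp add: ln_mult ln_powr e_def algebra_simps)
      then have "A powr ((2 + \<alpha>) * (q - 1) - a) * \<delta> powr (1 - e) =
         (A powr (- (2 + \<alpha>)) * \<delta> powr (- 3)) powr (1 - q) * (A powr (- a) * \<delta> powr (- b))"
        by (subst (asm) ln_inj_iff) (use \<delta> A in auto)
      then show ?thesis by (simp add: kernel_diag_def schur_weight_def A_def \<delta>_def c_def)
    qed
    finally show ?thesis .
  qed
  then show thesis using that[of "K * C"] K(1) C(1) by simp
qed

section \<open>A weighted reproducing formula on the disc\<close>

lemma distr_lborel_rotate:
  assumes "cmod c = 1" shows "distr lborel borel ((*) c) = lborel"
proof (rule measure_eqI)
  fix A assume "A \<in> sets (distr lborel borel ((*) c))"
  then have [measurable]: "A \<in> sets borel" by simp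
  have m: "(*) c -` A \<in> sets borel"
    using measurable_sets[of "(*) c" borel borel A] by simp
  have "emeasure (distr lborel borel ((*) c)) A = emeasure lborel ((*) c -` A)"
    by (subst emeasure_distr) auto
  also have "\<dots> = (\<integral>\<^sup>+z. indicator ((*) c -` A) z \<partial>lborel)"
    using m by simp
  also have "\<dots> = (\<integral>\<^sup>+z. indicator A (c * z) \<partial>lborel)"
    by (intro nn_integral_cong) (auto split: split_indicator)
  also have "\<dots> = emeasure lborel A"
    using nn_integral_complex_scale[of "indicator A" c] assms by (cases "c = 0") auto
  finally show "emeasure (distr lborel borel ((*) c)) A = emeasure lborel A" .
qed simp

lemma integral_complex_rotate:
  fixes f :: "complex \<Rightarrow> complex"
  assumes "cmod c = 1" and [measurable]: "f \<in> borel_measurable borel"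
  shows "(LINT z|lborel. f (c * z)) = (LINT z|lborel. f z)"
  by (subst (2) distr_lborel_rotate[OF assms(1), symmetric], subst integral_distr) auto

lemma integrable_disc_bounded:
  fixes f :: "complex \<Rightarrow> 'a :: {banach, second_countable_topology}"
  assumes "f \<in> borel_measurable borel" "\<And>x. cmod x < r \<Longrightarrow> norm (f x) \<le> B"
  shows "integrable lborel (\<lambda>x. indicator (ball 0 r) x *\<^sub>R f x)"
  using assms emeasure_lborel_ball_finite[of "0::complex" r]
  by (intro integrableI_bounded_set_indicator) auto

text \<open>A rotation by the angle \<open>\<pi> / (m - n)\<close> changes the sign of the integrand.\<close>

lemma disc_monomial_orthogonal:
  fixes \<omega> :: "complex \<Rightarrow> real"
  assumes [measurable]: "\<omega> \<in> borel_measurable borel"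
    and rot: "\<And>c x. cmod c = 1 \<Longrightarrow> \<omega> (c * x) = \<omega> x" and "m \<noteq> n"
  shows "(LINT x|lborel. indicator (ball 0 r) x *\<^sub>R (of_real (\<omega> x) * x ^ m * cnj x ^ n)) = 0"
proof -
  define k where "k = real m - real n"
  define c where "c = cis (pi / k)"
  have k: "k \<noteq> 0" using \<open>m \<noteq> n\<close> by (simp add: k_def)
  have c: "cmod c = 1" by (simp add: c_def)
  have "c ^ m * cnj c ^ n = cis (real m * (pi / k)) * cis (- (real n * (pi / k)))"
    by (simp add: c_def cis_cnj Complex.DeMoivre)
  also have "\<dots> = cis (k * (pi / k))"
    by (simp add: cis_mult k_def algebra_simps diff_divide_distrib)
  also have "\<dots> = -1" using k by (simp add: cis_pi)
  finally have cc: "c ^ m * cnj c ^ n = -1" .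
  define I where "I = (LINT x|lborel. indicator (ball 0 r) x *\<^sub>R (of_real (\<omega> x) * x ^ m * cnj x ^ n))"
  have "I = (LINT x|lborel. indicator (ball 0 r) (c * x) *\<^sub>R (of_real (\<omega> (c * x)) * (c * x) ^ m * cnj (c * x) ^ n))"
    unfolding I_def by (rule integral_complex_rotate[OF c, symmetric]) measurable
  also have "\<dots> = (LINT x|lborel. (c ^ m * cnj c ^ n) * (indicator (ball 0 r) x *\<^sub>R (of_real (\<omega> x) * x ^ m * cnj x ^ n)))"
  proof (intro Bochner_Integration.integral_cong refl)
    fix x
    have ind: "indicator (ball 0 r) (c * x) = (indicator (ball 0 r) x :: real)"
      by (simp add: indicator_def norm_mult c)
    show "indicator (ball 0 r) (c * x) *\<^sub>R (of_real (\<omega> (c * x)) * (c * x) ^ m * cnj (c * x) ^ n) =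
       (c ^ m * cnj c ^ n) * (indicator (ball 0 r) x *\<^sub>R (of_real (\<omega> x) * x ^ m * cnj x ^ n))"
      unfolding rot[OF c] ind power_mult_distrib complex_cnj_mult by (simp add: scaleR_conv_of_real)
  qed
  also have "\<dots> = - I" unfolding cc I_def by simp
  finally show ?thesis by (simp add: I_def)
qed

text \<open>On a smaller disc the Taylor series may be integrated term by term, and orthogonality leaves one term.\<close>

lemma disc_moment_compact:
  fixes \<omega> :: "complex \<Rightarrow> real" and g :: "complex \<Rightarrow> complex"
  assumes [measurable]: "\<omega> \<in> borel_measurable borel" and bd: "\<And>x. cmod x < r \<Longrightarrow> \<bar>\<omega> x\<bar> \<le> 1"
    and rot: "\<And>c x. cmod c = 1 \<Longrightarrow> \<omega> (c * x) = \<omega> x"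
    and g: "g holomorphic_on ball 0 R" and r: "0 < r" "r < R"
  shows "(LINT x|lborel. indicator (ball 0 r) x *\<^sub>R (of_real (\<omega> x) * g x * cnj x ^ n)) =
     (deriv ^^ n) g 0 / fact n * of_real (LINT x|lborel. indicator (ball 0 r) x * (\<omega> x * cmod x ^ (2 * n)))"
proof -
  define a where "a = (\<lambda>m. (deriv ^^ m) g 0 / fact m)"
  define f where "f = (\<lambda>m x. indicator (ball 0 r) x *\<^sub>R (of_real (\<omega> x) * (a m * x ^ m) * cnj x ^ n))"
  define r' where "r' = (r + R) / 2"
  have r': "r < r'" "r' < R" using r by (auto simp: r'_def)
  have sm: "(\<lambda>m. a m * x ^ m) sums g x" if "cmod x < R" for x
    using holomorphic_power_series[OF g, of x] that by (simp add: a_def)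
  have "summable (\<lambda>m. a m * (of_real r') ^ m)"
    using sm[of "of_real r'"] r r' by (simp add: sums_iff)
  then have sn: "summable (\<lambda>m. norm (a m * of_real r ^ m))"
    by (rule powser_insidea) (use r r' in auto)
  have f_meas: "f m \<in> borel_measurable borel" for m unfolding f_def by measurable
  have fb: "norm (of_real (\<omega> x) * (a m * x ^ m) * cnj x ^ n) \<le> norm (a m * of_real r ^ m) * r ^ n" if "cmod x < r" for x m
  proof -
    have "norm (of_real (\<omega> x) * (a m * x ^ m) * cnj x ^ n) = \<bar>\<omega> x\<bar> * (cmod (a m) * cmod x ^ m) * cmod x ^ n"
      by (simp add: norm_mult norm_power)
    also have "\<dots> \<le> 1 * (cmod (a m) * r ^ m) * r ^ n"
      using that r bd[OF that] by (intro mult_mono power_mono) auto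
    finally show ?thesis using r by (simp add: norm_mult norm_power)
  qed
  have f_int: "integrable lborel (f m)" for m
    unfolding f_def by (rule integrable_disc_bounded[OF _ fb]) measurable
  define A where "A = measure lborel (ball (0::complex) r)"
  have f_le: "(LINT x|lborel. norm (f m x)) \<le> norm (a m * of_real r ^ m) * r ^ n * A" for m
  proof -
    have "(LINT x|lborel. norm (f m x)) \<le> (LINT x|lborel. indicator (ball (0::complex) r) x *\<^sub>R (norm (a m * of_real r ^ m) * r ^ n))"
    proof (rule Bochner_Integration.integral_mono[OF integrable_norm[OF f_int]])
      show "integrable lborel (\<lambda>x. indicat_real (ball (0::complex) r) x *\<^sub>R (norm (a m * of_real r ^ m) * r ^ n))"
        by (rule integrable_disc_bounded[of _ _ "norm (norm (a m * of_real r ^ m) * r ^ n)"]) auto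
      show "norm (f m x) \<le> indicat_real (ball 0 r) x *\<^sub>R (norm (a m * of_real r ^ m) * r ^ n)" for x
        using fb[of x m] by (auto simp: f_def split: split_indicator)
    qed
    then show ?thesis by (simp add: A_def mult_ac)
  qed
  have sums_f: "(\<lambda>m. f m x) sums (indicator (ball 0 r) x *\<^sub>R (of_real (\<omega> x) * g x * cnj x ^ n))" for x
  proof (cases "cmod x < r")
    case True
    then have "(\<lambda>m. of_real (\<omega> x) * (a m * x ^ m) * cnj x ^ n) sums (of_real (\<omega> x) * g x * cnj x ^ n)"
      using r by (intro sums_mult sums_mult2 sm) auto
    then show ?thesis using True by (simp add: f_def)
  qed (simp add: f_def)
  have sn_f: "summable (\<lambda>m. norm (f m x))" for x
  proof (rule summable_comparison_test'[of "\<lambda>m. norm (a m * of_real r ^ m) * r ^ n" 0])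
    show "summable (\<lambda>m. norm (a m * of_real r ^ m) * r ^ n)" by (intro summable_mult2 sn)
    show "norm (norm (f m x)) \<le> norm (a m * of_real r ^ m) * r ^ n" for m
      using fb[of x m] r by (auto simp: f_def split: split_indicator)
  qed
  have "(\<lambda>m. integral\<^sup>L lborel (f m)) sums (\<integral>x. (\<Sum>m. f m x) \<partial>lborel)"
  proof (rule sums_integral[OF f_int])
    show "AE x in lborel. summable (\<lambda>m. norm (f m x))" using sn_f by simp
    show "summable (\<lambda>m. LINT x|lborel. norm (f m x))"
      by (rule summable_comparison_test'[of "\<lambda>m. norm (a m * of_real r ^ m) * r ^ n * A" 0])
         (use f_le in \<open>auto intro!: summable_mult2 sn\<close>)
  qed
  also have "(\<integral>x. (\<Sum>m. f m x) \<partial>lborel) = (LINT x|lborel. indicator (ball 0 r) x *\<^sub>R (of_real (\<omega> x) * g x * cnj x ^ n))"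
    using sums_f by (intro Bochner_Integration.integral_cong refl) (simp add: sums_iff)
  finally have S: "(\<lambda>m. integral\<^sup>L lborel (f m)) sums (LINT x|lborel. indicator (ball 0 r) x *\<^sub>R (of_real (\<omega> x) * g x * cnj x ^ n))" .
  have f_eq: "integral\<^sup>L lborel (f m) = a m * (LINT x|lborel. indicator (ball 0 r) x *\<^sub>R (of_real (\<omega> x) * x ^ m * cnj x ^ n))" for m
    unfolding f_def by (subst integral_mult_right_zero[symmetric], intro Bochner_Integration.integral_cong) auto
  have "(\<lambda>m. integral\<^sup>L lborel (f m)) sums integral\<^sup>L lborel (f n)"
    by (rule sums_finite[of "{n}", simplified]) (simp add: f_eq disc_monomial_orthogonal rot)
  with S have "(LINT x|lborel. indicator (ball 0 r) x *\<^sub>R (of_real (\<omega> x) * g x * cnj x ^ n)) = integral\<^sup>L lborel (f n)"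
    by (rule sums_unique2)
  also have "\<dots> = a n * (LINT x|lborel. complex_of_real (indicator (ball 0 r) x * (\<omega> x * cmod x ^ (2 * n))))"
  proof -
    have "x ^ n * cnj x ^ n = complex_of_real (cmod x ^ (2 * n))" for x
      by (simp add: power_mult_distrib[symmetric] complex_norm_square[symmetric] power_mult del: of_real_power)
         (simp add: power_mult)
    then show ?thesis unfolding f_eq
      by (intro arg_cong[where f = "(*) (a n)"] Bochner_Integration.integral_cong)
         (auto simp: mult.assoc split: split_indicator)
  qed
  finally show ?thesis by (simp only: a_def integral_complex_of_real)
qed

text \<open>The function \<open>g\<close> may be unbounded, so the disc is exhausted by smaller ones.\<close>

lemma disc_moment:
  fixes \<omega> :: "complex \<Rightarrow> real" and g :: "complex \<Rightarrow> complex"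
  assumes \<omega>[measurable]: "\<omega> \<in> borel_measurable borel" and bd: "\<And>x. cmod x < R \<Longrightarrow> \<bar>\<omega> x\<bar> \<le> 1"
    and rot: "\<And>c x. cmod c = 1 \<Longrightarrow> \<omega> (c * x) = \<omega> x"
    and g: "g holomorphic_on ball 0 R" and R: "0 < R"
    and int: "integrable lborel (\<lambda>x. indicator (ball 0 R) x *\<^sub>R (of_real (\<omega> x) * g x))"
  shows "(LINT x|lborel. indicator (ball 0 R) x *\<^sub>R (of_real (\<omega> x) * g x * cnj x ^ n)) =
     (deriv ^^ n) g 0 / fact n * of_real (LINT x|lborel. indicator (ball 0 R) x * (\<omega> x * cmod x ^ (2 * n)))"
proof -
  define r where "r = (\<lambda>k::nat. R * (1 - 1 / (real k + 2)))"
  have r: "0 < r k" "r k < R" for k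
  proof -
    have "0 < 1 - 1 / (real k + 2)" "1 - 1 / (real k + 2) < 1" by (auto simp: field_simps)
    then show "0 < r k" "r k < R" using R mult_strict_left_mono[of "1 - 1 / (real k + 2)" 1 R]
      by (auto simp: r_def)
  qed
  have r_lim: "r \<longlonglongrightarrow> R * (1 - 0)"
    unfolding r_def by (intro tendsto_intros) real_asymp
  have ev: "eventually (\<lambda>k. indicator (ball 0 (r k)) x = (indicator (ball 0 R) x :: real)) sequentially" for x :: complex
  proof (cases "cmod x < R")
    case True
    have "eventually (\<lambda>k. cmod x < r k) sequentially"
      using r_lim True by (intro order_tendstoD(1)[of r R]) auto
    then show ?thesis by eventually_elim (use True in auto)
  next
    case False
    then have "\<not> cmod x < r k" for k using r(2)[of k] by simp
    then show ?thesis using False by simp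
  qed
  define h where "h = (\<lambda>x. indicator (ball 0 R) x *\<^sub>R (of_real (\<omega> x) * g x * cnj x ^ n))"
  have g_meas: "(\<lambda>x. indicator (ball 0 R) x *\<^sub>R g x) \<in> borel_measurable borel"
    using g by (intro borel_measurable_continuous_on_indicator holomorphic_on_imp_continuous_on) auto
  have h_eq: "h = (\<lambda>x. of_real (\<omega> x) * (indicator (ball 0 R) x *\<^sub>R g x) * cnj x ^ n)"
    by (auto simp: h_def fun_eq_iff)
  have h_meas[measurable]: "h \<in> borel_measurable borel"
    unfolding h_eq using g_meas by measurable
  have h_r: "indicator (ball 0 (r k)) x *\<^sub>R h x = indicator (ball 0 (r k)) x *\<^sub>R (of_real (\<omega> x) * g x * cnj x ^ n)" for k x
    using r(2)[of k] by (auto simp: h_def split: split_indicator)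
  have "(\<lambda>k. LINT x|lborel. indicator (ball 0 (r k)) x *\<^sub>R h x) \<longlonglongrightarrow> (LINT x|lborel. h x)"
  proof (rule integral_dominated_convergence)
    show "integrable lborel (\<lambda>x. R ^ n * norm (indicator (ball 0 R) x *\<^sub>R (of_real (\<omega> x) * g x)))"
      using int by (intro integrable_mult_right integrable_norm)
    show "AE x in lborel. (\<lambda>k. indicator (ball 0 (r k)) x *\<^sub>R h x) \<longlonglongrightarrow> h x"
    proof (intro AE_I2 tendsto_eventually)
      fix x
      show "eventually (\<lambda>k. indicator (ball 0 (r k)) x *\<^sub>R h x = h x) sequentially"
        using ev[of x] by eventually_elim (auto simp: h_def split: split_indicator)
    qed
    show "AE x in lborel. norm (indicator (ball 0 (r k)) x *\<^sub>R h x) \<le> R ^ n * norm (indicator (ball 0 R) x *\<^sub>R (of_real (\<omega> x) * g x))" for k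
    proof (intro AE_I2)
      fix x :: complex
      have "norm (h x) \<le> R ^ n * norm (indicator (ball 0 R) x *\<^sub>R (of_real (\<omega> x) * g x))"
      proof (cases "cmod x < R")
        case True
        then have "cmod x ^ n \<le> R ^ n" by (intro power_mono) auto
        then have "\<bar>\<omega> x\<bar> * cmod (g x) * cmod x ^ n \<le> \<bar>\<omega> x\<bar> * cmod (g x) * R ^ n"
          by (intro mult_left_mono) auto
        then show ?thesis using True by (simp add: h_def norm_mult norm_power mult_ac)
      qed (simp add: h_def)
      moreover have "norm (indicator (ball 0 (r k)) x *\<^sub>R h x) \<le> norm (h x)" by (auto split: split_indicator)
      ultimately show "norm (indicator (ball 0 (r k)) x *\<^sub>R h x) \<le> R ^ n * norm (indicator (ball 0 R) x *\<^sub>R (of_real (\<omega> x) * g x))"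
        by linarith
    qed
  qed measurable
  moreover have "(\<lambda>k. LINT x|lborel. indicator (ball 0 (r k)) x * (\<omega> x * cmod x ^ (2 * n))) \<longlonglongrightarrow>
      (LINT x|lborel. indicator (ball 0 R) x * (\<omega> x * cmod x ^ (2 * n)))"
  proof (rule integral_dominated_convergence)
    show "integrable lborel (\<lambda>x::complex. indicator (ball 0 R) x *\<^sub>R (R ^ (2 * n)))"
      by (rule integrable_disc_bounded[of _ _ "norm (R ^ (2 * n))"]) auto
    show "AE x in lborel. (\<lambda>k. indicator (ball 0 (r k)) x * (\<omega> x * cmod x ^ (2 * n))) \<longlonglongrightarrow> indicator (ball 0 R) x * (\<omega> x * cmod x ^ (2 * n))"
    proof (intro AE_I2 tendsto_eventually)
      fix x
      show "eventually (\<lambda>k. indicator (ball 0 (r k)) x * (\<omega> x * cmod x ^ (2 * n)) = indicator (ball 0 R) x * (\<omega> x * cmod x ^ (2 * n))) sequentially"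
        using ev[of x] by eventually_elim simp
    qed
    show "AE x in lborel. norm (indicator (ball 0 (r k)) x * (\<omega> x * cmod x ^ (2 * n))) \<le> indicator (ball 0 R) x *\<^sub>R (R ^ (2 * n))" for k
    proof (intro AE_I2)
      fix x :: complex
      have "\<bar>\<omega> x\<bar> * cmod x ^ (2 * n) \<le> 1 * R ^ (2 * n)" if "cmod x < R"
        using bd[OF that] that by (intro mult_mono power_mono) auto
      then show "norm (indicator (ball 0 (r k)) x * (\<omega> x * cmod x ^ (2 * n))) \<le> indicator (ball 0 R) x *\<^sub>R (R ^ (2 * n))"
        using r(2)[of k] by (auto simp: abs_mult split: split_indicator)
    qed
  qed measurable
  then have "(\<lambda>k. (deriv ^^ n) g 0 / fact n * of_real (LINT x|lborel. indicator (ball 0 (r k)) x * (\<omega> x * cmod x ^ (2 * n)))) \<longlonglongrightarrow>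
      (deriv ^^ n) g 0 / fact n * of_real (LINT x|lborel. indicator (ball 0 R) x * (\<omega> x * cmod x ^ (2 * n)))"
    by (intro tendsto_intros)
  moreover have "(LINT x|lborel. indicator (ball 0 (r k)) x *\<^sub>R h x) =
     (deriv ^^ n) g 0 / fact n * of_real (LINT x|lborel. indicator (ball 0 (r k)) x * (\<omega> x * cmod x ^ (2 * n)))" for k
    unfolding h_r by (rule disc_moment_compact[OF \<omega> _ rot g r]) (use bd r(2)[of k] in auto)
  ultimately show ?thesis unfolding h_def[symmetric]
    by (intro LIMSEQ_unique[of "\<lambda>k. LINT x|lborel. indicator (ball 0 (r k)) x *\<^sub>R h x"]) simp_all
qed

lemma disc_mean_value:
  assumes g: "g holomorphic_on ball 0 R" and R: "0 < R"
    and int: "integrable lborel (\<lambda>x. indicator (ball 0 R) x *\<^sub>R g x)"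
  shows "(LINT x|lborel. indicator (ball 0 R) x *\<^sub>R g x) = of_real (pi * R\<^sup>2) * g 0"
proof -
  have "measure lborel (ball (0::complex) R) = pi * R\<^sup>2"
    using content_ball[of R "0::complex"] R by (simp add: unit_ball_vol_2)
  then have "(LINT x|lborel. indicator (ball (0::complex) R) x * (1 * cmod x ^ (2 * 0))) = pi * R\<^sup>2" by simp
  then show ?thesis using disc_moment[of "\<lambda>_. 1" R g 0] assms by simp
qed

lemma thullen_moment:
  assumes \<alpha>: "\<alpha> > 0"
  shows "(LINT x|lborel. indicator (ball (0::complex) 1) x * ((1 - cmod x powr (2 / \<alpha>)) * cmod x ^ (2 * n))) =
     pi / ((real n + 1) * (\<alpha> * (real n + 1) + 1))"
proof -
  define \<gamma> where "\<gamma> = 1 / \<alpha>"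
  have \<gamma>: "0 < \<gamma>" using \<alpha> by (simp add: \<gamma>_def)
  define J where "J = 1 / (real n + 1) - 1 / (real n + \<gamma> + 1)"
  have J: "J = 1 / ((real n + 1) * (\<alpha> * (real n + 1) + 1))"
  proof -
    define k where "k = real n + 1"
    define d where "d = \<alpha> * k + 1"
    have k: "0 < k" "0 < d" using \<alpha> by (auto simp: k_def d_def add_pos_pos)
    have "real n + \<gamma> + 1 = d / \<alpha>" using \<alpha> by (simp add: \<gamma>_def d_def k_def field_simps)
    then have "J = 1 / k - \<alpha> / d" by (simp add: J_def k_def)
    also have "\<dots> = (d - \<alpha> * k) / (k * d)" using k by (simp add: diff_frac_eq)
    finally show ?thesis by (simp add: d_def k_def)
  qed
  have J0: "0 \<le> J" unfolding J using \<alpha> by simp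
  define g where "g = (\<lambda>t::real. ennreal ((1 - t powr \<gamma>) * t ^ n) * indicator {..<1} t)"
  have "((\<lambda>t. t powr real n - t powr (real n + \<gamma>)) has_integral
      (1 powr (real n + 1) / (real n + 1) - 1 powr (real n + \<gamma> + 1) / (real n + \<gamma> + 1))) {0..1}"
    using \<gamma> by (intro has_integral_diff has_integral_powr_from_0) auto
  then have "((\<lambda>t. t powr real n - t powr (real n + \<gamma>)) has_integral J) {0..1}" by (simp add: J_def)
  then have "(\<integral>\<^sup>+t. ennreal (indicator {0..1} t * (t powr real n - t powr (real n + \<gamma>))) \<partial>lborel) = ennreal J"
    using \<gamma> by (intro nn_integral_has_integral_lebesgue) (auto intro!: powr_mono')
  also have "(\<integral>\<^sup>+t. ennreal (indicator {0..1} t * (t powr real n - t powr (real n + \<gamma>))) \<partial>lborel) =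
     (\<integral>\<^sup>+t\<in>{0<..}. g t \<partial>lborel)"
    using AE_lborel_singleton[of "0::real"] AE_lborel_singleton[of "1::real"]
    by (intro nn_integral_cong_AE)
       (auto simp: g_def powr_add powr_realpow algebra_simps split: split_indicator)
  finally have 1: "(\<integral>\<^sup>+t\<in>{0<..}. g t \<partial>lborel) = ennreal J" .
  have sq: "c powr (2 / \<alpha>) = (c\<^sup>2) powr \<gamma>" if "0 \<le> c" for c :: real
    using that by (cases "c = 0") (auto simp: powr_powr \<gamma>_def simp flip: powr_numeral)
  have "(\<integral>\<^sup>+x. ennreal (indicator (ball (0::complex) 1) x * ((1 - cmod x powr (2 / \<alpha>)) * cmod x ^ (2 * n))) \<partial>lborel) =
     (\<integral>\<^sup>+(x::complex). g ((cmod x)\<^sup>2) \<partial>lborel)"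
    by (intro nn_integral_cong) (auto simp: g_def sq abs_square_less_1 power_mult split: split_indicator)
  also have "\<dots> = ennreal (pi * J)"
  proof -
    have "g \<in> borel_measurable borel" unfolding g_def by measurable
    from nn_integral_disc_radial[OF this] show ?thesis
      unfolding 1 using J0 by (simp add: ennreal_mult)
  qed
  finally have 2: "(\<integral>\<^sup>+x. ennreal (indicator (ball (0::complex) 1) x * ((1 - cmod x powr (2 / \<alpha>)) * cmod x ^ (2 * n))) \<partial>lborel) = ennreal (pi * J)" .
  have pos: "0 \<le> 1 - cmod x powr (2 / \<alpha>)" if "cmod x < 1" for x :: complex
    using powr_mono2[of "2 / \<alpha>" "cmod x" 1] that \<alpha> by simp
  have "(LINT x|lborel. indicator (ball (0::complex) 1) x * ((1 - cmod x powr (2 / \<alpha>)) * cmod x ^ (2 * n))) = enn2real (ennreal (pi * J))"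
    unfolding 2[symmetric] using pos by (intro integral_eq_nn_integral) (auto split: split_indicator)
  then show ?thesis using J0 by (simp add: J)
qed

text \<open>The power series whose coefficients are \<open>\<pi>\<close> times the reciprocals of the moments of the weight
\<open>1 - |x|^(2/\<alpha>)\<close>.\<close>

definition kernel_profile :: "real \<Rightarrow> complex \<Rightarrow> complex" where
  "kernel_profile \<alpha> s = ((1 - s) + of_real \<alpha> * (1 + s)) / (1 - s) ^ 3"

lemma kernel_profile_sums:
  assumes "cmod s < 1"
  shows "(\<lambda>n. of_real ((real n + 1) * (\<alpha> * (real n + 1) + 1)) * s ^ n) sums kernel_profile \<alpha> s"
proof -
  have s1: "1 - s \<noteq> 0" using assms by auto
  have 1: "(\<lambda>n. of_nat (Suc n) * s ^ n) sums (1 / (1 - s)\<^sup>2)" by (rule geometric_deriv_sums[OF assms])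
  have "(\<lambda>n. diffs (\<lambda>n. of_nat (Suc n)) n * s ^ n) sums (2 / (1 - s) ^ 3)"
  proof (rule termdiffs_sums_strong[of 1 "\<lambda>n. of_nat (Suc n)" "\<lambda>z. 1 / (1 - z)\<^sup>2"])
    fix z :: complex assume "norm z < 1"
    then show "(\<lambda>n. of_nat (Suc n) * z ^ n) sums (1 / (1 - z)\<^sup>2)" by (rule geometric_deriv_sums)
  next
    show "((\<lambda>z. 1 / (1 - z)\<^sup>2) has_field_derivative 2 / (1 - s) ^ 3) (at s)"
    proof -
      have *: "((\<lambda>z. 1 / (1 - z)\<^sup>2) has_field_derivative 2 * (1 - s) / ((1 - s)\<^sup>2)\<^sup>2) (at s)"
        using s1 by (auto intro!: derivative_eq_intros simp: power2_eq_square)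
      have "2 * d / (d\<^sup>2)\<^sup>2 = 2 / d ^ 3" if "d \<noteq> 0" for d :: complex
        using that by (simp add: field_simps power2_eq_square power3_eq_cube)
      from this[OF s1] have "2 * (1 - s) / ((1 - s)\<^sup>2)\<^sup>2 = 2 / (1 - s) ^ 3" .
      with * show ?thesis by (simp only:)
    qed
  qed (use assms in auto)
  then have 2: "(\<lambda>n. of_nat (Suc n) * of_nat (n + 2) * s ^ n) sums (2 / (1 - s) ^ 3)"
    by (simp add: diffs_def)
  have "(\<lambda>n. of_real \<alpha> * (of_nat (Suc n) * of_nat (n + 2) * s ^ n) + of_real (1 - \<alpha>) * (of_nat (Suc n) * s ^ n)) sums
      (of_real \<alpha> * (2 / (1 - s) ^ 3) + of_real (1 - \<alpha>) * (1 / (1 - s)\<^sup>2))"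
    by (intro sums_add sums_mult 1 2)
  also have "(\<lambda>n. of_real \<alpha> * (of_nat (Suc n) * of_nat (n + 2) * s ^ n) + of_real (1 - \<alpha>) * (of_nat (Suc n) * s ^ n)) =
     (\<lambda>n. of_real ((real n + 1) * (\<alpha> * (real n + 1) + 1)) * s ^ n)"
    by (auto simp: fun_eq_iff algebra_simps)
  also have "of_real \<alpha> * (2 / (1 - s) ^ 3) + of_real (1 - \<alpha>) * (1 / (1 - s)\<^sup>2) = kernel_profile \<alpha> s"
  proof -
    have "1 / (1 - s)\<^sup>2 = (1 - s) / (1 - s) ^ 3" using s1 by (simp add: power2_eq_square power3_eq_cube)
    then show ?thesis by (simp add: kernel_profile_def add_divide_distrib[symmetric] algebra_simps)
  qed
  finally show ?thesis .
qed

text \<open>Integrating the series of the kernel against \<open>g\<close>, each moment cancels its coefficient and the Taylor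
series of \<open>g\<close> remains.\<close>

lemma kernel_profile_reproducing:
  assumes \<alpha>: "\<alpha> > 0" and s: "cmod s < 1" and g: "g holomorphic_on ball 0 1"
    and int: "integrable lborel (\<lambda>x. indicator (ball 0 1) x *\<^sub>R (of_real (1 - cmod x powr (2 / \<alpha>)) * g x))"
  shows "(LINT x|lborel. indicator (ball 0 1) x *\<^sub>R (of_real (1 - cmod x powr (2 / \<alpha>)) * g x * cnj (kernel_profile \<alpha> (x * cnj s)))) = of_real pi * g s"
proof -
  define c where "c = (\<lambda>n. (real n + 1) * (\<alpha> * (real n + 1) + 1))"
  have c0: "0 < c n" for n using \<alpha> by (simp add: c_def add_pos_nonneg)
  define W where "W = (\<lambda>x. indicator (ball 0 1) x *\<^sub>R (of_real (1 - cmod x powr (2 / \<alpha>)) * g x))"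
  have W_int: "integrable lborel W" using int by (simp add: W_def)
  have [measurable]: "W \<in> borel_measurable borel" using borel_measurable_integrable[OF W_int] by simp
  define f where "f = (\<lambda>n x. W x * (of_real (c n) * s ^ n * cnj x ^ n))"
  have bd: "norm (f n x) \<le> norm (W x) * (c n * cmod s ^ n)" for n x
  proof (cases "cmod x < 1")
    case True
    have "cmod x ^ n \<le> 1" using True by (intro power_le_one) auto
    then have "norm (W x) * (c n * cmod s ^ n) * cmod x ^ n \<le> norm (W x) * (c n * cmod s ^ n) * 1"
      using c0[of n] by (intro mult_left_mono) auto
    then show ?thesis using c0[of n] by (simp add: f_def norm_mult norm_power mult_ac)
  qed (simp add: f_def W_def)
  have f_int: "integrable lborel (f n)" for n
  proof (rule Bochner_Integration.integrable_bound)
    show "integrable lborel (\<lambda>x. norm (W x) * (c n * cmod s ^ n))" using W_int by simp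
    show "f n \<in> borel_measurable lborel" unfolding f_def by measurable
    show "AE x in lborel. norm (f n x) \<le> norm (norm (W x) * (c n * cmod s ^ n))"
      using bd[of n] c0[of n] by (auto simp: abs_mult)
  qed
  have csum: "summable (\<lambda>n. c n * cmod s ^ n)"
  proof -
    have "summable (\<lambda>n. norm (of_real (c n) * s ^ n :: complex))"
    proof (rule powser_insidea)
      define s' where "s' = (1 + cmod s) / 2"
      have s': "s' < 1" "cmod s < s'" using s by (auto simp: s'_def)
      then have "cmod (of_real s') = s'" unfolding norm_of_real by (smt (verit) norm_ge_zero)
      with s' have "cmod (of_real s') < 1" "cmod s < cmod (of_real s')" by auto
      then show "summable (\<lambda>n. complex_of_real (c n) * of_real s' ^ n)" "cmod s < cmod (of_real s')"
        using kernel_profile_sums[of "of_real s'" \<alpha>] by (auto simp: c_def sums_iff)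
    qed
    then show ?thesis using c0 by (simp add: norm_mult norm_power less_imp_le)
  qed
  have sumf: "(\<lambda>n. f n x) sums (indicator (ball 0 1) x *\<^sub>R (of_real (1 - cmod x powr (2 / \<alpha>)) * g x * cnj (kernel_profile \<alpha> (x * cnj s))))" for x
  proof (cases "cmod x < 1")
    case True
    have "cmod (x * cnj s) < 1" using True s mult_left_le[of "cmod s" "cmod x"] by (simp add: norm_mult)
    from kernel_profile_sums[OF this, of \<alpha>] have "(\<lambda>n. of_real (c n) * (x * cnj s) ^ n) sums kernel_profile \<alpha> (x * cnj s)"
      by (simp add: c_def)
    then have "(\<lambda>n. cnj (of_real (c n) * (x * cnj s) ^ n)) sums cnj (kernel_profile \<alpha> (x * cnj s))"
      by (simp only: sums_cnj)
    then have "(\<lambda>n. W x * cnj (of_real (c n) * (x * cnj s) ^ n)) sums (W x * cnj (kernel_profile \<alpha> (x * cnj s)))"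
      by (rule sums_mult)
    then show ?thesis using True by (simp add: f_def W_def power_mult_distrib mult_ac)
  qed (simp add: f_def W_def)
  have "(\<lambda>n. integral\<^sup>L lborel (f n)) sums (\<integral>x. (\<Sum>n. f n x) \<partial>lborel)"
  proof (rule sums_integral[OF f_int])
    show "AE x in lborel. summable (\<lambda>n. norm (f n x))"
    proof (intro AE_I2)
      fix x show "summable (\<lambda>n. norm (f n x))"
        by (rule summable_comparison_test'[of "\<lambda>n. norm (W x) * (c n * cmod s ^ n)" 0])
           (use bd in \<open>auto intro!: summable_mult csum\<close>)
    qed
    show "summable (\<lambda>n. LINT x|lborel. norm (f n x))"
    proof (rule summable_comparison_test'[of "\<lambda>n. (LINT x|lborel. norm (W x)) * (c n * cmod s ^ n)" 0])
      show "summable (\<lambda>n. (LINT x|lborel. norm (W x)) * (c n * cmod s ^ n))" by (intro summable_mult csum)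
      fix n
      have "(LINT x|lborel. norm (f n x)) \<le> (LINT x|lborel. norm (W x) * (c n * cmod s ^ n))"
        using W_int f_int bd by (intro Bochner_Integration.integral_mono integrable_norm integrable_mult_left) auto
      then show "norm (LINT x|lborel. norm (f n x)) \<le> (LINT x|lborel. norm (W x)) * (c n * cmod s ^ n)" by simp
    qed
  qed
  also have "(\<integral>x. (\<Sum>n. f n x) \<partial>lborel) = (LINT x|lborel. indicator (ball 0 1) x *\<^sub>R (of_real (1 - cmod x powr (2 / \<alpha>)) * g x * cnj (kernel_profile \<alpha> (x * cnj s))))"
    using sumf by (intro Bochner_Integration.integral_cong refl) (simp add: sums_iff)
  finally have S: "(\<lambda>n. integral\<^sup>L lborel (f n)) sums \<dots>" .
  have "integral\<^sup>L lborel (f n) = of_real pi * ((deriv ^^ n) g 0 / fact n * s ^ n)" for n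
  proof -
    have "integral\<^sup>L lborel (f n) = of_real (c n) * s ^ n *
      (LINT x|lborel. indicator (ball 0 1) x *\<^sub>R (of_real (1 - cmod x powr (2 / \<alpha>)) * g x * cnj x ^ n))"
      unfolding f_def W_def by (subst integral_mult_right_zero[symmetric], intro Bochner_Integration.integral_cong) auto
    also have "(LINT x|lborel. indicator (ball 0 1) x *\<^sub>R (of_real (1 - cmod x powr (2 / \<alpha>)) * g x * cnj x ^ n)) =
        (deriv ^^ n) g 0 / fact n * of_real (LINT x|lborel. indicator (ball (0::complex) 1) x * ((1 - cmod x powr (2 / \<alpha>)) * cmod x ^ (2 * n)))"
    proof (rule disc_moment[OF _ _ _ g _ int])
      show "\<bar>1 - cmod x powr (2 / \<alpha>)\<bar> \<le> 1" if "cmod x < 1" for x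
        using powr_mono2[of "2 / \<alpha>" "cmod x" 1] that \<alpha> by (auto simp: abs_if)
    qed (auto simp: norm_mult)
    also have "(LINT x|lborel. indicator (ball (0::complex) 1) x * ((1 - cmod x powr (2 / \<alpha>)) * cmod x ^ (2 * n))) = pi / c n"
      unfolding c_def by (rule thullen_moment[OF \<alpha>])
    finally show ?thesis using c0[of n] by simp
  qed
  with S have "(\<lambda>n. of_real pi * ((deriv ^^ n) g 0 / fact n * s ^ n)) sums
    (LINT x|lborel. indicator (ball 0 1) x *\<^sub>R (of_real (1 - cmod x powr (2 / \<alpha>)) * g x * cnj (kernel_profile \<alpha> (x * cnj s))))" by simp
  moreover have "(\<lambda>n. of_real pi * ((deriv ^^ n) g 0 / fact n * s ^ n)) sums (of_real pi * g s)"
    using holomorphic_power_series[OF g, of s] s by (intro sums_mult) simp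
  ultimately show ?thesis by (rule sums_unique2)
qed

section \<open>The Bergman kernel of the Thullen domain\<close>

lemma emeasure_U_dom_finite: "\<alpha> > 0 \<Longrightarrow> emeasure lborel (U_dom \<alpha>) < \<infinity>"
proof -
  assume \<alpha>: "\<alpha> > 0"
  have "U_dom \<alpha> \<subseteq> ball 0 1 \<times> ball 0 1"
    using U_dom_fst_less_1[OF \<alpha>] U_dom_snd_less_1[OF \<alpha>] by fastforce
  moreover have "bounded (ball (0::complex) 1 \<times> ball (0::complex) 1)" by (intro bounded_Times) auto
  ultimately have "bounded (U_dom \<alpha>)" by (rule bounded_subset[rotated])
  then show ?thesis using emeasure_bounded_finite by auto
qed

text \<open>At a point \<open>(t, 0)\<close> the kernel depends on the first coordinate only. The mean value property on the
fibres replaces \<open>h\<close> by its values on the axis and produces the fibre area \<open>\<pi> (1 - |x|^(2/\<alpha>))\<close> as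
weight.\<close>

lemma thullen_reproducing_axis:
  fixes h :: "complex \<times> complex \<Rightarrow> complex"
  assumes \<alpha>: "\<alpha> > 0" and t: "cmod t < 1"
    and h2: "\<And>x. cmod x < 1 \<Longrightarrow> (\<lambda>y. h (x, y)) holomorphic_on ball 0 (sqrt (1 - cmod x powr (2 / \<alpha>)))"
    and h1: "(\<lambda>x. h (x, 0)) holomorphic_on ball 0 1"
    and int: "integrable lborel (\<lambda>p. indicator (U_dom \<alpha>) p *\<^sub>R h p)"
  shows "(LINT p|lborel. indicator (U_dom \<alpha>) p *\<^sub>R (h p * cnj (kernel_profile \<alpha> (fst p * cnj t)))) = of_real (pi\<^sup>2) * h (t, 0)"
proof -
  define \<omega> where "\<omega> = (\<lambda>x::complex. 1 - cmod x powr (2 / \<alpha>))"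
  have \<omega>_pos: "0 < \<omega> x" if "cmod x < 1" for x
    using powr_less_iff_less_powr[of "cmod x" 1 "\<alpha> / 2"] that \<alpha> by (auto simp: \<omega>_def)
  define k where "k = (\<lambda>x. cnj (kernel_profile \<alpha> (x * cnj t)))"
  have k_meas[measurable]: "k \<in> borel_measurable borel" unfolding k_def kernel_profile_def by measurable
  define H where "H = (\<lambda>p. indicator (U_dom \<alpha>) p *\<^sub>R h p)"
  have H_meas[measurable]: "H \<in> borel_measurable borel"
    using borel_measurable_integrable[OF int] by (simp add: H_def)
  have H_int: "integrable (lborel \<Otimes>\<^sub>M lborel) H" using int by (simp add: H_def lborel_prod)
  have ind: "indicator (U_dom \<alpha>) (x, y) = (indicator (ball 0 1) x * indicator (ball 0 (sqrt (\<omega> x))) y :: real)" for x y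
    using U_dom_iff_fst[OF \<alpha>, of "(x, y)"] by (auto simp: indicator_def \<omega>_def)
  have inner: "AE x in lborel. (LINT y|lborel. H (x, y)) = indicator (ball 0 1) x *\<^sub>R (of_real pi * (of_real (\<omega> x) * h (x, 0)))"
    using lborel_pair.AE_integrable_fst'[OF H_int]
  proof eventually_elim
    case (elim x)
    show ?case
    proof (cases "cmod x < 1")
      case True
      have eq: "H (x, y) = indicator (ball 0 (sqrt (\<omega> x))) y *\<^sub>R h (x, y)" for y
        using True by (simp add: H_def ind)
      show ?thesis
        using disc_mean_value[OF h2[OF True]] \<omega>_pos[OF True] elim True
        unfolding eq by (simp add: \<omega>_def)
    qed (simp add: H_def ind)
  qed
  define W where "W = (\<lambda>x. indicator (ball 0 1) x *\<^sub>R (of_real (\<omega> x) * h (x, 0)))"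
  have \<omega>_meas: "\<omega> \<in> borel_measurable borel" unfolding \<omega>_def by measurable
  have W_meas[measurable]: "W \<in> borel_measurable borel"
  proof -
    have "(\<lambda>x. indicator (ball 0 1) x *\<^sub>R h (x, 0)) \<in> borel_measurable borel"
      using h1 by (intro borel_measurable_continuous_on_indicator holomorphic_on_imp_continuous_on) auto
    with \<omega>_meas have "(\<lambda>x. of_real (\<omega> x) * (indicator (ball 0 1) x *\<^sub>R h (x, 0))) \<in> borel_measurable borel"
      by measurable
    moreover have "W = (\<lambda>x. of_real (\<omega> x) * (indicator (ball 0 1) x *\<^sub>R h (x, 0)))"
      by (auto simp: W_def)
    ultimately show ?thesis by (simp only:)
  qed
  have pW_int: "integrable lborel (\<lambda>x. of_real pi * W x)"
  proof (rule integrable_cong_AE_imp[OF lborel_pair.integrable_fst'[OF H_int]])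
    show "AE x in lborel. (LINT y|lborel. H (x, y)) = of_real pi * W x"
      using inner by eventually_elim (auto simp: W_def)
  qed simp
  have W_int: "integrable lborel W"
    using integrable_mult_right[OF pW_int, of "1 / of_real pi"] by simp
  have Hk_int: "integrable (lborel \<Otimes>\<^sub>M lborel) (\<lambda>p. H p * k (fst p))"
  proof -
    define B where "B = (2 + 2 * \<bar>\<alpha>\<bar>) / (1 - cmod t) ^ 3"
    have kB: "cmod (k x) \<le> B" if "cmod x < 1" for x
    proof -
      have xt: "cmod (x * cnj t) \<le> cmod t" using that by (simp add: norm_mult mult_left_le_one_le)
      then have lo: "1 - cmod t \<le> cmod (1 - x * cnj t)"
        using norm_triangle_ineq2[of 1 "x * cnj t"] by simp
      have "cmod (1 - x * cnj t) \<le> 2" "cmod (1 + x * cnj t) \<le> 2"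
        using norm_triangle_ineq4[of 1 "x * cnj t"] norm_triangle_ineq[of 1 "x * cnj t"] xt t by auto
      then have "cmod ((1 - x * cnj t) + of_real \<alpha> * (1 + x * cnj t)) \<le> 2 + \<bar>\<alpha>\<bar> * 2"
        by (intro order_trans[OF norm_triangle_ineq] add_mono) (auto simp: norm_mult intro!: mult_left_mono)
      then show ?thesis unfolding k_def kernel_profile_def B_def complex_mod_cnj norm_divide norm_power
        using lo t by (intro frac_le power_mono) auto
    qed
    show ?thesis
    proof (rule Bochner_Integration.integrable_bound)
      show "integrable (lborel \<Otimes>\<^sub>M lborel) (\<lambda>p. B * norm (H p))" using H_int by simp
      show "(\<lambda>p. H p * k (fst p)) \<in> borel_measurable (lborel \<Otimes>\<^sub>M lborel)" unfolding lborel_prod by measurable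
      have "norm (H p * k (fst p)) \<le> norm (B * norm (H p))" for p
      proof (cases "p \<in> U_dom \<alpha>")
        case True
        then have "cmod (k (fst p)) \<le> B" using kB U_dom_fst_less_1[OF \<alpha>] by blast
        then have "norm (H p) * norm (k (fst p)) \<le> norm (H p) * \<bar>B\<bar>" by (intro mult_left_mono) auto
        then show ?thesis by (simp add: norm_mult abs_mult mult.commute)
      qed (simp add: H_def)
      then show "AE p in lborel \<Otimes>\<^sub>M lborel. norm (H p * k (fst p)) \<le> norm (B * norm (H p))" by simp
    qed
  qed
  have "(LINT p|lborel. indicator (U_dom \<alpha>) p *\<^sub>R (h p * cnj (kernel_profile \<alpha> (fst p * cnj t)))) = (LINT p|lborel. H p * k (fst p))"
    by (simp add: H_def k_def)
  also have "\<dots> = (LINT x|lborel. LINT y|lborel. H (x, y) * k x)"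
    using lborel_pair.integral_fst'[OF Hk_int] by (simp add: lborel_prod)
  also have "\<dots> = (LINT x|lborel. of_real pi * (indicator (ball 0 1) x *\<^sub>R (of_real (1 - cmod x powr (2 / \<alpha>)) * h (x, 0) * cnj (kernel_profile \<alpha> (x * cnj t)))))"
  proof (rule integral_cong_AE)
    show "AE x in lborel. (LINT y|lborel. H (x, y) * k x) = of_real pi * (indicator (ball 0 1) x *\<^sub>R (of_real (1 - cmod x powr (2 / \<alpha>)) * h (x, 0) * cnj (kernel_profile \<alpha> (x * cnj t))))"
      using inner by eventually_elim (simp add: k_def \<omega>_def)
    show "(\<lambda>x. LINT y|lborel. H (x, y) * k x) \<in> borel_measurable lborel"
      using borel_measurable_integrable[OF lborel_pair.integrable_fst'[OF Hk_int]] by simp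
    have "(\<lambda>x. of_real pi * (indicator (ball 0 1) x *\<^sub>R (of_real (1 - cmod x powr (2 / \<alpha>)) * h (x, 0) * cnj (kernel_profile \<alpha> (x * cnj t))))) =
      (\<lambda>x. of_real pi * W x * k x)" by (simp add: W_def k_def \<omega>_def fun_eq_iff)
    then show "(\<lambda>x. of_real pi * (indicator (ball 0 1) x *\<^sub>R (of_real (1 - cmod x powr (2 / \<alpha>)) * h (x, 0) * cnj (kernel_profile \<alpha> (x * cnj t))))) \<in> borel_measurable lborel"
      by simp
  qed
  also have "\<dots> = of_real pi * (of_real pi * h (t, 0))"
    using kernel_profile_reproducing[OF \<alpha> t h1 W_int[unfolded W_def \<omega>_def]] by (simp only: integral_mult_right_zero)
  finally show ?thesis by (simp add: power2_eq_square)
qed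

definition thullen_kernel :: "real \<Rightarrow> complex \<times> complex \<Rightarrow> complex \<times> complex \<Rightarrow> complex" where
  "thullen_kernel \<alpha> z w =
     kernel_profile \<alpha> (kernel_ratio \<alpha> z w) / (of_real (pi\<^sup>2) * (1 - snd z * cnj (snd w)) powr of_real (2 + \<alpha>))"

lemma cnj_kernel_ratio:
  assumes "cmod (snd z) < 1" "cmod (snd w) < 1"
  shows "cnj (kernel_ratio \<alpha> z w) = kernel_ratio \<alpha> w z"
proof -
  have "Re (1 - snd z * cnj (snd w)) > 0"
    using Re_one_minus_cnj_mult_pos[OF assms] by simp
  then have "cnj ((1 - snd z * cnj (snd w)) powr of_real \<alpha>) = (1 - cnj (snd z) * snd w) powr of_real \<alpha>"
    by (subst cnj_powr) auto
  then show ?thesis by (simp add: kernel_ratio_def mult.commute)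
qed

lemma cnj_thullen_kernel:
  assumes "cmod (snd z) < 1" "cmod (snd w) < 1"
  shows "cnj (thullen_kernel \<alpha> z w) = thullen_kernel \<alpha> w z"
proof -
  have "Re (1 - snd z * cnj (snd w)) > 0"
    using Re_one_minus_cnj_mult_pos[OF assms] by simp
  then have "cnj ((1 - snd z * cnj (snd w)) powr of_real (2 + \<alpha>)) = (1 - snd w * cnj (snd z)) powr of_real (2 + \<alpha>)"
    by (subst cnj_powr) (auto simp: mult.commute)
  then show ?thesis using cnj_kernel_ratio[OF assms, of \<alpha>]
    by (simp add: thullen_kernel_def kernel_profile_def)
qed

lemma measurable_thullen_kernel [measurable (raw)]:
  assumes [measurable]: "f \<in> borel_measurable M" "g \<in> borel_measurable M"
  shows "(\<lambda>x. thullen_kernel \<alpha> (f x) (g x)) \<in> borel_measurable M"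
proof -
  have [measurable]: "(\<lambda>x. snd (f x)) \<in> borel_measurable M" "(\<lambda>x. snd (g x)) \<in> borel_measurable M"
    using assms measurable_compose[OF _ measurable_snd_borel] by auto
  show ?thesis unfolding thullen_kernel_def kernel_profile_def by measurable
qed

lemma norm_kernel_ratio_less:
  assumes \<alpha>: "\<alpha> > 0" and z: "z \<in> U_dom \<alpha>" and w: "w \<in> U_dom \<alpha>"
  shows "cmod (kernel_ratio \<alpha> z w) \<le> cmod (f_fun \<alpha> w)" "cmod (kernel_ratio \<alpha> z w) < 1"
proof -
  have z2: "cmod (snd z) < 1" and w2: "cmod (snd w) < 1"
    using U_dom_snd_less_1[OF \<alpha>] z w by auto
  have m: "(1 - (cmod (moebius (snd z) (snd w)))\<^sup>2) powr (\<alpha> / 2) \<le> 1"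
    using powr_mono2[of "\<alpha> / 2" "1 - (cmod (moebius (snd z) (snd w)))\<^sup>2" 1] one_minus_norm_sq_pos[OF moebius_in_disc[OF z2 w2]] \<alpha> by simp
  have "cmod (f_fun \<alpha> z) * cmod (f_fun \<alpha> w) * (1 - (cmod (moebius (snd z) (snd w)))\<^sup>2) powr (\<alpha> / 2) \<le> 1 * cmod (f_fun \<alpha> w) * 1"
    using norm_f_fun_less_1[OF \<alpha> z] m by (intro mult_mono) auto
  then show "cmod (kernel_ratio \<alpha> z w) \<le> cmod (f_fun \<alpha> w)"
    by (simp add: norm_kernel_ratio[OF \<alpha> z w2])
  then show "cmod (kernel_ratio \<alpha> z w) < 1" using norm_f_fun_less_1[OF \<alpha> w] by simp
qed

lemma norm_thullen_kernel_le:
  assumes \<alpha>: "\<alpha> > 0" and z: "z \<in> U_dom \<alpha>" and w: "w \<in> U_dom \<alpha>"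
  shows "cmod (thullen_kernel \<alpha> z w) \<le> (2 + 2 * \<alpha>) / pi\<^sup>2 * kernel_size \<alpha> z w"
proof -
  have z2: "cmod (snd z) < 1" and w2: "cmod (snd w) < 1"
    using U_dom_snd_less_1[OF \<alpha>] z w by auto
  define T where "T = kernel_ratio \<alpha> z w"
  have T: "cmod T < 1" using norm_kernel_ratio_less(2)[OF \<alpha> z w] by (simp add: T_def)
  define x where "x = cmod (1 - snd z * cnj (snd w))"
  have x: "0 < x" using one_minus_cnj_mult_nonzero[OF z2 w2] unfolding x_def norm_one_minus_mult_cnj by simp
  define s where "s = cmod (1 - T)"
  have s: "0 < s" using T by (auto simp: s_def)
  have "cmod (1 - T) \<le> 2" "cmod (1 + T) \<le> 2"
    using norm_triangle_ineq4[of 1 T] norm_triangle_ineq[of 1 T] T by auto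
  then have "cmod ((1 - T) + of_real \<alpha> * (1 + T)) \<le> 2 + \<alpha> * 2"
    using \<alpha> by (intro order_trans[OF norm_triangle_ineq] add_mono) (auto simp: norm_mult intro!: mult_left_mono)
  then have "cmod (kernel_profile \<alpha> T) \<le> (2 + \<alpha> * 2) / s ^ 3"
    unfolding kernel_profile_def norm_divide norm_power s_def[symmetric] using s by (intro divide_right_mono) auto
  moreover have "cmod (thullen_kernel \<alpha> z w) = cmod (kernel_profile \<alpha> T) / (pi\<^sup>2 * x powr (2 + \<alpha>))"
    by (simp add: thullen_kernel_def T_def norm_divide norm_mult norm_power norm_powr_real_powr' x_def
        del: of_real_add)
  moreover have "kernel_size \<alpha> z w = 1 / x powr (2 + \<alpha>) * (1 / s ^ 3)"
    unfolding kernel_size_def x_def[symmetric] T_def[symmetric] s_def[symmetric] powr_minus_divide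
    using s by simp
  ultimately show ?thesis
    using x divide_right_mono[of "cmod (kernel_profile \<alpha> T)" "(2 + \<alpha> * 2) / s ^ 3" "pi\<^sup>2 * x powr (2 + \<alpha>)"]
    by (simp add: mult_ac)
qed

text \<open>Because \<open>varphi\<close> is an involution, \<open>\<Phi>\<close> is the composition of \<open>\<Phi> \<circ> varphi\<close> with
\<open>varphi\<close>, to which the substitution rule applies.\<close>

lemma integral_U_dom_varphi:
  fixes \<Phi> :: "complex \<times> complex \<Rightarrow> complex"
  assumes \<alpha>: "\<alpha> > 0" and b: "cmod b < 1" and [measurable]: "(\<lambda>x. indicator (U_dom \<alpha>) x *\<^sub>R \<Phi> x) \<in> borel_measurable borel"
  defines "Q \<equiv> (\<lambda>x. ((1 - (cmod b)\<^sup>2) / (cmod (1 - cnj b * snd x))\<^sup>2) powr (2 + \<alpha>))"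
  shows "(LINT x|lborel. indicator (U_dom \<alpha>) x *\<^sub>R \<Phi> x) = (LINT x|lborel. indicator (U_dom \<alpha>) x *\<^sub>R (Q x *\<^sub>R \<Phi> (varphi_map \<alpha> b x)))"
    and "(\<integral>\<^sup>+x\<in>U_dom \<alpha>. ennreal (norm (\<Phi> x)) \<partial>lborel) =
      (\<integral>\<^sup>+x\<in>U_dom \<alpha>. ennreal (Q x * norm (\<Phi> (varphi_map \<alpha> b x))) \<partial>lborel)"
proof -
  let ?U = "U_dom \<alpha>"
  have Q[measurable]: "Q \<in> borel_measurable borel" unfolding Q_def by measurable
  have Q0: "0 \<le> Q x" for x by (simp add: Q_def)
  define G where "G = (\<lambda>x. indicator ?U (varphi_map \<alpha> b x) *\<^sub>R \<Phi> (varphi_map \<alpha> b x))"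
  have G[measurable]: "G \<in> borel_measurable borel"
    unfolding G_def using measurable_compose[OF measurable_varphi_map assms(3)] .
  have GU: "G (varphi_map \<alpha> b x) = \<Phi> x" "G x = \<Phi> (varphi_map \<alpha> b x)" if "x \<in> ?U" for x
    using that by (auto simp: G_def varphi_map_varphi_map[OF \<alpha> b] varphi_map_in_U_dom[OF \<alpha> b])
  define M where "M = density lborel (indicator ?U :: _ \<Rightarrow> ennreal)"
  define M' where "M' = density lborel (\<lambda>x. ennreal (Q x * indicator ?U x))"
  have eq: "distr M borel (varphi_map \<alpha> b) = M'"
  proof (rule measure_eqI)
    fix A assume "A \<in> sets (distr M borel (varphi_map \<alpha> b))"
    then have A[measurable]: "A \<in> sets borel" by simp
    have "emeasure (distr M borel (varphi_map \<alpha> b)) A = (\<integral>\<^sup>+x. indicator A x \<partial>distr M borel (varphi_map \<alpha> b))"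
      by simp
    also have "\<dots> = (\<integral>\<^sup>+x\<in>?U. indicator A (varphi_map \<alpha> b x) \<partial>lborel)"
      unfolding M_def by (subst nn_integral_distr) (auto simp: nn_integral_density mult.commute)
    also have "\<dots> = (\<integral>\<^sup>+x\<in>?U. indicator A x * ennreal (Q x) \<partial>lborel)"
      unfolding Q_def by (rule nn_integral_varphi_map[OF \<alpha> b]) measurable
    also have "\<dots> = emeasure M' A"
      unfolding M'_def by (subst emeasure_density) (auto intro!: nn_integral_cong split: split_indicator)
    finally show "emeasure (distr M borel (varphi_map \<alpha> b)) A = emeasure M' A" .
  qed (simp add: M'_def)
  have "(LINT x|lborel. indicator ?U x *\<^sub>R \<Phi> x) = (LINT x|lborel. indicator ?U x *\<^sub>R G (varphi_map \<alpha> b x))"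
    by (intro Bochner_Integration.integral_cong) (auto simp: GU split: split_indicator)
  also have "\<dots> = (LINT x|density lborel (\<lambda>x. ennreal (indicator ?U x)). G (varphi_map \<alpha> b x))"
    by (subst integral_density) auto
  also have "\<dots> = (LINT x|M'. G x)"
    unfolding eq[symmetric] by (subst integral_distr) (auto simp: M_def ennreal_indicator)
  also have "\<dots> = (LINT x|lborel. (Q x * indicator ?U x) *\<^sub>R G x)"
    unfolding M'_def using Q0 by (subst integral_density) auto
  also have "\<dots> = (LINT x|lborel. indicator ?U x *\<^sub>R (Q x *\<^sub>R \<Phi> (varphi_map \<alpha> b x)))"
    by (intro Bochner_Integration.integral_cong) (auto simp: GU split: split_indicator)
  finally show "(LINT x|lborel. indicator ?U x *\<^sub>R \<Phi> x) = (LINT x|lborel. indicator ?U x *\<^sub>R (Q x *\<^sub>R \<Phi> (varphi_map \<alpha> b x)))" .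
  have "(\<integral>\<^sup>+x\<in>?U. ennreal (norm (\<Phi> x)) \<partial>lborel) =
      (\<integral>\<^sup>+x\<in>?U. ennreal (norm (G (varphi_map \<alpha> b x))) \<partial>lborel)"
    by (intro nn_integral_cong) (auto simp: GU split: split_indicator)
  also have "\<dots> = (\<integral>\<^sup>+x\<in>?U. ennreal (norm (G x)) * ennreal (Q x) \<partial>lborel)"
    unfolding Q_def by (rule nn_integral_varphi_map[OF \<alpha> b, of "\<lambda>x. ennreal (norm (G x))"]) measurable
  also have "\<dots> = (\<integral>\<^sup>+x\<in>?U. ennreal (Q x * norm (\<Phi> (varphi_map \<alpha> b x))) \<partial>lborel)"
    using Q0 by (intro nn_integral_cong) (auto simp: GU ennreal_mult mult.commute split: split_indicator)
  finally show "(\<integral>\<^sup>+x\<in>?U. ennreal (norm (\<Phi> x)) \<partial>lborel) =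
      (\<integral>\<^sup>+x\<in>?U. ennreal (Q x * norm (\<Phi> (varphi_map \<alpha> b x))) \<partial>lborel)" .
qed


text \<open>Holomorphy at a single point, so that the rules for products and compositions can be stated pointwise.\<close>

definition holo2_at :: "(complex \<times> complex \<Rightarrow> complex) \<Rightarrow> complex \<times> complex \<Rightarrow> bool" where
  "holo2_at f z \<longleftrightarrow> (\<exists>A B. (f has_derivative (\<lambda>h. A * fst h + B * snd h)) (at z))"

lemma holo2_at_fst: "holo2_at fst z"
  unfolding holo2_at_def
  by (rule exI[of _ 1], rule exI[of _ 0]) (auto intro!: derivative_eq_intros)

lemma holo2_at_snd: "holo2_at snd z"
  unfolding holo2_at_def
  by (rule exI[of _ 0], rule exI[of _ 1]) (auto intro!: derivative_eq_intros)

lemma holo2_at_mult: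
  assumes "holo2_at f z" "holo2_at g z" shows "holo2_at (\<lambda>x. f x * g x) z"
proof -
  obtain A B C D where "(f has_derivative (\<lambda>h. A * fst h + B * snd h)) (at z)"
      "(g has_derivative (\<lambda>h. C * fst h + D * snd h)) (at z)"
    using assms by (auto simp: holo2_at_def)
  from has_derivative_mult[OF this]
  have "((\<lambda>x. f x * g x) has_derivative (\<lambda>h. (f z * C + A * g z) * fst h + (f z * D + B * g z) * snd h)) (at z)"
    by (rule has_derivative_eq_rhs) (auto simp: algebra_simps)
  then show ?thesis unfolding holo2_at_def by blast
qed

lemma holo2_at_compose:
  assumes "holo2_at f z" "g field_differentiable at (f z)" shows "holo2_at (\<lambda>x. g (f x)) z"
proof -
  obtain A B where f: "(f has_derivative (\<lambda>h. A * fst h + B * snd h)) (at z)"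
    using assms by (auto simp: holo2_at_def)
  obtain d where "(g has_derivative (*) d) (at (f z))"
    using assms(2) by (auto simp: field_differentiable_def has_field_derivative_def)
  from has_derivative_compose[OF f this]
  have "((\<lambda>x. g (f x)) has_derivative (\<lambda>h. (d * A) * fst h + (d * B) * snd h)) (at z)"
    by (rule has_derivative_eq_rhs) (auto simp: algebra_simps)
  then show ?thesis unfolding holo2_at_def by blast
qed

lemma holo2_at_curve:
  assumes "holo2_at f (g1 s, g2 s)" "g1 field_differentiable at s" "g2 field_differentiable at s"
  shows "(\<lambda>s. f (g1 s, g2 s)) field_differentiable at s"
proof -
  obtain A B where f: "(f has_derivative (\<lambda>h. A * fst h + B * snd h)) (at (g1 s, g2 s))"
    using assms by (auto simp: holo2_at_def)
  obtain d1 d2 where "(g1 has_derivative (*) d1) (at s)" "(g2 has_derivative (*) d2) (at s)"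
    using assms by (auto simp: field_differentiable_def has_field_derivative_def)
  from has_derivative_compose[OF has_derivative_Pair[OF this] f]
  have "((\<lambda>s. f (g1 s, g2 s)) has_derivative (*) (A * d1 + B * d2)) (at s)"
    by (rule has_derivative_eq_rhs) (auto simp: algebra_simps)
  then show ?thesis by (auto simp: field_differentiable_def has_field_derivative_def)
qed

lemma holomorphic2_on_iff: "holomorphic2_on f U \<longleftrightarrow> (\<forall>z\<in>U. holo2_at f z)"
  by (simp add: holomorphic2_on_def holo2_at_def)

lemma holomorphic2_on_indicator_measurable:
  assumes "\<alpha> > 0" "holomorphic2_on f (U_dom \<alpha>)"
  shows "(\<lambda>x. indicator (U_dom \<alpha>) x *\<^sub>R f x) \<in> borel_measurable borel"
proof (rule borel_measurable_continuous_on_indicator)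
  show "continuous_on (U_dom \<alpha>) f"
    using assms(2) unfolding holomorphic2_on_def
    by (intro continuous_at_imp_continuous_on ballI) (blast intro: has_derivative_continuous)
qed simp

text \<open>The substitution by \<open>varphi\<close> at \<open>w2\<close> takes \<open>w\<close> to \<open>(t, 0)\<close>. The Jacobian is
the squared modulus of a holomorphic function; its antiholomorphic half cancels against the conjugated kernel, and the
other half is absorbed into \<open>f\<close>, which leaves the formula on the axis for a holomorphic function.\<close>

lemma thullen_kernel_reproducing:
  assumes \<alpha>: "\<alpha> > 0" and f: "holomorphic2_on f (U_dom \<alpha>)" and w: "w \<in> U_dom \<alpha>"
    and int: "integrable lborel (\<lambda>x. indicator (U_dom \<alpha>) x *\<^sub>R f x)"
  shows "(LINT x|lborel. indicator (U_dom \<alpha>) x *\<^sub>R (f x * cnj (thullen_kernel \<alpha> x w))) = f w"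
proof -
  let ?U = "U_dom \<alpha>"
  define b where "b = snd w"
  define t where "t = f_fun \<alpha> w"
  define \<psi> where "\<psi> = varphi_map \<alpha> b"
  define A where "A = 1 - (cmod b)\<^sup>2"
  define \<zeta> where "\<zeta> = (\<lambda>y. 1 - cnj b * y)"
  define Z where "Z = (\<lambda>y. \<zeta> y powr of_real (2 + \<alpha>))"
  \<comment> \<open>The Jacobian of \<open>\<psi>\<close> is a constant times \<open>1 / (Z * cnj Z)\<close>.\<close>
  define h where "h = (\<lambda>x. f (\<psi> x) / Z (snd x))"
  have b: "cmod b < 1" using U_dom_snd_less_1[OF \<alpha> w] by (simp add: b_def)
  have t: "cmod t < 1" using norm_f_fun_less_1[OF \<alpha> w] by (simp add: t_def)
  have A: "0 < A" using one_minus_norm_sq_pos[OF b] by (simp add: A_def)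
  have \<psi>U: "\<psi> x \<in> ?U" "\<psi> (\<psi> x) = x" if "x \<in> ?U" for x
    using that varphi_map_in_U_dom[OF \<alpha> b] varphi_map_varphi_map[OF \<alpha> b] by (auto simp: \<psi>_def)
  have Re\<zeta>: "0 < Re (\<zeta> y)" if "cmod y < 1" for y
    using Re_one_minus_cnj_mult_pos[OF b that] by (simp add: \<zeta>_def)
  have Z0: "Z y \<noteq> 0" if "cmod y < 1" for y using Re\<zeta>[OF that] by (auto simp: Z_def)
  have nZ: "cmod (Z y) = cmod (\<zeta> y) powr (2 + \<alpha>)" for y
    by (simp add: Z_def norm_powr_real_powr' del: of_real_add)
  define Q where "Q = (\<lambda>x::complex\<times>complex. ((1 - (cmod b)\<^sup>2) / (cmod (1 - cnj b * snd x))\<^sup>2) powr (2 + \<alpha>))"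
  have Q: "Q x = A powr (2 + \<alpha>) / (cmod (Z (snd x)))\<^sup>2" for x
  proof -
    have "((cmod (\<zeta> (snd x)))\<^sup>2) powr (2 + \<alpha>) = (cmod (\<zeta> (snd x)) powr (2 + \<alpha>))\<^sup>2"
      by (simp add: power2_eq_square powr_mult)
    then show ?thesis unfolding Q_def nZ
      using A by (simp add: A_def[symmetric] \<zeta>_def powr_divide)
  qed
  have \<psi>_snd: "snd (\<psi> x) = moebius b (snd x)" for x by (simp add: \<psi>_def varphi_map_def moebius_def)
  have kern: "thullen_kernel \<alpha> (\<psi> x) w = kernel_profile \<alpha> (fst x * cnj t) * Z (snd x) / of_real (pi\<^sup>2 * A powr (2 + \<alpha>))"
    if x: "x \<in> ?U" for x
  proof -
    have x2: "cmod (snd x) < 1" using U_dom_snd_less_1[OF \<alpha> x] .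
    have "kernel_ratio \<alpha> (\<psi> x) w = cnj (kernel_ratio \<alpha> w (\<psi> x))"
      using cnj_kernel_ratio[of w "\<psi> x" \<alpha>] b moebius_in_disc[OF b x2] by (simp add: b_def \<psi>_snd)
    also have "\<dots> = cnj t * fst (\<psi> (\<psi> x))"
      using cnj_f_fun_varphi[OF \<alpha> w \<psi>U(1)[OF x]] by (simp add: \<psi>_def b_def t_def)
    finally have T: "kernel_ratio \<alpha> (\<psi> x) w = fst x * cnj t" using \<psi>U(2)[OF x] by (simp add: mult.commute)
    have "1 - snd (\<psi> x) * cnj (snd w) = of_real A / \<zeta> (snd x)"
      using one_minus_cnj_mult_moebius[OF b x2] unfolding \<psi>_snd b_def[symmetric] A_def \<zeta>_def by (simp add: mult.commute)
    then have "(1 - snd (\<psi> x) * cnj (snd w)) powr of_real (2 + \<alpha>) = of_real (A powr (2 + \<alpha>)) / Z (snd x)"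
      unfolding Z_def by (simp only: of_real_divide_powr[OF A Re\<zeta>[OF x2]])
    then show ?thesis unfolding thullen_kernel_def T using Z0[OF x2] A by simp
  qed
  define \<Phi> where "\<Phi> = (\<lambda>x. f x * cnj (thullen_kernel \<alpha> x w))"
  note f_meas[measurable] = holomorphic2_on_indicator_measurable[OF \<alpha> f]
  have \<Phi>_meas: "(\<lambda>x. indicator ?U x *\<^sub>R \<Phi> x) \<in> borel_measurable borel"
  proof -
    have "(\<lambda>x. (indicator ?U x *\<^sub>R f x) * cnj (thullen_kernel \<alpha> x w)) \<in> borel_measurable borel"
      by measurable
    then show ?thesis by (simp add: \<Phi>_def)
  qed
  have pull: "Q x *\<^sub>R \<Phi> (\<psi> x) = (1 / of_real (pi\<^sup>2)) * (h x * cnj (kernel_profile \<alpha> (fst x * cnj t)))" if x: "x \<in> ?U" for x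
  proof -
    have x2: "cmod (snd x) < 1" using U_dom_snd_less_1[OF \<alpha> x] .
    have "complex_of_real (Q x) = of_real (A powr (2 + \<alpha>)) / (Z (snd x) * cnj (Z (snd x)))"
      unfolding Q by (simp add: complex_norm_square[symmetric])
    then show ?thesis using Z0[OF x2] A
      by (simp add: \<Phi>_def kern[OF x] h_def scaleR_conv_of_real divide_simps mult.commute[of "Z (snd x)" "cnj (Z (snd x))"])
  qed
  have h_int: "integrable lborel (\<lambda>x. indicator ?U x *\<^sub>R h x)"
  proof -
    define B where "B = 2 powr (2 + \<alpha>) / A powr (2 + \<alpha>)"
    have B: "0 \<le> B" by (simp add: B_def)
    have h_meas: "(\<lambda>x. indicator ?U x *\<^sub>R h x) \<in> borel_measurable borel"
    proof -
      have [measurable]: "\<psi> \<in> borel_measurable borel" unfolding \<psi>_def by measurable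
      have [measurable]: "(\<lambda>x. Z (snd x)) \<in> borel_measurable (borel :: (complex \<times> complex) measure)"
        unfolding Z_def \<zeta>_def by measurable
      have "(\<lambda>x. indicator ?U (\<psi> x) *\<^sub>R f (\<psi> x)) \<in> borel_measurable borel"
        by (rule measurable_compose[OF _ f_meas]) measurable
      then have "(\<lambda>x. indicator ?U x *\<^sub>R ((indicator ?U (\<psi> x) *\<^sub>R f (\<psi> x)) / Z (snd x))) \<in> borel_measurable borel"
        by measurable
      also have "(\<lambda>x. indicator ?U x *\<^sub>R ((indicator ?U (\<psi> x) *\<^sub>R f (\<psi> x)) / Z (snd x))) =
          (\<lambda>x. indicator ?U x *\<^sub>R h x)"
        by (auto simp: h_def fun_eq_iff \<psi>U(1) split: split_indicator)
      finally show ?thesis .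
    qed
    have "(\<integral>\<^sup>+x. ennreal (norm (indicator ?U x *\<^sub>R h x)) \<partial>lborel) \<le>
       (\<integral>\<^sup>+x. ennreal B * (ennreal (Q x * norm (f (\<psi> x))) * indicator ?U x) \<partial>lborel)"
    proof (intro nn_integral_mono)
      fix x :: "complex \<times> complex"
      show "ennreal (norm (indicator ?U x *\<^sub>R h x)) \<le> ennreal B * (ennreal (Q x * norm (f (\<psi> x))) * indicator ?U x)"
      proof (cases "x \<in> ?U")
        case True
        then have x2: "cmod (snd x) < 1" using U_dom_snd_less_1[OF \<alpha>] by blast
        have "cmod (cnj b * snd x) \<le> 1" using b x2 by (simp add: norm_mult mult_le_one)
        then have "cmod (\<zeta> (snd x)) \<le> 2"
          using norm_triangle_ineq4[of 1 "cnj b * snd x"] by (simp add: \<zeta>_def)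
        then have Z2: "cmod (Z (snd x)) \<le> 2 powr (2 + \<alpha>)"
          unfolding nZ using \<alpha> by (intro powr_mono2) auto
        have "cmod (h x) = cmod (f (\<psi> x)) / (cmod (Z (snd x)))\<^sup>2 * cmod (Z (snd x))"
          using Z0[OF x2] by (simp add: h_def norm_divide power2_eq_square)
        also have "\<dots> \<le> cmod (f (\<psi> x)) / (cmod (Z (snd x)))\<^sup>2 * 2 powr (2 + \<alpha>)"
          using Z2 by (intro mult_left_mono) auto
        also have "\<dots> = B * (Q x * cmod (f (\<psi> x)))" using A by (simp add: B_def Q)
        finally show ?thesis using True B by (simp add: ennreal_mult[symmetric] Q ennreal_leI)
      qed simp
    qed
    also have "\<dots> = ennreal B * (\<integral>\<^sup>+x\<in>?U. ennreal (Q x * norm (f (\<psi> x))) \<partial>lborel)"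
    proof (rule nn_integral_cmult)
      have [measurable]: "Q \<in> borel_measurable borel" unfolding Q_def by measurable
      have [measurable]: "\<psi> \<in> borel_measurable borel" unfolding \<psi>_def by measurable
      have [measurable]: "(\<lambda>x. indicator ?U (\<psi> x) *\<^sub>R f (\<psi> x)) \<in> borel_measurable borel"
        by (rule measurable_compose[OF _ f_meas]) measurable
      have "(\<lambda>x. ennreal (Q x * norm (indicator ?U (\<psi> x) *\<^sub>R f (\<psi> x))) * indicator ?U x) \<in> borel_measurable borel"
        by measurable
      also have "(\<lambda>x. ennreal (Q x * norm (indicator ?U (\<psi> x) *\<^sub>R f (\<psi> x))) * indicator ?U x) =
          (\<lambda>x. ennreal (Q x * norm (f (\<psi> x))) * indicator ?U x)"
        by (auto simp: fun_eq_iff \<psi>U(1) split: split_indicator)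
      finally show "(\<lambda>x. ennreal (Q x * norm (f (\<psi> x))) * indicator ?U x) \<in> borel_measurable lborel" by simp
    qed
    also have "(\<integral>\<^sup>+x\<in>?U. ennreal (Q x * norm (f (\<psi> x))) \<partial>lborel) =
       (\<integral>\<^sup>+x\<in>?U. ennreal (norm (f x)) \<partial>lborel)"
      unfolding Q_def \<psi>_def by (rule integral_U_dom_varphi(2)[OF \<alpha> b f_meas, symmetric])
    also have "\<dots> = (\<integral>\<^sup>+x. ennreal (norm (indicator ?U x *\<^sub>R f x)) \<partial>lborel)"
      by (intro nn_integral_cong) (auto split: split_indicator)
    also have "ennreal B * \<dots> < \<infinity>"
      using int by (auto simp: integrable_iff_bounded ennreal_mult_less_top)
    finally show ?thesis using h_meas by (auto simp: integrable_iff_bounded)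
  qed
  have fd_\<psi>1: "(\<lambda>y. (of_real (sqrt (1 - (cmod b)\<^sup>2)) / (1 - cnj b * y)) powr of_real \<alpha>) field_differentiable at y" if y: "cmod y < 1" for y
  proof -
    have "0 < Re (of_real (sqrt A) / \<zeta> y)"
      using A Re\<zeta>[OF y] by (auto simp: Re_divide intro!: divide_pos_pos mult_pos_pos add_pos_nonneg)
    then have "of_real (sqrt (1 - (cmod b)\<^sup>2)) / (1 - cnj b * y) \<notin> \<real>\<^sub>\<le>\<^sub>0"
      by (auto simp: A_def \<zeta>_def complex_nonpos_Reals_iff)
    then show ?thesis using Re\<zeta>[OF y] unfolding field_differentiable_def \<zeta>_def
      by (intro exI) (auto intro!: derivative_eq_intros)
  qed
  have fd_Z: "(\<lambda>y. 1 / Z y) field_differentiable at y" if y: "cmod y < 1" for y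
  proof -
    have "1 - cnj b * y \<notin> \<real>\<^sub>\<le>\<^sub>0" using Re\<zeta>[OF y] by (auto simp: \<zeta>_def complex_nonpos_Reals_iff)
    then show ?thesis using Z0[OF y] unfolding field_differentiable_def Z_def \<zeta>_def
      by (intro exI) (auto intro!: derivative_eq_intros simp del: of_real_add)
  qed
  have fd_moebius: "moebius b field_differentiable at y" if y: "cmod y < 1" for y
    using moebius_has_field_derivative[OF b y] by (auto simp: field_differentiable_def)
  have h2: "(\<lambda>y. h (x, y)) holomorphic_on ball 0 (sqrt (1 - cmod x powr (2 / \<alpha>)))" if x: "cmod x < 1" for x
    unfolding holomorphic_on_def
  proof
    fix y :: complex assume "y \<in> ball 0 (sqrt (1 - cmod x powr (2 / \<alpha>)))"
    then have xy: "(x, y) \<in> ?U" using x by (simp add: U_dom_iff_fst[OF \<alpha>])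
    then have y: "cmod y < 1" using U_dom_snd_less_1[OF \<alpha>] by fastforce
    have "(\<lambda>y. f (x * (of_real (sqrt (1 - (cmod b)\<^sup>2)) / (1 - cnj b * y)) powr of_real \<alpha>, moebius b y)) field_differentiable at y"
    proof (rule holo2_at_curve)
      show "holo2_at f (x * (of_real (sqrt (1 - (cmod b)\<^sup>2)) / (1 - cnj b * y)) powr of_real \<alpha>, moebius b y)"
        using f \<psi>U(1)[OF xy] by (simp add: holomorphic2_on_iff \<psi>_def varphi_map_def moebius_def)
      show "(\<lambda>y. x * (of_real (sqrt (1 - (cmod b)\<^sup>2)) / (1 - cnj b * y)) powr of_real \<alpha>) field_differentiable at y"
        by (intro field_differentiable_mult fd_\<psi>1[OF y] field_differentiable_const)
    qed (rule fd_moebius[OF y])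
    then have "(\<lambda>y. f (x * (of_real (sqrt (1 - (cmod b)\<^sup>2)) / (1 - cnj b * y)) powr of_real \<alpha>, moebius b y) * (1 / Z y)) field_differentiable at y"
      by (intro field_differentiable_mult fd_Z[OF y])
    then have "(\<lambda>y. h (x, y)) field_differentiable at y"
      by (simp add: h_def \<psi>_def varphi_map_def moebius_def)
    then show "(\<lambda>y. h (x, y)) field_differentiable at y within ball 0 (sqrt (1 - cmod x powr (2 / \<alpha>)))"
      by (rule field_differentiable_at_within)
  qed
  have h1: "(\<lambda>x. h (x, 0)) holomorphic_on ball 0 1"
    unfolding holomorphic_on_def
  proof
    fix x :: complex assume x: "x \<in> ball 0 1"
    then have x0: "(x, 0) \<in> ?U" by (simp add: U_dom_iff_snd[OF \<alpha>])
    have "(\<lambda>x. f (x * (of_real (sqrt (1 - (cmod b)\<^sup>2)) / (1 - cnj b * 0)) powr of_real \<alpha>, moebius b 0)) field_differentiable at x"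
    proof (rule holo2_at_curve)
      show "holo2_at f (x * (of_real (sqrt (1 - (cmod b)\<^sup>2)) / (1 - cnj b * 0)) powr of_real \<alpha>, moebius b 0)"
        using f \<psi>U(1)[OF x0] by (simp add: holomorphic2_on_iff \<psi>_def varphi_map_def moebius_def)
    qed (intro field_differentiable_mult field_differentiable_const field_differentiable_ident)+
    then have "(\<lambda>x. f (x * (of_real (sqrt (1 - (cmod b)\<^sup>2)) / (1 - cnj b * 0)) powr of_real \<alpha>, moebius b 0) * (1 / Z 0)) field_differentiable at x"
      by (intro field_differentiable_mult field_differentiable_const)
    then have "(\<lambda>x. h (x, 0)) field_differentiable at x"
      by (simp add: h_def \<psi>_def varphi_map_def moebius_def)
    then show "(\<lambda>x. h (x, 0)) field_differentiable at x within ball 0 1"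
      by (rule field_differentiable_at_within)
  qed
  have "(LINT x|lborel. indicator ?U x *\<^sub>R \<Phi> x) = (LINT x|lborel. indicator ?U x *\<^sub>R (Q x *\<^sub>R \<Phi> (\<psi> x)))"
    unfolding Q_def \<psi>_def by (rule integral_U_dom_varphi(1)[OF \<alpha> b \<Phi>_meas])
  also have "\<dots> = (LINT x|lborel. (1 / of_real (pi\<^sup>2)) * (indicator ?U x *\<^sub>R (h x * cnj (kernel_profile \<alpha> (fst x * cnj t)))))"
  proof (intro Bochner_Integration.integral_cong refl)
    fix x
    show "indicator ?U x *\<^sub>R (Q x *\<^sub>R \<Phi> (\<psi> x)) = (1 / of_real (pi\<^sup>2)) * (indicator ?U x *\<^sub>R (h x * cnj (kernel_profile \<alpha> (fst x * cnj t))))"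
    proof (cases "x \<in> ?U")
      case True
      then show ?thesis unfolding pull[OF True] by simp
    qed simp
  qed
  also have "\<dots> = (1 / of_real (pi\<^sup>2)) * (of_real (pi\<^sup>2) * h (t, 0))"
    by (simp only: integral_mult_right_zero thullen_reproducing_axis[OF \<alpha> t h2 h1 h_int])
  also have "\<dots> = h (t, 0)" by simp
  also have "\<dots> = f w"
  proof -
    have "\<psi> (t, 0) = (t * of_real (A powr (\<alpha> / 2)), b)"
      using moebius_factor_powr[OF b, of 0 \<alpha>] by (simp add: \<psi>_def varphi_map_def A_def)
    also have "\<dots> = w" using A by (simp add: t_def f_fun_def A_def b_def)
    finally show ?thesis by (simp add: h_def Z_def \<zeta>_def)
  qed
  finally show ?thesis by (simp add: \<Phi>_def)
qed

lemma integrable_lebesgue_on_iff: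
  fixes g :: "complex \<times> complex \<Rightarrow> 'b :: {banach, second_countable_topology}"
  assumes "(\<lambda>x. indicator (U_dom \<alpha>) x *\<^sub>R g x) \<in> borel_measurable borel"
  shows "integrable (lebesgue_on (U_dom \<alpha>)) g \<longleftrightarrow> integrable lborel (\<lambda>x. indicator (U_dom \<alpha>) x *\<^sub>R g x)"
    and "(LINT x|lebesgue_on (U_dom \<alpha>). g x) = (LINT x|lborel. indicator (U_dom \<alpha>) x *\<^sub>R g x)"
  using assms by (simp_all add: integrable_restrict_space integral_restrict_space integrable_completion integral_completion)

lemma bergman_space_integrable:
  assumes \<alpha>: "\<alpha> > 0" and f: "f \<in> bergman_space (U_dom \<alpha>)"
  shows "integrable lborel (\<lambda>x. indicator (U_dom \<alpha>) x *\<^sub>R f x)"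
proof -
  let ?U = "U_dom \<alpha>"
  have hol: "holomorphic2_on f ?U" and L2: "integrable (lebesgue_on ?U) (\<lambda>x. norm (f x) powr 2)"
    using f by (auto simp: bergman_space_def Lp_space_def)
  note f_meas[measurable] = holomorphic2_on_indicator_measurable[OF \<alpha> hol]
  have meas2: "(\<lambda>x. indicator ?U x *\<^sub>R (norm (f x) powr 2)) \<in> borel_measurable borel"
  proof -
    have "(\<lambda>x. norm (indicator ?U x *\<^sub>R f x) powr 2) \<in> borel_measurable borel" by measurable
    also have "(\<lambda>x. norm (indicator ?U x *\<^sub>R f x) powr 2) = (\<lambda>x. indicator ?U x *\<^sub>R (norm (f x) powr 2))"
      by (auto split: split_indicator)
    finally show ?thesis .
  qed
  have sq: "integrable lborel (\<lambda>x. indicator ?U x *\<^sub>R (norm (f x) powr 2))"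
    using L2 integrable_lebesgue_on_iff(1)[OF meas2] by simp
  have one: "integrable lborel (\<lambda>x. indicat_real ?U x)"
    using emeasure_U_dom_finite[OF \<alpha>] by simp
  show ?thesis
  proof (rule Bochner_Integration.integrable_bound[OF Bochner_Integration.integrable_add[OF one sq]])
    have "a \<le> 1 + a powr 2" if "0 \<le> a" for a :: real
    proof (cases "a \<le> 1")
      case False
      then have "a * 1 \<le> a * a" by (intro mult_left_mono) auto
      then show ?thesis using that by (simp add: power2_eq_square)
    qed (simp add: add_increasing2)
    then show "AE x in lborel. norm (indicator ?U x *\<^sub>R f x) \<le> norm (indicat_real ?U x + indicator ?U x *\<^sub>R (norm (f x) powr 2))"
      by (intro AE_I2) (auto split: split_indicator)
  qed simp
qed

lemma thullen_kernel_bergman: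
  assumes \<alpha>: "\<alpha> > 0" and w: "w \<in> U_dom \<alpha>"
  shows "(\<lambda>x. thullen_kernel \<alpha> x w) \<in> bergman_space (U_dom \<alpha>)"
proof -
  let ?U = "U_dom \<alpha>"
  have w2: "cmod (snd w) < 1" using U_dom_snd_less_1[OF \<alpha> w] .
  have "holo2_at (\<lambda>x. thullen_kernel \<alpha> x w) z" if z: "z \<in> ?U" for z
  proof -
    have z2: "cmod (snd z) < 1" using U_dom_snd_less_1[OF \<alpha> z] .
    have re: "0 < Re (1 - snd z * cnj (snd w))"
      using Re_one_minus_cnj_mult_pos[OF z2 w2] by simp
    then have nr: "1 - snd z * cnj (snd w) \<notin> \<real>\<^sub>\<le>\<^sub>0" "1 - snd z * cnj (snd w) \<noteq> 0"
      by (force simp: complex_nonpos_Reals_iff, metis less_irrefl zero_complex.sel(1))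
    have "(\<lambda>y. cnj (fst w) / (1 - y * cnj (snd w)) powr of_real \<alpha>) field_differentiable at (snd z)"
      using nr unfolding field_differentiable_def by (intro exI) (auto intro!: derivative_eq_intros)
    then have "holo2_at (\<lambda>x. fst x * (cnj (fst w) / (1 - snd x * cnj (snd w)) powr of_real \<alpha>)) z"
      by (intro holo2_at_mult holo2_at_fst holo2_at_compose[OF holo2_at_snd])
    then have T: "holo2_at (\<lambda>x. kernel_ratio \<alpha> x w) z" by (simp add: kernel_ratio_def)
    have "kernel_ratio \<alpha> z w \<noteq> 1" using norm_kernel_ratio_less(2)[OF \<alpha> z w] by auto
    then have "kernel_profile \<alpha> field_differentiable at (kernel_ratio \<alpha> z w)"
      unfolding field_differentiable_def kernel_profile_def by (intro exI) (auto intro!: derivative_eq_intros)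
    then have F: "holo2_at (\<lambda>x. kernel_profile \<alpha> (kernel_ratio \<alpha> x w)) z" by (rule holo2_at_compose[OF T])
    have "(\<lambda>y. 1 / (of_real (pi\<^sup>2) * (1 - y * cnj (snd w)) powr of_real (2 + \<alpha>))) field_differentiable at (snd z)"
      using nr unfolding field_differentiable_def by (intro exI) (auto intro!: derivative_eq_intros simp del: of_real_add)
    then have "holo2_at (\<lambda>x. 1 / (of_real (pi\<^sup>2) * (1 - snd x * cnj (snd w)) powr of_real (2 + \<alpha>))) z"
      by (rule holo2_at_compose[OF holo2_at_snd])
    from holo2_at_mult[OF F this] show ?thesis by (simp add: thullen_kernel_def)
  qed
  then have hol: "holomorphic2_on (\<lambda>x. thullen_kernel \<alpha> x w) ?U" by (simp add: holomorphic2_on_iff)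
  define B where "B = (2 + 2 * \<alpha>) / pi\<^sup>2 * ((1 - cmod (snd w)) powr (- (2 + \<alpha>)) * (1 - cmod (f_fun \<alpha> w)) powr (- 3))"
  have bd: "cmod (thullen_kernel \<alpha> z w) \<le> B" if z: "z \<in> ?U" for z
  proof -
    have z2: "cmod (snd z) < 1" using U_dom_snd_less_1[OF \<alpha> z] .
    have 1: "1 - cmod (snd w) \<le> cmod (1 - snd z * cnj (snd w))"
      using one_minus_cnj_mult_lower[of "snd z" "snd w"] z2 by (simp add: norm_one_minus_mult_cnj)
    have 2: "1 - cmod (f_fun \<alpha> w) \<le> cmod (1 - kernel_ratio \<alpha> z w)"
      using norm_triangle_ineq2[of 1 "kernel_ratio \<alpha> z w"] norm_kernel_ratio_less(1)[OF \<alpha> z w] by simp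
    have "kernel_size \<alpha> z w \<le> (1 - cmod (snd w)) powr (- (2 + \<alpha>)) * (1 - cmod (f_fun \<alpha> w)) powr (- 3)"
      unfolding kernel_size_def using 1 2 w2 norm_f_fun_less_1[OF \<alpha> w] \<alpha> by (intro mult_mono powr_mono2') auto
    then have "(2 + 2 * \<alpha>) / pi\<^sup>2 * kernel_size \<alpha> z w \<le> B" unfolding B_def using \<alpha> by (intro mult_left_mono) auto
    with norm_thullen_kernel_le[OF \<alpha> z w] show ?thesis by linarith
  qed
  have B0: "0 \<le> B" using \<alpha> by (simp add: B_def)
  have meas: "(\<lambda>x. thullen_kernel \<alpha> x w) \<in> borel_measurable borel" by measurable
  have "integrable lborel (\<lambda>x. indicator ?U x *\<^sub>R (cmod (thullen_kernel \<alpha> x w) powr 2))"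
  proof (rule integrableI_bounded_set_indicator)
    show "emeasure lborel ?U < \<infinity>" by (rule emeasure_U_dom_finite[OF \<alpha>])
    show "AE x in lborel. x \<in> ?U \<longrightarrow> norm (cmod (thullen_kernel \<alpha> x w) powr 2) \<le> B\<^sup>2"
      using bd by (auto intro!: AE_I2 power_mono)
  qed (use meas in measurable)
  then have "integrable (lebesgue_on ?U) (\<lambda>x. cmod (thullen_kernel \<alpha> x w) powr 2)"
    using meas by (subst integrable_lebesgue_on_iff(1)) measurable
  moreover have "(\<lambda>x. thullen_kernel \<alpha> x w) \<in> borel_measurable (lebesgue_on ?U)"
    using meas by (intro measurable_restrict_space1 measurable_completion) simp
  ultimately show ?thesis using hol by (simp add: bergman_space_def Lp_space_def)
qed

lemma bergman_space_reproducing: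
  assumes \<alpha>: "\<alpha> > 0" and f: "f \<in> bergman_space (U_dom \<alpha>)" and w: "w \<in> U_dom \<alpha>"
  shows "(LINT x|lebesgue_on (U_dom \<alpha>). f x * cnj (thullen_kernel \<alpha> x w)) = f w"
proof -
  have hol: "holomorphic2_on f (U_dom \<alpha>)" using f by (auto simp: bergman_space_def)
  note [measurable] = holomorphic2_on_indicator_measurable[OF \<alpha> hol]
  have "(\<lambda>x. (indicator (U_dom \<alpha>) x *\<^sub>R f x) * cnj (thullen_kernel \<alpha> x w)) \<in> borel_measurable borel"
    by measurable
  then have "(\<lambda>x. indicator (U_dom \<alpha>) x *\<^sub>R (f x * cnj (thullen_kernel \<alpha> x w))) \<in> borel_measurable borel" by simp
  from integrable_lebesgue_on_iff(2)[OF this] show ?thesis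
    using thullen_kernel_reproducing[OF \<alpha> hol w bergman_space_integrable[OF \<alpha> f]] by simp
qed

text \<open>If \<open>k\<close> also represents evaluation at \<open>w\<close>, then pairing it with the kernel at \<open>z\<close> gives \<open>k z\<close> by one reproducing property and \<open>cnj (K w z)\<close> by the other.\<close>

lemma bergman_kernel_U_dom:
  assumes \<alpha>: "\<alpha> > 0" and z: "z \<in> U_dom \<alpha>" and w: "w \<in> U_dom \<alpha>"
  shows "bergman_kernel (U_dom \<alpha>) z w = thullen_kernel \<alpha> z w"
  unfolding bergman_kernel_def
proof (rule the_equality)
  show "\<exists>k\<in>bergman_space (U_dom \<alpha>). (\<forall>f\<in>bergman_space (U_dom \<alpha>). f w = (LINT x|lebesgue_on (U_dom \<alpha>). f x * cnj (k x))) \<and>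
      thullen_kernel \<alpha> z w = k z"
    using thullen_kernel_bergman[OF \<alpha> w] bergman_space_reproducing[OF \<alpha> _ w] by (intro bexI) auto
next
  fix c
  assume "\<exists>k\<in>bergman_space (U_dom \<alpha>). (\<forall>f\<in>bergman_space (U_dom \<alpha>). f w = (LINT x|lebesgue_on (U_dom \<alpha>). f x * cnj (k x))) \<and> c = k z"
  then obtain k where k: "k \<in> bergman_space (U_dom \<alpha>)" "c = k z"
    "\<And>f. f \<in> bergman_space (U_dom \<alpha>) \<Longrightarrow> f w = (LINT x|lebesgue_on (U_dom \<alpha>). f x * cnj (k x))" by blast
  have "thullen_kernel \<alpha> w z = (LINT x|lebesgue_on (U_dom \<alpha>). thullen_kernel \<alpha> x z * cnj (k x))"
    by (rule k(3)[OF thullen_kernel_bergman[OF \<alpha> z]])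
  also have "\<dots> = (LINT x|lebesgue_on (U_dom \<alpha>). cnj (k x * cnj (thullen_kernel \<alpha> x z)))"
    by (simp add: mult.commute)
  also have "\<dots> = cnj (k z)"
    by (subst Bochner_Integration.integral_cnj) (simp add: bergman_space_reproducing[OF \<alpha> k(1) z])
  finally have "k z = cnj (thullen_kernel \<alpha> w z)" by simp
  then show "c = thullen_kernel \<alpha> z w"
    using cnj_thullen_kernel U_dom_snd_less_1[OF \<alpha>] z w k(2) by simp
qed

section \<open>Schur test and boundedness of the Hankel operator\<close>

text \<open>Cauchy-Schwarz for the measure with density \<open>L x\<close> and the factors \<open>sqrt h\<close> and \<open>f / sqrt h\<close>. The
test inequality is used once in each variable, the second time by symmetry after exchanging the integrals.\<close>

lemma schur_test:
  fixes L :: "'a::euclidean_space \<Rightarrow> 'a \<Rightarrow> ennreal" and h :: "'a \<Rightarrow> real" and f :: "'a \<Rightarrow> ennreal"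
  assumes L: "case_prod L \<in> borel_measurable (lborel \<Otimes>\<^sub>M lborel)"
    and sym: "\<And>x y. L x y = L y x"
    and h[measurable]: "h \<in> borel_measurable borel" and pos: "\<And>x. 0 < h x"
    and test: "AE x in lborel. (\<integral>\<^sup>+y. L x y * ennreal (h y) \<partial>lborel) \<le> C * ennreal (h x)"
    and f[measurable]: "f \<in> borel_measurable borel"
  shows "(\<integral>\<^sup>+x. (\<integral>\<^sup>+y. L x y * f y \<partial>lborel)\<^sup>2 \<partial>lborel) \<le> C\<^sup>2 * (\<integral>\<^sup>+y. (f y)\<^sup>2 \<partial>lborel)"
proof -
  note L[measurable]
  have Lx[measurable]: "L x \<in> borel_measurable borel" for x
    using measurable_Pair2[OF L, of x] by simp
  define g where "g = (\<lambda>y. (f y)\<^sup>2 * ennreal (1 / h y))"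
  have g[measurable]: "g \<in> borel_measurable borel" unfolding g_def by measurable
  have ptw: "(\<integral>\<^sup>+y. L x y * f y \<partial>lborel)\<^sup>2 \<le> (\<integral>\<^sup>+y. L x y * ennreal (h y) \<partial>lborel) * (\<integral>\<^sup>+y. L x y * g y \<partial>lborel)" for x
  proof -
    define \<nu> where "\<nu> = density lborel (L x)"
    have "(\<integral>\<^sup>+y. L x y * f y \<partial>lborel) = (\<integral>\<^sup>+y. ennreal (sqrt (h y)) * (f y * ennreal (1 / sqrt (h y))) \<partial>\<nu>)"
      unfolding \<nu>_def
    proof (subst nn_integral_density, measurable, intro nn_integral_cong)
      fix y
      have "ennreal (sqrt (h y)) * ennreal (1 / sqrt (h y)) = 1"
        using pos[of y] by (simp add: ennreal_mult[symmetric])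
      then show "L x y * f y = L x y * (ennreal (sqrt (h y)) * (f y * ennreal (1 / sqrt (h y))))"
        by (simp add: mult.left_commute[of _ "f y"])
    qed
    also have "\<dots>\<^sup>2 \<le> (\<integral>\<^sup>+y. (ennreal (sqrt (h y)))\<^sup>2 \<partial>\<nu>) * (\<integral>\<^sup>+y. (f y * ennreal (1 / sqrt (h y)))\<^sup>2 \<partial>\<nu>)"
      by (rule Cauchy_Schwarz_nn_integral) (auto simp: \<nu>_def)
    also have "(\<integral>\<^sup>+y. (ennreal (sqrt (h y)))\<^sup>2 \<partial>\<nu>) = (\<integral>\<^sup>+y. L x y * ennreal (h y) \<partial>lborel)"
      unfolding \<nu>_def using pos[THEN less_imp_le]
      by (subst nn_integral_density) (auto simp: ennreal_power intro!: nn_integral_cong)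
    also have "(\<integral>\<^sup>+y. (f y * ennreal (1 / sqrt (h y)))\<^sup>2 \<partial>\<nu>) = (\<integral>\<^sup>+y. L x y * g y \<partial>lborel)"
      unfolding \<nu>_def g_def using pos[THEN less_imp_le]
      by (subst nn_integral_density) (auto simp: ennreal_power power_mult_distrib power_divide intro!: nn_integral_cong)
    finally show ?thesis .
  qed
  have "(\<integral>\<^sup>+x. (\<integral>\<^sup>+y. L x y * f y \<partial>lborel)\<^sup>2 \<partial>lborel) \<le> (\<integral>\<^sup>+x. C * ennreal (h x) * (\<integral>\<^sup>+y. L x y * g y \<partial>lborel) \<partial>lborel)"
    using test
  proof (intro nn_integral_mono_AE, eventually_elim)
    case (elim x)
    show ?case by (rule order_trans[OF ptw mult_right_mono[OF elim(2)]]) simp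
  qed
  also have "\<dots> = (\<integral>\<^sup>+x. \<integral>\<^sup>+y. C * (ennreal (h x) * L x y * g y) \<partial>lborel \<partial>lborel)"
    by (intro nn_integral_cong) (simp add: nn_integral_cmult[symmetric] mult_ac)
  also have "\<dots> = (\<integral>\<^sup>+y. \<integral>\<^sup>+x. C * (ennreal (h x) * L x y * g y) \<partial>lborel \<partial>lborel)"
    by (rule lborel_pair.Fubini'[symmetric]) measurable
  also have "\<dots> = (\<integral>\<^sup>+y. C * g y * (\<integral>\<^sup>+x. L y x * ennreal (h x) \<partial>lborel) \<partial>lborel)"
    by (intro nn_integral_cong, subst nn_integral_cmult[symmetric]) (auto simp: sym mult_ac intro!: nn_integral_cong)
  also have "\<dots> \<le> (\<integral>\<^sup>+y. C\<^sup>2 * (f y)\<^sup>2 \<partial>lborel)"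
    using test
  proof (intro nn_integral_mono_AE, eventually_elim)
    case (elim y)
    have "C * g y * (\<integral>\<^sup>+x. L y x * ennreal (h x) \<partial>lborel) \<le> C * g y * (C * ennreal (h y))"
      by (rule mult_left_mono[OF elim(2)]) simp
    also have "\<dots> = C\<^sup>2 * (f y)\<^sup>2 * (ennreal (1 / h y) * ennreal (h y))"
      by (simp add: g_def power2_eq_square mult_ac)
    also have "ennreal (1 / h y) * ennreal (h y) = 1" using pos[of y] by (simp add: ennreal_mult[symmetric])
    finally show ?case by simp
  qed
  also have "\<dots> = C\<^sup>2 * (\<integral>\<^sup>+y. (f y)\<^sup>2 \<partial>lborel)" by (rule nn_integral_cmult) measurable
  finally show ?thesis .
qed

lemma measurable_lebesgue_AE_eq:
  assumes g: "g \<in> borel_measurable lborel" and ae: "AE x in lborel. f x = g x"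
  shows "f \<in> borel_measurable lebesgue"
proof (rule measurableI)
  fix A :: "'b set" assume A: "A \<in> sets borel"
  have "g -` A \<in> sets lborel" using measurable_sets[OF g A] by simp
  then have gA: "g -` A \<in> sets lebesgue" by (rule sets_completionI_sets)
  have "AE x in lebesgue. x \<in> g -` A \<longleftrightarrow> x \<in> f -` A"
    using AE_completion[OF ae] by eventually_elim auto
  from completion.in_sets_AE[OF this gA] show "f -` A \<inter> space lebesgue \<in> sets lebesgue" by simp
qed simp

lemma lebesgue_measurable_borel_representative:
  fixes f :: "'a::euclidean_space \<Rightarrow> complex"
  assumes [measurable]: "f \<in> borel_measurable lebesgue"
  obtains g where "g \<in> borel_measurable borel" "AE x in lborel. f x = g x"
proof -
  have "(\<lambda>x. Re (f x)) \<in> borel_measurable lebesgue" "(\<lambda>x. Im (f x)) \<in> borel_measurable lebesgue" by measurable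
  then obtain a b where ab: "a \<in> borel_measurable lborel" "AE x in lborel. Re (f x) = a x"
      "b \<in> borel_measurable lborel" "AE x in lborel. Im (f x) = b x"
    using completion_ex_borel_measurable_real by metis
  have [measurable]: "a \<in> borel_measurable borel" "b \<in> borel_measurable borel" using ab by auto
  show thesis
  proof (rule that[of "\<lambda>x. of_real (a x) + \<i> * of_real (b x)"])
    show "AE x in lborel. f x = of_real (a x) + \<i> * of_real (b x)"
      using ab(2,4) by eventually_elim (simp add: complex_eq_iff)
  qed measurable
qed

lemma measurable_phi_map [measurable]: "phi_map \<alpha> a \<in> borel_measurable borel"
  unfolding phi_map_def phi_fst_def phi_snd_def borel_prod[symmetric] by measurable

text \<open>The substitution rule with the indicator of a null set shows that its preimage is null. Together with the
complement of the domain this also covers the points that the map might send outside.\<close>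

lemma AE_varphi_phi:
  assumes \<alpha>: "\<alpha> > 0" and z: "z \<in> U_dom \<alpha>" and P: "AE w in lborel. w \<in> U_dom \<alpha> \<longrightarrow> P w"
  shows "AE x in lborel. x \<in> U_dom \<alpha> \<longrightarrow> P (varphi_map \<alpha> (snd z) (phi_map \<alpha> (f_fun \<alpha> z) x))"
proof -
  have b: "cmod (snd z) < 1" and t: "cmod (f_fun \<alpha> z) < 1"
    using U_dom_snd_less_1[OF \<alpha> z] norm_f_fun_less_1[OF \<alpha> z] by auto
  from P[unfolded eventually_ae_filter] obtain N where N: "N \<in> null_sets lborel"
      "{w \<in> space lborel. \<not> (w \<in> U_dom \<alpha> \<longrightarrow> P w)} \<subseteq> N"
    by (rule bexE)
  define S where "S = N \<union> (- U_dom \<alpha>)"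
  have [measurable]: "N \<in> sets borel" using null_setsD2[OF N(1)] by simp
  have S[measurable]: "S \<in> sets borel" unfolding S_def by measurable
  have "(\<integral>\<^sup>+x\<in>U_dom \<alpha>. indicator S (varphi_map \<alpha> (snd z) (phi_map \<alpha> (f_fun \<alpha> z) x)) \<partial>lborel) = 0"
  proof (subst nn_integral_varphi_phi[OF \<alpha> b t])
    show "(\<integral>\<^sup>+w. indicator S w *
            ennreal (((1 - (cmod (f_fun \<alpha> z))\<^sup>2) / (cmod (1 - cnj (f_fun \<alpha> z) * fst (varphi_map \<alpha> (snd z) w)))\<^sup>2)\<^sup>2 *
               ((1 - cmod (moebius (f_fun \<alpha> z) (fst (varphi_map \<alpha> (snd z) w))) powr (2 / \<alpha>)) / (1 - cmod (fst (varphi_map \<alpha> (snd z) w)) powr (2 / \<alpha>)))) *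
            ennreal (((1 - (cmod (snd z))\<^sup>2) / (cmod (1 - cnj (snd z) * snd w))\<^sup>2) powr (2 + \<alpha>)) *
            indicator (U_dom \<alpha>) w \<partial>lborel) = 0" (is "(\<integral>\<^sup>+w. ?F w \<partial>lborel) = 0")
    proof -
      have "(\<integral>\<^sup>+w. ?F w \<partial>lborel) = (\<integral>\<^sup>+(w::complex\<times>complex). 0 \<partial>lborel)"
        using AE_not_in[OF N(1)] by (intro nn_integral_cong_AE) (auto simp: S_def split: split_indicator)
      then show ?thesis by simp
    qed
  qed simp
  then have "AE x in lborel. indicator S (varphi_map \<alpha> (snd z) (phi_map \<alpha> (f_fun \<alpha> z) x)) * indicator (U_dom \<alpha>) x = (0::ennreal)"
    by (subst (asm) nn_integral_0_iff_AE) measurable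
  then show ?thesis
  proof eventually_elim
    case (elim x)
    then show ?case using N(2) by (auto simp: S_def indicator_def split: if_splits)
  qed
qed

text \<open>The factor \<open>(k^2 / \<kappa> * h)^(1/p)\<close> is inserted into one term and removed from the other. The powers of
\<open>h\<close> and \<open>\<kappa>\<close> are balanced so that the integral of either term is a multiple of \<open>h\<close>.\<close>

lemma young_split:
  fixes p q :: real
  assumes p: "p > 1" and q: "q = p / (p - 1)" and pos: "0 \<le> a" "0 < k" "0 < \<kappa>" "0 < h" "0 < h'"
  shows "a * k * h' \<le> h / p * (a powr p * (k\<^sup>2 / \<kappa>)) + h powr (1 - q) / q * \<kappa> powr (q - 1) * (k powr (2 - q) * h' powr q)"
proof -
  have q1: "q > 1" "1 / p + 1 / q = 1" using p by (auto simp: q field_simps)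
  have pq: "q / p = q - 1" using p by (simp add: q field_simps)
  define j where "j = k\<^sup>2 / \<kappa>"
  have j: "0 < j" using pos by (simp add: j_def)
  define X where "X = a * (j * h) powr (1 / p)"
  define Y where "Y = k * h' * (j * h) powr (- (1 / p))"
  have XY: "X * Y = a * k * h'"
  proof -
    have "(j * h) powr (1 / p) * (j * h) powr (- (1 / p)) = 1"
      using j pos by (simp add: powr_add[symmetric])
    then show ?thesis by (simp add: X_def Y_def mult_ac)
  qed
  have "X powr p = a powr p * (j * h)"
    using pos j p by (simp add: X_def powr_mult powr_powr)
  moreover have "Y powr q = h powr (1 - q) * \<kappa> powr (q - 1) * (k powr (2 - q) * h' powr q)"
  proof -
    have "Y powr q = (k * h') powr q * (j * h) powr (1 - q)"
      using pos j pq by (simp add: Y_def powr_mult powr_powr)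
    moreover have "ln ((k * h') powr q * (j * h) powr (1 - q)) = ln (h powr (1 - q) * \<kappa> powr (q - 1) * (k powr (2 - q) * h' powr q))"
      using pos j by (simp add: j_def ln_mult ln_div ln_powr ln_realpow algebra_simps)
    then have "(k * h') powr q * (j * h) powr (1 - q) = h powr (1 - q) * \<kappa> powr (q - 1) * (k powr (2 - q) * h' powr q)"
      by (subst (asm) ln_inj_iff) (use pos j in auto)
    ultimately show ?thesis by simp
  qed
  moreover have "X * Y \<le> X powr p / p + Y powr q / q"
    using Youngs_inequality[OF p q1] pos j by (simp add: X_def Y_def)
  ultimately show ?thesis unfolding XY j_def[symmetric] by (simp add: mult_ac)
qed

lemma kernel_size_pos:
  assumes \<alpha>: "\<alpha> > 0" and z: "z \<in> U_dom \<alpha>" and w: "w \<in> U_dom \<alpha>"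
  shows "0 < kernel_size \<alpha> z w"
proof -
  have "1 - snd z * cnj (snd w) \<noteq> 0"
    using one_minus_cnj_mult_nonzero[of "snd z" "snd w"] U_dom_snd_less_1[OF \<alpha>] z w
    by (metis norm_eq_zero norm_one_minus_mult_cnj)
  moreover have "1 - kernel_ratio \<alpha> z w \<noteq> 0" using norm_kernel_ratio_less(2)[OF \<alpha> z w] by auto
  ultimately show ?thesis by (simp add: kernel_size_def)
qed

lemma kernel_diag_pos:
  assumes \<alpha>: "\<alpha> > 0" and z: "z \<in> U_dom \<alpha>" shows "0 < kernel_diag \<alpha> z"
  using one_minus_norm_sq_pos[OF U_dom_snd_less_1[OF \<alpha> z]] one_minus_norm_sq_pos[OF norm_f_fun_less_1[OF \<alpha> z]]
  by (simp add: kernel_diag_def)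

lemma schur_weight_pos:
  assumes \<alpha>: "\<alpha> > 0" and z: "z \<in> U_dom \<alpha>" shows "0 < schur_weight \<alpha> a b z"
  using one_minus_norm_sq_pos[OF U_dom_snd_less_1[OF \<alpha> z]] one_minus_norm_sq_pos[OF norm_f_fun_less_1[OF \<alpha> z]]
  by (simp add: schur_weight_def)

lemma kernel_size_commute:
  assumes \<alpha>: "\<alpha> > 0" and z: "z \<in> U_dom \<alpha>" and w: "w \<in> U_dom \<alpha>"
  shows "kernel_size \<alpha> z w = kernel_size \<alpha> w z"
proof -
  have "1 - kernel_ratio \<alpha> w z = cnj (1 - kernel_ratio \<alpha> z w)"
    using cnj_kernel_ratio[of z w \<alpha>] U_dom_snd_less_1[OF \<alpha>] z w by simp
  then have "cmod (1 - kernel_ratio \<alpha> w z) = cmod (1 - kernel_ratio \<alpha> z w)" by (metis complex_mod_cnj)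
  moreover have "cmod (1 - snd w * cnj (snd z)) = cmod (1 - snd z * cnj (snd w))"
    by (simp add: norm_one_minus_mult_cnj[of "snd z"] mult.commute)
  ultimately show ?thesis by (simp add: kernel_size_def)
qed

text \<open>The condition \<open>p > 4\<close> is used here, through the choice of \<open>b\<close> between \<open>3 (q - 1)\<close> and
\<open>1\<close>.\<close>

lemma schur_bound_of_moment:
  fixes p :: real
  assumes \<alpha>: "\<alpha> > 0" and p: "p > 4" and K: "0 \<le> K"
  shows "\<exists>a b C. 0 \<le> C \<and> (\<forall>z\<in>U_dom \<alpha>. \<forall>g\<in>borel_measurable borel. (\<forall>w. 0 \<le> g w) \<longrightarrow>
      (\<integral>\<^sup>+w\<in>U_dom \<alpha>. ennreal (g w powr p) * ennreal ((kernel_size \<alpha> z w)\<^sup>2 / kernel_diag \<alpha> z) \<partial>lborel) \<le> ennreal K \<longrightarrow>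
      (\<integral>\<^sup>+w\<in>U_dom \<alpha>. ennreal (g w * kernel_size \<alpha> z w * schur_weight \<alpha> a b w) \<partial>lborel) \<le> ennreal (C * schur_weight \<alpha> a b z))"
proof -
  let ?U = "U_dom \<alpha>"
  define q where "q = p / (p - 1)"
  have q: "q > 1" "3 * (q - 1) < 1" using p by (auto simp: q_def field_simps)
  \<comment> \<open>Since \<open>q < 4/3\<close>, there is room for both exponents, whatever the value of \<open>\<alpha>\<close>.\<close>
  have "(2 + \<alpha>) * (q - 1) \<le> (2 + \<alpha>) * (1 / 3)" using q \<alpha> by (intro mult_left_mono) auto
  also have "\<dots> < 1 + \<alpha>" using \<alpha> by simp
  finally obtain a where a: "(2 + \<alpha>) * (q - 1) < a" "a < 1 + \<alpha>" using dense by blast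
  obtain b where b: "3 * (q - 1) < b" "b < 1" using dense q by blast
  obtain C where C: "0 \<le> C" "\<And>z. z \<in> ?U \<Longrightarrow>
     (\<integral>\<^sup>+w\<in>?U. ennreal (kernel_size \<alpha> z w powr (2 - q) * schur_weight \<alpha> a b w) \<partial>lborel)
      \<le> ennreal (C * (kernel_diag \<alpha> z powr (1 - q) * schur_weight \<alpha> a b z))"
    using schur_kernel_estimate[OF \<alpha> q(1) a b] by blast
  define h where "h = schur_weight \<alpha> (a / q) (b / q)"
  have hq: "h w powr q = schur_weight \<alpha> a b w" for w
    using q by (simp add: h_def schur_weight_def powr_mult powr_powr)
  have [measurable]: "h \<in> borel_measurable borel" unfolding h_def by measurable
  have main: "(\<integral>\<^sup>+w\<in>?U. ennreal (g w * kernel_size \<alpha> z w * h w) \<partial>lborel) \<le> ennreal ((K / p + C / q) * h z)"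
    if z: "z \<in> ?U" and g[measurable]: "g \<in> borel_measurable borel" and g0: "\<And>w. 0 \<le> g w"
      and gK: "(\<integral>\<^sup>+w\<in>?U. ennreal (g w powr p) * ennreal ((kernel_size \<alpha> z w)\<^sup>2 / kernel_diag \<alpha> z) \<partial>lborel) \<le> ennreal K"
    for z g
  proof -
    define \<kappa> where "\<kappa> = kernel_diag \<alpha> z"
    have \<kappa>: "0 < \<kappa>" using kernel_diag_pos[OF \<alpha> z] by (simp add: \<kappa>_def)
    have hp: "0 < h w" if "w \<in> ?U" for w using schur_weight_pos[OF \<alpha> that] by (simp add: h_def)
    define c1 where "c1 = h z / p"
    define c2 where "c2 = h z powr (1 - q) / q * \<kappa> powr (q - 1)"
    have c: "0 \<le> c1" "0 \<le> c2" using hp[OF z] p q by (auto simp: c1_def c2_def)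
    have "(\<integral>\<^sup>+w\<in>?U. ennreal (g w * kernel_size \<alpha> z w * h w) \<partial>lborel) \<le>
      (\<integral>\<^sup>+w. ennreal c1 * (ennreal (g w powr p) * ennreal ((kernel_size \<alpha> z w)\<^sup>2 / kernel_diag \<alpha> z) * indicator ?U w) +
         ennreal c2 * (ennreal (kernel_size \<alpha> z w powr (2 - q) * schur_weight \<alpha> a b w) * indicator ?U w) \<partial>lborel)"
    proof (intro nn_integral_mono)
      fix w :: "complex \<times> complex"
      show "ennreal (g w * kernel_size \<alpha> z w * h w) * indicator ?U w \<le>
        ennreal c1 * (ennreal (g w powr p) * ennreal ((kernel_size \<alpha> z w)\<^sup>2 / kernel_diag \<alpha> z) * indicator ?U w) +
         ennreal c2 * (ennreal (kernel_size \<alpha> z w powr (2 - q) * schur_weight \<alpha> a b w) * indicator ?U w)"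
      proof (cases "w \<in> ?U")
        case True
        have "g w * kernel_size \<alpha> z w * h w \<le> c1 * (g w powr p * ((kernel_size \<alpha> z w)\<^sup>2 / \<kappa>)) + c2 * (kernel_size \<alpha> z w powr (2 - q) * h w powr q)"
          unfolding c1_def c2_def using p
          by (intro young_split[OF _ q_def g0 kernel_size_pos[OF \<alpha> z True] \<kappa> hp[OF z] hp[OF True]]) auto
        then have "ennreal (g w * kernel_size \<alpha> z w * h w) \<le> ennreal (c1 * (g w powr p * ((kernel_size \<alpha> z w)\<^sup>2 / \<kappa>)) + c2 * (kernel_size \<alpha> z w powr (2 - q) * h w powr q))"
          by (rule ennreal_leI)
        also have "\<dots> = ennreal c1 * (ennreal (g w powr p) * ennreal ((kernel_size \<alpha> z w)\<^sup>2 / \<kappa>)) + ennreal c2 * ennreal (kernel_size \<alpha> z w powr (2 - q) * h w powr q)"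
        proof -
          have split: "ennreal (c1 * (X * Y) + c2 * Z) = ennreal c1 * (ennreal X * ennreal Y) + ennreal c2 * ennreal Z"
            if "0 \<le> X" "0 \<le> Y" "0 \<le> Z" for X Y Z
            using that c by (simp add: ennreal_plus ennreal_mult)
          show ?thesis by (rule split) (use \<kappa> in auto)
        qed
        finally show ?thesis using True by (simp add: \<kappa>_def hq)
      qed simp
    qed
    also have "\<dots> = ennreal c1 * (\<integral>\<^sup>+w\<in>?U. ennreal (g w powr p) * ennreal ((kernel_size \<alpha> z w)\<^sup>2 / kernel_diag \<alpha> z) \<partial>lborel) +
       ennreal c2 * (\<integral>\<^sup>+w\<in>?U. ennreal (kernel_size \<alpha> z w powr (2 - q) * schur_weight \<alpha> a b w) \<partial>lborel)"
    proof -
      have m1: "(\<lambda>w. ennreal (g w powr p) * ennreal ((kernel_size \<alpha> z w)\<^sup>2 / kernel_diag \<alpha> z) * indicator ?U w) \<in> borel_measurable lborel"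
        by measurable
      have m2: "(\<lambda>w. ennreal (kernel_size \<alpha> z w powr (2 - q) * schur_weight \<alpha> a b w) * indicator ?U w) \<in> borel_measurable lborel"
        by measurable
      show ?thesis
        by (subst nn_integral_add) (use m1 m2 in \<open>auto simp: nn_integral_cmult[OF m1] nn_integral_cmult[OF m2]\<close>)
    qed
    also have "\<dots> \<le> ennreal c1 * ennreal K + ennreal c2 * ennreal (C * (kernel_diag \<alpha> z powr (1 - q) * schur_weight \<alpha> a b z))"
      by (intro add_mono mult_left_mono gK C(2)[OF z]) auto
    also have "\<dots> = ennreal (c1 * K + c2 * (C * (\<kappa> powr (1 - q) * h z powr q)))"
      using c K C(1) by (simp add: ennreal_mult ennreal_plus hq \<kappa>_def[symmetric] schur_weight_pos[OF \<alpha> z, THEN less_imp_le])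
    also have "c1 * K + c2 * (C * (\<kappa> powr (1 - q) * h z powr q)) = (K / p + C / q) * h z"
    proof -
      have "\<kappa> powr (q - 1) * \<kappa> powr (1 - q) = 1" using \<kappa> by (simp add: powr_add[symmetric])
      moreover have "h z powr (1 - q) * h z powr q = h z" using hp[OF z] by (simp add: powr_add[symmetric])
      moreover have "c2 * (C * (\<kappa> powr (1 - q) * h z powr q)) = C / q * (\<kappa> powr (q - 1) * \<kappa> powr (1 - q)) * (h z powr (1 - q) * h z powr q)"
        by (simp add: c2_def)
      ultimately show ?thesis by (simp add: c1_def algebra_simps)
    qed
    finally show ?thesis .
  qed
  show ?thesis
  proof (rule exI[of _ "a / q"], rule exI[of _ "b / q"], rule exI[of _ "K / p + C / q"], fold h_def, intro conjI ballI impI)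
    show "0 \<le> K / p + C / q" using K C(1) p q by simp
  qed (rule main, auto)
qed


text \<open>The double integrals in Schur's test require joint Borel measurability, which \<open>u\<close> lacks; it is replaced
by a Borel function \<open>v\<close>, at the cost of a null set of points \<open>z\<close>.\<close>

lemma hankel_bounded_of_schur:
  assumes \<alpha>: "\<alpha> > 0" and u: "u \<in> borel_measurable (lebesgue_on (U_dom \<alpha>))"
    and v[measurable]: "v \<in> borel_measurable borel" and uv: "AE w in lborel. w \<in> U_dom \<alpha> \<longrightarrow> u w = v w"
    and C: "0 \<le> C" and test: "\<And>z. z \<in> U_dom \<alpha> \<Longrightarrow>
      (\<integral>\<^sup>+w\<in>U_dom \<alpha>. ennreal (cmod (u z - v w) * kernel_size \<alpha> z w * schur_weight \<alpha> a b w) \<partial>lborel) \<le> ennreal (C * schur_weight \<alpha> a b z)"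
  shows "hankel_bounded (U_dom \<alpha>) u"
proof -
  let ?U = "U_dom \<alpha>"
  define c where "c = (2 + 2 * \<alpha>) / pi\<^sup>2"
  have c: "0 \<le> c" using \<alpha> by (simp add: c_def)
  define L where "L = (\<lambda>z w. ennreal (cmod (v z - v w) * kernel_size \<alpha> z w) * indicator ?U z * indicator ?U w)"
  \<comment> \<open>Outside the domain \<open>L\<close> vanishes, so any positive value serves there.\<close>
  define h where "h = (\<lambda>w. if w \<in> ?U then schur_weight \<alpha> a b w else 1)"
  have meas_pair: "case_prod L \<in> borel_measurable (lborel \<Otimes>\<^sub>M lborel)"
    unfolding L_def case_prod_unfold lborel_prod by measurable
  have [measurable]: "h \<in> borel_measurable borel" unfolding h_def by measurable
  have hp: "0 < h w" for w using schur_weight_pos[OF \<alpha>] by (simp add: h_def)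
  have L_sym: "L z w = L w z" for z w
    using kernel_size_commute[OF \<alpha>, of z w] by (auto simp: L_def norm_minus_commute split: split_indicator)
  have L_test: "AE z in lborel. (\<integral>\<^sup>+w. L z w * ennreal (h w) \<partial>lborel) \<le> ennreal C * ennreal (h z)"
    using uv
  proof eventually_elim
    case (elim z)
    show ?case
    proof (cases "z \<in> ?U")
      case True
      have "(\<integral>\<^sup>+w. L z w * ennreal (h w) \<partial>lborel) =
         (\<integral>\<^sup>+w\<in>?U. ennreal (cmod (u z - v w) * kernel_size \<alpha> z w * schur_weight \<alpha> a b w) \<partial>lborel)"
        using True elim kernel_size_pos[OF \<alpha> True, THEN less_imp_le] schur_weight_pos[OF \<alpha>, THEN less_imp_le]
        by (intro nn_integral_cong) (auto simp: L_def h_def ennreal_mult split: split_indicator)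
      also have "\<dots> \<le> ennreal (C * schur_weight \<alpha> a b z)" by (rule test[OF True])
      also have "\<dots> = ennreal C * ennreal (h z)"
        using C True schur_weight_pos[OF \<alpha> True, of a b] by (simp add: h_def ennreal_mult)
      finally show ?thesis .
    qed (simp add: L_def)
  qed
  have main: "(AE z in lebesgue_on ?U. integrable (lebesgue_on ?U) (hankel_integrand ?U u f z)) \<and>
      hankel ?U u f \<in> Lp_space 2 (lebesgue_on ?U) \<and>
      Lp_norm 2 (lebesgue_on ?U) (hankel ?U u f) \<le> c * C * Lp_norm 2 (lebesgue_on ?U) f"
    if f: "f \<in> bergman_space ?U" for f
  proof -
    have hol: "holomorphic2_on f ?U" and f_L2: "integrable (lebesgue_on ?U) (\<lambda>x. cmod (f x) powr 2)"
      and f_leb: "f \<in> borel_measurable (lebesgue_on ?U)"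
      using f by (auto simp: bergman_space_def Lp_space_def)
    define fU where "fU = (\<lambda>x. indicator ?U x *\<^sub>R f x)"
    have fU[measurable]: "fU \<in> borel_measurable borel"
      unfolding fU_def by (rule holomorphic2_on_indicator_measurable[OF \<alpha> hol])
    define I where "I = (\<lambda>z. \<integral>\<^sup>+w. L z w * ennreal (cmod (fU w)) \<partial>lborel)"
    have [measurable]: "I \<in> borel_measurable borel"
    proof -
      have "(\<lambda>(z, w). L z w * ennreal (cmod (fU w))) \<in> borel_measurable (lborel \<Otimes>\<^sub>M lborel)"
        using meas_pair by measurable
      from lborel.borel_measurable_nn_integral[OF this] show ?thesis by (simp add: I_def)
    qed
    define F2 where "F2 = (LINT x|lebesgue_on ?U. cmod (f x) powr 2)"
    have F2: "0 \<le> F2" by (simp add: F2_def)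
    have fU2: "(\<integral>\<^sup>+w. (ennreal (cmod (fU w)))\<^sup>2 \<partial>lborel) = ennreal F2"
    proof -
      have "ennreal F2 = (\<integral>\<^sup>+x. ennreal (cmod (f x) powr 2) \<partial>lebesgue_on ?U)"
        unfolding F2_def using f_L2 by (intro nn_integral_eq_integral[symmetric]) auto
      also have "\<dots> = (\<integral>\<^sup>+x\<in>?U. ennreal (cmod (f x) powr 2) \<partial>lborel)"
        by (simp add: nn_integral_restrict_space nn_integral_completion)
      also have "\<dots> = (\<integral>\<^sup>+w. (ennreal (cmod (fU w)))\<^sup>2 \<partial>lborel)"
        by (intro nn_integral_cong) (auto simp: fU_def ennreal_power split: split_indicator)
      finally show ?thesis by simp
    qed
    have I2: "(\<integral>\<^sup>+z. (I z)\<^sup>2 \<partial>lborel) \<le> ennreal (C\<^sup>2 * F2)"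
      using schur_test[OF meas_pair L_sym _ hp L_test, of "\<lambda>w. ennreal (cmod (fU w))"] C F2
      unfolding I_def fU2 by (simp add: ennreal_mult ennreal_power)
    have I_fin: "AE z in lborel. I z < \<infinity>"
    proof -
      have "AE z in lborel. (I z)\<^sup>2 \<noteq> \<infinity>"
        using I2 by (intro nn_integral_noteq_infinite) (auto simp: top_unique)
      then show ?thesis by eventually_elim (auto simp: less_top power2_eq_square ennreal_mult_eq_top_iff)
    qed
    define G where "G = (\<lambda>z w. indicator ?U z *\<^sub>R (indicator ?U w *\<^sub>R ((v z - v w) * fU w * thullen_kernel \<alpha> z w)))"
    have G_pair: "case_prod G \<in> borel_measurable (borel \<Otimes>\<^sub>M lborel)"
    proof -
      have "case_prod G \<in> borel_measurable (borel :: ((complex \<times> complex) \<times> (complex \<times> complex)) measure)"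
        unfolding G_def case_prod_unfold by measurable
      moreover have "sets (borel \<Otimes>\<^sub>M lborel) = sets (borel :: ((complex \<times> complex) \<times> (complex \<times> complex)) measure)"
      proof -
        have "sets ((borel :: (complex \<times> complex) measure) \<Otimes>\<^sub>M lborel) = sets (borel \<Otimes>\<^sub>M (borel :: (complex \<times> complex) measure))"
          by (rule sets_pair_measure_cong) simp_all
        then show ?thesis by (simp only: borel_prod)
      qed
      ultimately show ?thesis by (subst measurable_cong_sets[OF _ refl])
    qed
    have G_meas: "G z \<in> borel_measurable borel" for z
      using measurable_Pair2[OF G_pair, of z] by simp
    have G_le: "ennreal (norm (G z w)) \<le> ennreal c * (L z w * ennreal (cmod (fU w)))" for z w
    proof (cases "z \<in> ?U \<and> w \<in> ?U")
      case True
      then have "cmod (thullen_kernel \<alpha> z w) \<le> c * kernel_size \<alpha> z w"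
        unfolding c_def using norm_thullen_kernel_le[OF \<alpha>] by blast
      then have "norm (G z w) \<le> cmod (v z - v w) * cmod (fU w) * (c * kernel_size \<alpha> z w)"
        using True by (auto simp: G_def norm_mult intro!: mult_left_mono)
      then have "ennreal (norm (G z w)) \<le> ennreal (c * ((cmod (v z - v w) * kernel_size \<alpha> z w) * cmod (fU w)))"
        by (intro ennreal_leI) (simp add: mult_ac)
      also have "\<dots> = ennreal c * (ennreal (cmod (v z - v w) * kernel_size \<alpha> z w) * ennreal (cmod (fU w)))"
        using True c kernel_size_pos[OF \<alpha>, of z w] by (simp add: ennreal_mult)
      finally show ?thesis using True by (simp add: L_def)
    qed (auto simp: G_def)
    have G_nn: "(\<integral>\<^sup>+w. ennreal (norm (G z w)) \<partial>lborel) \<le> ennreal c * I z" for z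
    proof -
      have "(\<integral>\<^sup>+w. ennreal (norm (G z w)) \<partial>lborel) \<le> (\<integral>\<^sup>+w. ennreal c * (L z w * ennreal (cmod (fU w))) \<partial>lborel)"
        by (intro nn_integral_mono G_le)
      also have "\<dots> = ennreal c * I z"
        unfolding I_def using measurable_Pair2[OF meas_pair, of z] by (intro nn_integral_cmult) simp
      finally show ?thesis .
    qed
    define H where "H = (\<lambda>z. LINT w|lborel. G z w)"
    have H_meas[measurable]: "H \<in> borel_measurable borel"
      unfolding H_def using G_pair by (rule lborel.borel_measurable_lebesgue_integral)
    have H_le: "ennreal (norm (H z)) \<le> ennreal c * I z" for z
    proof -
      have "ennreal (norm (H z)) \<le> (\<integral>\<^sup>+w. ennreal (norm (G z w)) \<partial>lborel)"
      proof (cases "integrable lborel (G z)")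
        case True
        then show ?thesis unfolding H_def by (rule integral_norm_bound_ennreal)
      qed (simp add: H_def not_integrable_integral_eq)
      also have "\<dots> \<le> ennreal c * I z" by (rule G_nn)
      finally show ?thesis .
    qed
    have good: "AE z in lborel. z \<in> ?U \<longrightarrow> integrable (lebesgue_on ?U) (hankel_integrand ?U u f z) \<and> hankel ?U u f z = H z"
      using uv I_fin
    proof eventually_elim
      case (elim z)
      show ?case
      proof
        assume z: "z \<in> ?U"
        define J where "J = (\<lambda>w. indicator ?U w *\<^sub>R hankel_integrand ?U u f z w)"
        have JG: "AE w in lborel. J w = G z w"
          using uv
        proof eventually_elim
          case (elim w)
          then show ?case using \<open>z \<in> ?U \<longrightarrow> u z = v z\<close> z bergman_kernel_U_dom[OF \<alpha> z, of w]
            by (auto simp: J_def G_def hankel_integrand_def fU_def split: split_indicator)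
        qed
        have Gz: "integrable lborel (G z)"
          unfolding integrable_iff_bounded
        proof
          show "G z \<in> borel_measurable lborel" using G_meas by simp
          have "ennreal c * I z < \<infinity>" using elim(2) by (simp add: ennreal_mult_less_top)
          with G_nn[of z] show "(\<integral>\<^sup>+w. ennreal (norm (G z w)) \<partial>lborel) < \<infinity>" by (rule le_less_trans)
        qed
        have J_leb: "J \<in> borel_measurable lebesgue"
          by (rule measurable_lebesgue_AE_eq[OF _ JG]) (use G_meas in simp)
        have "integrable lebesgue (G z)" using Gz G_meas[of z] by (simp add: integrable_completion)
        then have "integrable lebesgue J"
          by (rule integrable_cong_AE_imp[OF _ J_leb]) (use AE_completion[OF JG] in \<open>auto elim: eventually_mono\<close>)
        moreover have "(LINT w|lebesgue. J w) = H z"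
        proof -
          have "(LINT w|lebesgue. J w) = (LINT w|lebesgue. G z w)"
            using J_leb measurable_completion[of "G z" lborel borel] G_meas[of z] AE_completion[OF JG]
            by (intro integral_cong_AE) auto
          then show ?thesis using G_meas[of z] by (simp add: H_def integral_completion)
        qed
        ultimately show "integrable (lebesgue_on ?U) (hankel_integrand ?U u f z) \<and> hankel ?U u f z = H z"
          by (simp add: J_def hankel_def integrable_restrict_space integral_restrict_space)
      qed
    qed
    have AE_U: "(AE z in lebesgue_on ?U. P z) \<longleftrightarrow> (AE z in lborel. z \<in> ?U \<longrightarrow> P z)" for P
      by (simp add: AE_restrict_space_iff AE_completion_iff)
    have hk_int: "AE z in lebesgue_on ?U. integrable (lebesgue_on ?U) (hankel_integrand ?U u f z)"
      unfolding AE_U using good by eventually_elim auto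
    have hkH: "AE z in lborel. indicator ?U z *\<^sub>R hankel ?U u f z = indicator ?U z *\<^sub>R H z"
      using good by eventually_elim (auto split: split_indicator)
    have hk_meas: "hankel ?U u f \<in> borel_measurable (lebesgue_on ?U)"
      unfolding borel_measurable_restrict_space_iff[of ?U lebesgue, simplified]
      by (rule measurable_lebesgue_AE_eq[OF _ hkH]) simp
    have hk2: "(\<integral>\<^sup>+z. ennreal (cmod (hankel ?U u f z) powr 2) \<partial>lebesgue_on ?U) \<le> ennreal ((c * C)\<^sup>2 * F2)"
    proof -
      have "(\<integral>\<^sup>+z. ennreal (cmod (hankel ?U u f z) powr 2) \<partial>lebesgue_on ?U) =
         (\<integral>\<^sup>+z\<in>?U. ennreal (cmod (hankel ?U u f z) powr 2) \<partial>lborel)"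
        by (simp add: nn_integral_restrict_space nn_integral_completion)
      also have "\<dots> \<le> (\<integral>\<^sup>+z. (ennreal c)\<^sup>2 * (I z)\<^sup>2 \<partial>lborel)"
        using good
      proof (intro nn_integral_mono_AE, eventually_elim)
        case (elim z)
        have "(ennreal (norm (H z)))\<^sup>2 \<le> (ennreal c * I z)\<^sup>2" by (intro power_mono H_le) auto
        then show ?case using elim
          by (auto simp: ennreal_power power_mult_distrib split: split_indicator)
      qed
      also have "\<dots> = (ennreal c)\<^sup>2 * (\<integral>\<^sup>+z. (I z)\<^sup>2 \<partial>lborel)" by (rule nn_integral_cmult) measurable
      also have "\<dots> \<le> (ennreal c)\<^sup>2 * ennreal (C\<^sup>2 * F2)" by (intro mult_left_mono I2) auto
      also have "\<dots> = ennreal ((c * C)\<^sup>2 * F2)"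
        using c F2 by (simp add: ennreal_power ennreal_mult[symmetric] power_mult_distrib mult_ac)
      finally show ?thesis .
    qed
    have hk_int2: "integrable (lebesgue_on ?U) (\<lambda>z. cmod (hankel ?U u f z) powr 2)"
      unfolding integrable_iff_bounded using hk_meas hk2 by (auto intro: le_less_trans)
    have "ennreal (LINT z|lebesgue_on ?U. cmod (hankel ?U u f z) powr 2) \<le> ennreal ((c * C)\<^sup>2 * F2)"
      using hk2 hk_int2 by (subst nn_integral_eq_integral[symmetric]) auto
    then have le: "(LINT z|lebesgue_on ?U. cmod (hankel ?U u f z) powr 2) \<le> (c * C)\<^sup>2 * F2"
      using F2 by (subst (asm) ennreal_le_iff) auto
    have "Lp_norm 2 (lebesgue_on ?U) (hankel ?U u f) \<le> ((c * C)\<^sup>2 * F2) powr (1 / 2)"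
      unfolding Lp_norm_def using le by (intro powr_mono2) (auto intro!: Bochner_Integration.integral_nonneg)
    also have "\<dots> = c * C * Lp_norm 2 (lebesgue_on ?U) f"
      unfolding Lp_norm_def F2_def[symmetric] using c C F2
      by (simp add: powr_half_sqrt real_sqrt_mult)
    finally show ?thesis using hk_int hk_meas hk_int2 by (simp add: Lp_space_def)
  qed
  then show ?thesis unfolding hankel_bounded_def by blast
qed

theorem corollary3p3:
  fixes \<alpha> p :: real and u :: "complex \<times> complex \<Rightarrow> complex"
  assumes "\<alpha> > 0" and "\<alpha> \<noteq> 1" and "p > 4"
    and "u \<in> borel_measurable (lebesgue_on (U_dom \<alpha>))"
    and "\<And>z. z \<in> U_dom \<alpha> \<Longrightarrow> oscillation \<alpha> u z \<in> Lp_space p (lebesgue_on (U_dom \<alpha>))"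
    and "bdd_above ((\<lambda>z. Lp_norm p (lebesgue_on (U_dom \<alpha>)) (oscillation \<alpha> u z)) ` U_dom \<alpha>)"
  shows "hankel_bounded (U_dom \<alpha>) u"
proof -
  let ?U = "U_dom \<alpha>"
  have \<alpha>: "\<alpha> > 0" and p: "p > 4" by fact+
  obtain m where m: "\<And>z. z \<in> ?U \<Longrightarrow> Lp_norm p (lebesgue_on ?U) (oscillation \<alpha> u z) \<le> m"
    using assms(6) by (auto simp: bdd_above_def)
  define K where "K = max 1 (1 / \<alpha>) / min 1 (1 / \<alpha>) * m powr p"
  have K: "0 \<le> K" using \<alpha> by (simp add: K_def)
  have "(\<lambda>x. indicator ?U x *\<^sub>R u x) \<in> borel_measurable lebesgue"
    using assms(4) by (simp add: borel_measurable_restrict_space_iff)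
  then obtain v where v[measurable]: "v \<in> borel_measurable borel" and "AE x in lborel. indicator ?U x *\<^sub>R u x = v x"
    by (rule lebesgue_measurable_borel_representative)
  then have uv: "AE w in lborel. w \<in> ?U \<longrightarrow> u w = v w"
    by (auto elim!: eventually_mono)
  have osc: "(\<integral>\<^sup>+x\<in>?U. ennreal (cmod (oscillation \<alpha> u z x) powr p) \<partial>lborel) \<le> ennreal (m powr p)"
    if z: "z \<in> ?U" for z
  proof -
    define S where "S = (LINT x|lebesgue_on ?U. cmod (oscillation \<alpha> u z x) powr p)"
    have S: "0 \<le> S" by (simp add: S_def)
    have "S powr (1 / p) \<le> m" using m[OF z] by (simp add: Lp_norm_def S_def)
    then have "(S powr (1 / p)) powr p \<le> m powr p" using p by (intro powr_mono2) auto
    then have Sm: "S \<le> m powr p" using S p by (simp add: powr_powr)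
    have "(\<integral>\<^sup>+x\<in>?U. ennreal (cmod (oscillation \<alpha> u z x) powr p) \<partial>lborel) =
        (\<integral>\<^sup>+x. ennreal (cmod (oscillation \<alpha> u z x) powr p) \<partial>lebesgue_on ?U)"
      by (simp add: nn_integral_restrict_space nn_integral_completion)
    also have "\<dots> = ennreal S"
      unfolding S_def using assms(5)[OF z] by (intro nn_integral_eq_integral) (auto simp: Lp_space_def)
    finally show ?thesis using Sm by (simp add: ennreal_leI)
  qed
  have moment: "(\<integral>\<^sup>+w\<in>?U. ennreal (cmod (u z - v w) powr p) * ennreal ((kernel_size \<alpha> z w)\<^sup>2 / kernel_diag \<alpha> z) \<partial>lborel) \<le> ennreal K"
    if z: "z \<in> ?U" for z
  proof -
    have "(\<integral>\<^sup>+w\<in>?U. ennreal (cmod (u z - v w) powr p) * ennreal ((kernel_size \<alpha> z w)\<^sup>2 / kernel_diag \<alpha> z) \<partial>lborel) \<le>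
       ennreal (max 1 (1 / \<alpha>) / min 1 (1 / \<alpha>)) *
       (\<integral>\<^sup>+x\<in>?U. ennreal (cmod (u z - v (varphi_map \<alpha> (snd z) (phi_map \<alpha> (f_fun \<alpha> z) x))) powr p) \<partial>lborel)"
      by (rule nn_integral_kernel_weight_le[OF \<alpha> z, of "\<lambda>w. ennreal (cmod (u z - v w) powr p)"]) measurable
    also have "(\<integral>\<^sup>+x\<in>?U. ennreal (cmod (u z - v (varphi_map \<alpha> (snd z) (phi_map \<alpha> (f_fun \<alpha> z) x))) powr p) \<partial>lborel) =
        (\<integral>\<^sup>+x\<in>?U. ennreal (cmod (oscillation \<alpha> u z x) powr p) \<partial>lborel)"
      using AE_varphi_phi[OF \<alpha> z uv]
      by (intro nn_integral_cong_AE) (auto simp: oscillation_def elim!: eventually_mono split: split_indicator)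
    also have "ennreal (max 1 (1 / \<alpha>) / min 1 (1 / \<alpha>)) * \<dots> \<le> ennreal (max 1 (1 / \<alpha>) / min 1 (1 / \<alpha>)) * ennreal (m powr p)"
      by (intro mult_left_mono osc[OF z]) auto
    also have "\<dots> = ennreal K" unfolding K_def using \<alpha> by (intro ennreal_mult[symmetric]) auto
    finally show ?thesis .
  qed
  obtain a b C where C: "0 \<le> C" and test: "\<forall>z\<in>?U. \<forall>g\<in>borel_measurable borel. (\<forall>w. 0 \<le> g w) \<longrightarrow>
      (\<integral>\<^sup>+w\<in>?U. ennreal (g w powr p) * ennreal ((kernel_size \<alpha> z w)\<^sup>2 / kernel_diag \<alpha> z) \<partial>lborel) \<le> ennreal K \<longrightarrow>
      (\<integral>\<^sup>+w\<in>?U. ennreal (g w * kernel_size \<alpha> z w * schur_weight \<alpha> a b w) \<partial>lborel) \<le> ennreal (C * schur_weight \<alpha> a b z)"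
    using schur_bound_of_moment[OF \<alpha> p K] by (elim exE conjE) (rule that)
  show ?thesis
  proof (rule hankel_bounded_of_schur[OF \<alpha> assms(4) v uv C])
    show "(\<integral>\<^sup>+w\<in>?U. ennreal (cmod (u z - v w) * kernel_size \<alpha> z w * schur_weight \<alpha> a b w) \<partial>lborel)
        \<le> ennreal (C * schur_weight \<alpha> a b z)" if "z \<in> ?U" for z
      using test[rule_format, OF that _ _ moment[OF that]] by simp
  qed
qed

end
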